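(* Let $\xi=\frac{2^8\cdot5^2}{3\cdot19^2\cdot89^2}$, $1-\xi\leq\sigma_0\leq1$, $s_0=\sigma_0+it_0$ with $t_0\in\mathbb{R}$, $r>0$, and let $f:\mathcal{K}\to\mathbb{C}$ be continuous on $\mathcal{K}=\{s\in\mathbb{C}:|s-s_0|\leq r\}$ and analytic in the interior of $\mathcal{K}$. Let $0<A<1$ and $\varepsilon\in(0,|f(s_0)|)$. Let $d_0\geq3$ be defined by $$d_0+\frac1{2d_0}=\frac{40}{267}\left(\frac1{3(1-\sigma_0)}\right)^{1/2}$$ ($d_0=+\infty$ if $\sigma_0=1$). Then for every sufficiently large $N\in\mathbb{N}$ (in terms of $f$ and $\varepsilon$) there are effectively computable positive integers $Q\ge 2$ and $M$, depending only on $\sigma_0$, $N$, $A$, $\varepsilon$ and the Taylor data $f^{(k)}(s_0)$, $k=0,\dots,N$, such that the following holds. All but finitely many algebraic irrationals $\alpha\in[A,1]$ of degree $d(\alpha)\leq d_0-1$ belong to $\mathcal{A}(Q,M)$ (so the set of exceptional $\alpha$ is described effectively), and for every real $d$ with $3\leq d\leq d_0$, $d<\infty$, there are positive effectively computable numbers $c_5=c_5(N,d)$ and $\nu=\nu(d,N)$ such that for every $\alpha\in\mathcal{A}(Q,M)\cap[A,1]$ of degree $d(\alpha)\leq d-1$ and every $$T\geq c_5\max\left\{\left(\mathbf{K}(Q,M,\alpha)\exp\left((M+2)\exp\left(Q^2\right)\right)\right)^{\frac{4d}{4(d-d(\alpha))-3}},\ \varepsilon^{-2\nu}\right\}$$ there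 exist real numbers $\tau\in[T,2T]$ and $\delta=\delta(\varepsilon,f,T)>0$, $\delta\le 1$, with $$\max_{|s-s_0|\leq\delta r}\left|\zeta(s+i\tau;\alpha)-f(s)\right|<3\varepsilon.$$
   Context: $\zeta(s;\alpha)$ is the Hurwitz zeta-function: for $\alpha\in(0,1]$ and $\Re s>1$, $\zeta(s;\alpha)=\sum_{n=0}^\infty(n+\alpha)^{-s}$, continued analytically to $\mathbb{C}\setminus\{1\}$ (simple pole at $s=1$). $\mathbb{N}$ is the set of positive integers. The height $H(P)$ of a polynomial $P$ is the maximum of the absolute values of its coefficients. For an algebraic number $\alpha$, $d(\alpha)$ and $H(\alpha)$ are the degree and the height of its minimal polynomial over $\mathbb{Z}$. $\mathbb{A}$ is the set of algebraic irrational numbers in $[0,1]$. For positive integers $Q,M$ and $\underline{m}=(m_0,\dots,m_{Q-1})\in\mathbb{Z}^Q\setminus\{\underline{0}\}$ put $$Q^+_{\underline m}(x)=\prod_{0\le n\le Q-1,\ m_n>0}(n+x)^{m_n},\qquad Q^-_{\underline m}(x)=\prod_{0\le n\le Q-1,\ m_n<0}(n+x)^{-m_n}$$ (empty products equal $1$). Let $\hat M=\mathbb{Z}^Q\cap[-M,M]^Q$ and $\mathcal{P}(Q,M)=\{Q^+_{\underline m}-Q^-_{\underline m}:\underline m\in\hat M\setminus\{\underline 0\}\}$; this is a finite set of non-zero integer polynomials of degree at most $MQ$, and $\mathbf{H}(Q,M)$ denotes a constant bounding the heights of all its elements. Put $\mathcal{A}(Q,M)=\mathcal{A}_1\cup\mathcal{A}_2$,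 where $\mathcal{A}_1=\{\alpha\in\mathbb{A}:d(\alpha)>MQ+1\}$, $\mathcal{A}_2=\bigcap_{\underline m\in\hat M\setminus\{\underline 0\}}\mathcal{A}_{2\underline m}$, and $$\mathcal{A}_{2\underline m}=\left\{\alpha\in\mathbb{A}\setminus\mathcal{A}_1:\ \frac{Q^+_{\underline m}(\alpha)}{Q^-_{\underline m}(\alpha)}\neq\frac{x+\alpha}{y+\alpha}\ \text{ for all integers }x,y\in[Q,\exp(2Q^2)]\right\}.$$ Finally, $$\mathbf{K}(Q,M,\alpha)=\left[\mathbf{H}(Q,M)(MQ+2)\right]^{d(\alpha)-1}\left[H(\alpha)(d(\alpha)+1)^{1/2}\right]^{MQ+1}.$$ *)

theory Defs
  imports
    "HOL-Complex_Analysis.Complex_Analysis"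
    "HOL-Computational_Algebra.Computational_Algebra"
    "HOL-Library.FuncSet"
    "HOL-Library.Nat_Bijection"
    "HOL-Library.Extended_Real"
begin

section \<open>The Hurwitz zeta-function\<close>

text \<open>By the identity theorem the continuation of the Dirichlet series to the punctured plane is
  unique; the third conjunct only fixes a dummy value at the pole.\<close>

definition hurwitz_zeta :: "complex \<Rightarrow> real \<Rightarrow> complex" where
  "hurwitz_zeta s \<alpha> =
     (THE g. g holomorphic_on (- {1}) \<and>
             (\<forall>z. Re z > 1 \<longrightarrow> g z = (\<Sum>n. complex_of_real (real n + \<alpha>) powr (- z))) \<and>
             g 1 = 0) s"


section \<open>Heights and degrees\<close>

abbreviation ipoly :: "int poly \<Rightarrow> real \<Rightarrow> real" where
  "ipoly p x \<equiv> poly (map_poly real_of_int p) x"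

text \<open>The range below is finite because it contains only finitely many nonzero values.\<close>

definition poly_height :: "int poly \<Rightarrow> int" where
  "poly_height p = Max (range (\<lambda>i. \<bar>coeff p i\<bar>))"

text \<open>Irreducibility in \<open>\<int>[x]\<close> includes primitivity, so for algebraic \<open>\<alpha>\<close> the description is unique.\<close>

definition min_int_poly :: "real \<Rightarrow> int poly" where
  "min_int_poly \<alpha> = (THE p. irreducible p \<and> lead_coeff p > 0 \<and> ipoly p \<alpha> = 0)"

definition alg_degree :: "real \<Rightarrow> nat" where
  "alg_degree \<alpha> = degree (min_int_poly \<alpha>)"

definition alg_height :: "real \<Rightarrow> int" where
  "alg_height \<alpha> = poly_height (min_int_poly \<alpha>)"

definition alg_irrationals :: "real set" where
  "alg_irrationals = {\<alpha> \<in> {0..1}. algebraic \<alpha> \<and> \<alpha> \<notin> \<rat>}"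


section \<open>The polynomials attached to exponent vectors, and the admissible parameters\<close>

definition Qplus :: "nat \<Rightarrow> (nat \<Rightarrow> int) \<Rightarrow> int poly" where
  "Qplus Q m = (\<Prod>n\<in>{n. n < Q \<and> m n > 0}. [:int n, 1:] ^ nat (m n))"

definition Qminus :: "nat \<Rightarrow> (nat \<Rightarrow> int) \<Rightarrow> int poly" where
  "Qminus Q m = (\<Prod>n\<in>{n. n < Q \<and> m n < 0}. [:int n, 1:] ^ nat (- m n))"

definition exponent_vectors :: "nat \<Rightarrow> nat \<Rightarrow> (nat \<Rightarrow> int) set" where
  "exponent_vectors Q M = {m \<in> {..<Q} \<rightarrow>\<^sub>E {- int M..int M}. \<exists>n<Q. m n \<noteq> 0}"

definition difference_polys :: "nat \<Rightarrow> nat \<Rightarrow> int poly set" where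
  "difference_polys Q M = (\<lambda>m. Qplus Q m - Qminus Q m) ` exponent_vectors Q M"

definition admissible1 :: "nat \<Rightarrow> nat \<Rightarrow> real set" where
  "admissible1 Q M = {\<alpha> \<in> alg_irrationals. alg_degree \<alpha> > M * Q + 1}"

definition admissible2_at :: "nat \<Rightarrow> nat \<Rightarrow> (nat \<Rightarrow> int) \<Rightarrow> real set" where
  "admissible2_at Q M m =
     {\<alpha> \<in> alg_irrationals - admissible1 Q M.
        \<forall>x y :: int. real_of_int x \<in> {real Q..exp (2 * real Q ^ 2)} \<and>
                     real_of_int y \<in> {real Q..exp (2 * real Q ^ 2)} \<longrightarrow>
          ipoly (Qplus Q m) \<alpha> / ipoly (Qminus Q m) \<alpha> \<noteq>
            (real_of_int x + \<alpha>) / (real_of_int y + \<alpha>)}"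

definition admissible2 :: "nat \<Rightarrow> nat \<Rightarrow> real set" where
  "admissible2 Q M = (\<Inter>m\<in>exponent_vectors Q M. admissible2_at Q M m)"

definition admissible :: "nat \<Rightarrow> nat \<Rightarrow> real set" where
  "admissible Q M = admissible1 Q M \<union> admissible2 Q M"

text \<open>The argument \<open>H\<close> is any upper bound for the heights of the elements of \<open>difference_polys Q M\<close>.\<close>

definition bigK :: "real \<Rightarrow> nat \<Rightarrow> nat \<Rightarrow> real \<Rightarrow> real" where
  "bigK H Q M \<alpha> =
     (H * real (M * Q + 2)) ^ (alg_degree \<alpha> - 1) *
     (real_of_int (alg_height \<alpha>) * sqrt (real (alg_degree \<alpha>) + 1)) ^ (M * Q + 1)"


section \<open>The numerical parameters\<close>

definition xi_const :: real where
  "xi_const = (2 ^ 8 * 5 ^ 2) / (3 * 19 ^ 2 * 89 ^ 2)"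

definition is_d0 :: "real \<Rightarrow> ereal \<Rightarrow> bool" where
  "is_d0 \<sigma>0 d0 \<longleftrightarrow>
     (if \<sigma>0 = 1 then d0 = \<infinity>
      else \<exists>x::real. d0 = ereal x \<and> x \<ge> 3 \<and>
             x + 1 / (2 * x) = 40 / 267 * sqrt (1 / (3 * (1 - \<sigma>0))))"


section \<open>Effective computability\<close>

text \<open>Partial recursive functions relative to an oracle.\<close>

datatype recfn =
    RZero
  | RSucc
  | RProj nat
  | ROracle
  | RComp recfn "recfn list"
  | RPrim recfn recfn
  | RMin recfn

text \<open>\<open>rec_eval g p xs y\<close>: with oracle \<open>g\<close> the program \<open>p\<close> halts on input \<open>xs\<close> with result \<open>y\<close>.\<close>

inductive rec_eval :: "(nat \<Rightarrow> nat) \<Rightarrow> recfn \<Rightarrow> nat list \<Rightarrow> nat \<Rightarrow> bool" for g where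
  "rec_eval g RZero xs 0"
| "rec_eval g RSucc [x] (Suc x)"
| "i < length xs \<Longrightarrow> rec_eval g (RProj i) xs (xs ! i)"
| "rec_eval g ROracle [x] (g x)"
| "list_all2 (\<lambda>q y. rec_eval g q xs y) qs ys \<Longrightarrow> rec_eval g p ys z \<Longrightarrow>
     rec_eval g (RComp p qs) xs z"
| "rec_eval g p xs y \<Longrightarrow> rec_eval g (RPrim p q) (0 # xs) y"
| "rec_eval g (RPrim p q) (n # xs) y \<Longrightarrow> rec_eval g q (n # y # xs) z \<Longrightarrow>
     rec_eval g (RPrim p q) (Suc n # xs) z"
| "rec_eval g p (n # xs) 0 \<Longrightarrow> (\<And>i. i < n \<Longrightarrow> \<exists>y. rec_eval g p (i # xs) (Suc y)) \<Longrightarrow>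
     rec_eval g (RMin p) xs n"

inductive_cases rec_eval_elims:
  "rec_eval g RZero xs z"
  "rec_eval g RSucc xs z"
  "rec_eval g (RProj i) xs z"
  "rec_eval g ROracle xs z"
  "rec_eval g (RComp p qs) xs z"
  "rec_eval g (RPrim p q) (0 # xs) z"
  "rec_eval g (RPrim p q) (Suc n # xs) z"
  "rec_eval g (RMin p) xs z"

lemma rec_eval_deterministic:
  "rec_eval g p xs y \<Longrightarrow> rec_eval g p xs z \<Longrightarrow> y = z"
proof (induction arbitrary: z rule: rec_eval.induct)
  case (1 xs)
  from "1.prems" show ?case by (rule rec_eval_elims(1)) simp
next
  case (2 x)
  from "2.prems" show ?case by (rule rec_eval_elims(2)) simp
next
  case (3 i xs)
  from "3.prems" show ?case by (rule rec_eval_elims(3)) simp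
next
  case (4 x)
  from "4.prems" show ?case by (rule rec_eval_elims(4)) simp
next
  case (5 xs qs ys p y)
  from "5.prems" obtain ys' where ys': "list_all2 (\<lambda>q y. rec_eval g q xs y) qs ys'"
    and z: "rec_eval g p ys' z"
    by (rule rec_eval_elims(5))
  have "ys ! i = ys' ! i" if "i < length qs" for i
    using "5.IH"(1) ys' that unfolding list_all2_conv_all_nth by metis
  then have "ys = ys'"
    using list_all2_lengthD[OF "5.IH"(1)] list_all2_lengthD[OF ys']
    by (intro nth_equalityI) simp_all
  with z have "rec_eval g p ys z" by simp
  then show ?case by (rule "5.IH"(2))
next
  case (6 p xs y q)
  from "6.prems" have "rec_eval g p xs z" by (rule rec_eval_elims(6))
  then show ?case by (rule "6.IH")
next
  case (7 p q n xs y w)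
  from "7.prems" obtain y' where y': "rec_eval g (RPrim p q) (n # xs) y'"
    and z: "rec_eval g q (n # y' # xs) z"
    by (rule rec_eval_elims(7))
  from "7.IH"(1)[OF y'] z have "rec_eval g q (n # y # xs) z" by simp
  then show ?case by (rule "7.IH"(2))
next
  case (8 p n xs)
  from "8.prems" have z: "rec_eval g p (z # xs) 0"
    and below: "\<And>i. i < z \<Longrightarrow> \<exists>y. rec_eval g p (i # xs) (Suc y)"
    by (rule rec_eval_elims(8), simp)+
  show ?case
  proof (rule linorder_cases[of n z])
    assume "n < z"
    then obtain y where "rec_eval g p (n # xs) (Suc y)" using below by blast
    from "8.IH"(1)[OF this] show ?thesis by simp
  next
    assume "z < n"
    from "8.IH"(2)[OF this] obtain y where
      "\<forall>w. rec_eval g p (z # xs) w \<longrightarrow> Suc y = w" by blast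
    with z show ?thesis by blast
  qed
qed

text \<open>As in computable analysis, real numbers are presented to a program by dyadic approximations:
  \<open>k\<close> represents \<open>x\<close> to precision \<open>n\<close> if \<open>|x - int_decode k / 2^n| \<le> 1 / 2^n\<close>.\<close>

definition dyadic_approx :: "nat \<Rightarrow> nat \<Rightarrow> real \<Rightarrow> bool" where
  "dyadic_approx n k x \<longleftrightarrow> \<bar>x - real_of_int (int_decode k) / 2 ^ n\<bar> \<le> 1 / 2 ^ n"

text \<open>A program required to work for every name of \<open>xs\<close> can use no information beyond \<open>xs\<close>.
  Programs with integer output may return different values for different names of the same reals
  (a single-valued computable map from a connected set of reals to the integers is constant);
  fixing one name for each list of reals yields a genuine function of that list.\<close>

definition is_name :: "(nat \<Rightarrow> nat) \<Rightarrow> real list \<Rightarrow> bool" where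
  "is_name g xs \<longleftrightarrow> (\<forall>j<length xs. \<forall>n. dyadic_approx n (g (prod_encode (j, n))) (xs ! j))"

text \<open>\<open>F N d\<close> is uniformly computable from the positive integer \<open>N\<close> and the real number \<open>d \<in> D\<close>.\<close>

definition computable_nat_real :: "(nat \<Rightarrow> real \<Rightarrow> real) \<Rightarrow> real set \<Rightarrow> bool" where
  "computable_nat_real F D \<longleftrightarrow>
     (\<exists>p. \<forall>N\<ge>1. \<forall>d\<in>D. \<forall>g. is_name g [d] \<longrightarrow>
        (\<forall>n. \<exists>k. rec_eval g p [N, n] k \<and> dyadic_approx n k (F N d)))"

text \<open>The data on which the integers \<open>Q\<close> and \<open>M\<close> may depend, besides \<open>N\<close>.\<close>

definition input_data :: "real \<Rightarrow> real \<Rightarrow> real \<Rightarrow> (complex \<Rightarrow> complex) \<Rightarrow> complex \<Rightarrow> nat \<Rightarrow> real list" where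
  "input_data \<sigma>0 A \<epsilon> f s0 N =
     [\<sigma>0, A, \<epsilon>] @
     concat (map (\<lambda>k. [Re ((deriv ^^ k) f s0), Im ((deriv ^^ k) f s0)]) [0..<Suc N])"

end

theory Submission
  imports Defs "HOL-Real_Asymp.Real_Asymp" "Subresultants.Subresultant_Gcd"
begin

text \<open>
  The disc on which \<open>\<zeta>(s + i\<tau>; \<alpha>)\<close> has to be close to \<open>f\<close> may shrink with \<open>T\<close>. As \<open>\<zeta>(\<cdot>; \<alpha>)\<close> is
  Lipschitz near the line in question with a constant that depends only on \<open>T\<close>
  (\<open>exists_common_radius\<close>), it suffices to find \<open>\<tau> \<in> [T, 2T]\<close> such that \<open>\<zeta>(s0 + i\<tau>; \<alpha>)\<close> is close to the
  single number \<open>w = f(s0)\<close>. This is \<open>point_approximation\<close>, and it is proved by an average.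

  Up to a negligible error (\<open>hurwitz_zeta_remainder_le\<close>), \<open>\<zeta>(s0 + i\<tau>; \<alpha>)\<close> is the sum of
  \<open>(n + \<alpha>) powr (- s0 - i\<tau>)\<close> over \<open>n < X\<close>, where \<open>X\<close> is about \<open>T\<^sup>2\<close>. The moduli \<open>a n = (n + \<alpha>) powr (- \<sigma>)\<close>
  have a divergent sum because \<open>\<sigma> \<le> 1\<close>. Hence, once \<open>Q\<close> is large compared with \<open>1 / A\<close> and \<open>\<bar>w\<bar>\<close>, a closed
  polygon with sides \<open>a 0, \<dots>, a (Q - 1)\<close> and \<open>\<bar>w\<bar>\<close> exists: there are unimodular \<open>u n\<close> with
  \<open>\<Sum>n<Q. a n * u n = w\<close> exactly (\<open>polygon\<close>). The nonnegative weight
  \<open>K \<tau> = (\<Prod>n<Q. ((1 + cos \<theta>\<^sub>n) / 2) ^ k)\<close>, where \<open>\<theta>\<^sub>n\<close> is the angle between \<open>(n + \<alpha>) powr (- i(t0 + \<tau>))\<close> and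
  \<open>u n\<close>, is concentrated on those \<open>\<tau>\<close> for which all the angles are small. The mean over \<open>[T, 2T]\<close> of
  \<open>K \<tau> * \<bar>\<zeta>(s0 + i\<tau>; \<alpha>) - w\<bar>\<^sup>2\<close> is compared with the mean of \<open>K\<close> in three ranges of \<open>n\<close>
  (\<open>weighted_distance_to_target\<close>).

  For \<open>n < Q\<close> the weight itself makes the contribution small. For \<open>Q \<le> n < Y\<close>, with \<open>Y\<close> about \<open>2 ^ Q\<^sup>2\<close>, one
  expands \<open>K\<close> and the square; the diagonal gives the convergent tail \<open>\<Sum>n\<ge>Q. (a n)\<^sup>2\<close>, and the
  remaining frequencies \<open>\<Sum>n<Q. \<mu> n * ln (n + \<alpha>) + ln (y + \<alpha>) - ln (x + \<alpha>)\<close> are nonzero because \<open>\<alpha>\<close> is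
  admissible. They are even bounded away from zero by a Liouville inequality
  (\<open>liouville_inequality\<close>, \<open>frequency_separation\<close>) whose constant \<open>T\<close> dominates. For \<open>n \<ge> Y\<close> the trivial
  bound \<open>K \<le> 1\<close> and the unweighted mean square suffice: this loses a factor \<open>(2 * k + 1) ^ Q\<close>, which
  bounds the ratio of the maximum of \<open>K\<close> to its mean, and \<open>Y\<close> is a larger power of it.

  The parameters are \<open>Q = 2 ^ 2 ^ (n + N)\<close>, where a program finds \<open>n\<close> with \<open>1 / 2 ^ n \<le> A\<close> from a name of \<open>A\<close>, and
  \<open>M = 2 ^ 2 ^ Q\<close>; every \<open>N\<close> that is large in terms of \<open>f\<close> and \<open>\<epsilon>\<close> is admitted. As \<open>M\<close> is enormous compared
  with the exponents \<open>k = Q ^ 5\<close> that occur in \<open>K\<close>, the constants \<open>c5 = \<nu> = 1\<close> are good enough. The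
  exceptional \<open>\<alpha>\<close> are roots of finitely many nonzero polynomials (\<open>finite_exceptional\<close>).
\<close>

section \<open>Programs for the parameters\<close>

definition rf_one :: recfn where "rf_one = RComp RSucc [RZero]"
definition rf_add :: recfn where "rf_add = RPrim (RProj 0) (RComp RSucc [RProj 1])"
definition rf_exp2 :: recfn where
  "rf_exp2 = RPrim rf_one (RComp rf_add [RProj 1, RProj 1])"
definition rf_pred :: recfn where "rf_pred = RPrim RZero (RProj 0)"
text \<open>Truncated subtraction with the arguments in reverse order, the recursion being on the subtrahend.\<close>

definition rf_rsub :: recfn where
  "rf_rsub = RPrim (RProj 0) (RComp rf_pred [RProj 1])"
definition rf_triangle :: recfn where
  "rf_triangle = RPrim RZero (RComp rf_add [RComp RSucc [RProj 0], RProj 1])"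
definition rf_four :: recfn where
  "rf_four = RComp rf_exp2 [RComp RSucc [rf_one]]"

lemma rec_eval_comp1:
  assumes "rec_eval g q xs y" "rec_eval g p [y] z"
  shows "rec_eval g (RComp p [q]) xs z"
  by (rule rec_eval.intros(5)[where ys = "[y]"]) (use assms in simp_all)

lemma rec_eval_comp2:
  assumes "rec_eval g q1 xs y1" "rec_eval g q2 xs y2" "rec_eval g p [y1, y2] z"
  shows "rec_eval g (RComp p [q1, q2]) xs z"
  by (rule rec_eval.intros(5)[where ys = "[y1, y2]"]) (use assms in simp_all)

lemma rec_eval_proj0: "rec_eval g (RProj 0) (x # xs) x"
  using rec_eval.intros(3)[of 0 "x # xs" g] by simp

lemma rec_eval_proj1: "rec_eval g (RProj 1) (x # y # xs) y"
  using rec_eval.intros(3)[of 1 "x # y # xs" g] by simp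

lemma rec_eval_one: "rec_eval g rf_one xs 1"
  unfolding rf_one_def using rec_eval_comp1[OF rec_eval.intros(1) rec_eval.intros(2)] by simp

lemma rec_eval_add: "rec_eval g rf_add [m, n] (m + n)"
proof (induction m)
  case 0
  show ?case unfolding rf_add_def
    by (rule rec_eval.intros(6)) (simp add: rec_eval_proj0)
next
  case (Suc m)
  have "rec_eval g (RComp RSucc [RProj 1]) [m, m + n, n] (Suc (m + n))"
    by (rule rec_eval_comp1 rec_eval_proj1 rec_eval.intros(2))+
  with Suc show ?case unfolding rf_add_def by (auto intro: rec_eval.intros(7))
qed

lemma rec_eval_exp2: "rec_eval g rf_exp2 [n] (2 ^ n)"
proof (induction n)
  case 0
  show ?case unfolding rf_exp2_def
    using rec_eval.intros(6)[OF rec_eval_one] by simp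
next
  case (Suc n)
  have "rec_eval g (RComp rf_add [RProj 1, RProj 1]) [n, 2 ^ n] (2 ^ n + 2 ^ n)"
    by (rule rec_eval_comp2 rec_eval_proj1 rec_eval_add)+
  with Suc show ?case unfolding rf_exp2_def
    by (auto intro!: rec_eval.intros(7) simp: mult_2)
qed

lemma rec_eval_pred: "rec_eval g rf_pred [n] (n - 1)"
proof (cases n)
  case 0
  then show ?thesis unfolding rf_pred_def by (auto intro: rec_eval.intros)
next
  case (Suc m)
  have "\<exists>y. rec_eval g (RPrim RZero (RProj 0)) [m] y"
    by (induction m) (auto intro: rec_eval.intros rec_eval_proj0)
  then show ?thesis unfolding rf_pred_def Suc
    by (auto intro: rec_eval.intros(7) rec_eval_proj0)
qed

lemma rec_eval_rsub: "rec_eval g rf_rsub [k, c] (c - k)"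
proof (induction k)
  case 0
  show ?case unfolding rf_rsub_def
    by (rule rec_eval.intros(6)) (simp add: rec_eval_proj0)
next
  case (Suc k)
  have "rec_eval g (RComp rf_pred [RProj 1]) [k, c - k, c] (c - k - 1)"
    by (rule rec_eval_comp1 rec_eval_proj1 rec_eval_pred)+
  then have "rec_eval g (RComp rf_pred [RProj 1]) [k, c - k, c] (c - Suc k)"
    by simp
  with Suc show ?case unfolding rf_rsub_def by (blast intro: rec_eval.intros(7))
qed

lemma rec_eval_triangle: "rec_eval g rf_triangle [n] (triangle n)"
proof (induction n)
  case 0
  show ?case unfolding rf_triangle_def by (auto intro: rec_eval.intros)
next
  case (Suc n)
  have "rec_eval g (RComp rf_add [RComp RSucc [RProj 0], RProj 1]) [n, triangle n]
      (Suc n + triangle n)"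
    by (rule rec_eval_comp2 rec_eval_comp1 rec_eval_proj0 rec_eval_proj1 rec_eval_add
        rec_eval.intros(2))+
  with Suc show ?case unfolding rf_triangle_def
    by (auto intro!: rec_eval.intros(7) simp: add.commute)
qed

lemma rec_eval_four: "rec_eval g rf_four xs 4"
  unfolding rf_four_def
  using rec_eval_comp1[OF rec_eval_comp1[OF rec_eval_one rec_eval.intros(2)] rec_eval_exp2]
  by (simp add: numeral_eq_Suc)

text \<open>The dyadic name of \<open>1\<close> to precision \<open>n\<close> has numerator \<open>2 ^ n\<close>, whose code is \<open>2 ^ (n + 1)\<close>.\<close>

lemma computable_nat_real_one: "computable_nat_real (\<lambda>_ _. 1) D"
  unfolding computable_nat_real_def
proof (intro exI allI impI ballI)
  fix N n :: nat and d :: real and g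
  have "rec_eval g (RComp rf_exp2 [RComp RSucc [RProj 1]]) [N, n] (2 ^ Suc n)"
    by (rule rec_eval_comp1 rec_eval_proj1 rec_eval_exp2 rec_eval.intros(2))+
  moreover have "int_decode (2 ^ Suc n) = 2 ^ n"
  proof -
    have "int_encode (2 ^ n) = 2 ^ Suc n"
      by (simp add: int_encode_def sum_encode_def nat_power_eq)
    then show ?thesis by (metis int_encode_inverse)
  qed
  ultimately show "rec_eval g (RComp rf_exp2 [RComp RSucc [RProj 1]]) [N, n] (2 ^ Suc n) \<and>
      dyadic_approx n (2 ^ Suc n) 1"
    by (simp add: dyadic_approx_def)
qed

text \<open>On input \<open>i\<close> this returns \<open>0\<close> iff the name of the second input real at precision \<open>i\<close> is a code \<open>\<ge> 4\<close>. Codes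
  of nonnegative integers \<open>z\<close> are \<open>2 * z\<close>, so that for a positive real the test succeeds iff
  the numerator is at least \<open>2\<close>.\<close>

definition rf_lower_test :: recfn where
  "rf_lower_test = RComp rf_rsub
     [RComp ROracle [RComp RSucc [RComp rf_triangle [RComp RSucc [RProj 0]]]], rf_four]"

lemma rec_eval_lower_test:
  "rec_eval g rf_lower_test (i # xs) (4 - g (prod_encode (1, i)))"
proof -
  have "rec_eval g (RComp RSucc [RComp rf_triangle [RComp RSucc [RProj 0]]]) (i # xs)
      (prod_encode (1, i))"
    using rec_eval_comp1[OF rec_eval_comp1[OF rec_eval_comp1[OF rec_eval_proj0
        rec_eval.intros(2)] rec_eval_triangle] rec_eval.intros(2)]
    by (simp add: prod_encode_def)
  from rec_eval_comp2[OF rec_eval_comp1[OF this rec_eval.intros(4)] rec_eval_four rec_eval_rsub]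
  show ?thesis unfolding rf_lower_test_def .
qed

text \<open>Since \<open>x > 0\<close>, the numerator \<open>z\<close> of the approximation exceeds \<open>-1\<close>, hence it is nonnegative and its
  code is even; a code \<open>\<ge> 4\<close> then means \<open>z \<ge> 2\<close>, and \<open>x \<ge> (z - 1) / 2 ^ n\<close>.\<close>

lemma dyadic_approx_lower_bound:
  assumes "dyadic_approx n k x" "k \<ge> 4" "x > 0"
  shows "1 / 2 ^ n \<le> x"
proof -
  define z where "z = int_decode k"
  have a: "\<bar>x - real_of_int z / 2 ^ n\<bar> \<le> 1 / 2 ^ n"
    using assms(1) by (simp add: dyadic_approx_def z_def)
  then have "x \<le> (real_of_int z + 1) / 2 ^ n" by (simp add: add_divide_distrib abs_le_iff)
  with assms(3) have "real_of_int z + 1 > 0"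
    by (metis divide_le_0_iff linorder_not_less order_less_le_trans zero_le_numeral zero_le_power)
  then have "z \<ge> 0" by linarith
  then have "k = 2 * nat z"
    by (metis z_def int_decode_inverse int_encode_def sum_encode_def sum.case(1) comp_apply)
  with assms(2) have "z \<ge> 2" by linarith
  then have "(1::real) \<le> real_of_int z - 1" by simp
  then have "1 / 2 ^ n \<le> (real_of_int z - 1) / (2::real) ^ n" by (intro divide_right_mono) auto
  also have "\<dots> \<le> x" using a by (simp add: diff_divide_distrib abs_le_iff)
  finally show ?thesis .
qed

lemma dyadic_approx_detects_positive:
  assumes "\<And>n. dyadic_approx n (c n) x" "x > 0"
  shows "\<exists>n. c n \<ge> 4"
proof -
  obtain n where n: "(1/2) ^ n < x / 3"
    using real_arch_pow_inv[of "x / 3" "1/2"] assms(2) by auto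
  define z where "z = int_decode (c n)"
  have "x - real_of_int z / 2 ^ n \<le> 1 / 2 ^ n"
    using assms(1)[of n] by (simp add: dyadic_approx_def z_def abs_le_iff)
  then have "x \<le> (real_of_int z + 1) / 2 ^ n" by (simp add: add_divide_distrib)
  then have "x \<le> (real_of_int z + 1) * (1/2) ^ n" by (simp add: power_divide)
  also have "\<dots> \<le> (real_of_int z + 1) * (x / 3)" if "real_of_int z + 1 \<ge> 0"
    using that n by (intro mult_left_mono) auto
  finally have "x \<le> (real_of_int z + 1) * (x / 3)" if "real_of_int z + 1 \<ge> 0" using that .
  moreover have "real_of_int z + 1 > 0"
    using assms(2) \<open>x \<le> (real_of_int z + 1) * (1/2) ^ n\<close>
    by (smt (verit) mult_nonpos_nonneg zero_le_power divide_nonneg_nonneg)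
  ultimately have "3 * x \<le> (real_of_int z + 1) * x" by simp
  with assms(2) have "z \<ge> 2" by auto
  moreover have "c n = int_encode z" by (simp add: z_def)
  ultimately show ?thesis
    by (intro exI[of _ n]) (simp add: int_encode_def sum_encode_def)
qed

definition rf_Q :: recfn where
  "rf_Q = RComp rf_exp2 [RComp rf_exp2 [RComp rf_add [RMin rf_lower_test, RProj 0]]]"
definition rf_M :: recfn where
  "rf_M = RComp rf_exp2 [RComp rf_exp2 [rf_Q]]"

text \<open>The unbounded search for a precision \<open>n\<close> at which \<open>A\<close> is visibly positive halts, and \<open>n\<close> yields the
  lower bound \<open>1 / 2 ^ n \<le> A\<close>. It depends on the name of \<open>A\<close>.\<close>

lemma rec_eval_Q_M:
  assumes "is_name g xs" "1 < length xs" "xs ! 1 > 0"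
  obtains n where "1 / 2 ^ n \<le> xs ! 1"
    "rec_eval g rf_Q [N] (2 ^ 2 ^ (n + N))" "rec_eval g rf_M [N] (2 ^ 2 ^ 2 ^ 2 ^ (n + N))"
proof -
  have ap: "dyadic_approx n (g (prod_encode (1, n))) (xs ! 1)" for n
    using assms by (auto simp: is_name_def)
  define n where "n = (LEAST n. g (prod_encode (1, n)) \<ge> 4)"
  have ex: "\<exists>n. g (prod_encode (1, n)) \<ge> 4"
    using dyadic_approx_detects_positive[OF ap assms(3)] .
  have n4: "g (prod_encode (1, n)) \<ge> 4" unfolding n_def by (rule LeastI_ex[OF ex])
  have "rec_eval g rf_lower_test [n, N] 0"
    using rec_eval_lower_test[of g n "[N]"] n4 by simp
  moreover have "\<exists>y. rec_eval g rf_lower_test [i, N] (Suc y)" if "i < n" for i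
  proof -
    have "\<not> g (prod_encode (1, i)) \<ge> 4" using that not_less_Least unfolding n_def by blast
    then have "4 - g (prod_encode (1, i)) = Suc (3 - g (prod_encode (1, i)))" by simp
    then show ?thesis using rec_eval_lower_test[of g i "[N]"] by metis
  qed
  ultimately have "rec_eval g (RMin rf_lower_test) [N] n" by (rule rec_eval.intros(8))
  from rec_eval_comp1[OF rec_eval_comp1[OF rec_eval_comp2[OF this rec_eval_proj0 rec_eval_add]
      rec_eval_exp2] rec_eval_exp2]
  have Q: "rec_eval g rf_Q [N] (2 ^ 2 ^ (n + N))" unfolding rf_Q_def .
  from rec_eval_comp1[OF rec_eval_comp1[OF this rec_eval_exp2] rec_eval_exp2]
  have "rec_eval g rf_M [N] (2 ^ 2 ^ 2 ^ 2 ^ (n + N))" unfolding rf_M_def .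
  with Q show ?thesis using that dyadic_approx_lower_bound[OF ap n4 assms(3)] by blast
qed

section \<open>Analytic continuation of the Hurwitz zeta-function\<close>

text \<open>On each of the \<open>n\<close> subintervals the integrand differs from its value at the left end point by at most
  \<open>e\<close>.\<close>

lemma riemann_sum_error:
  fixes f :: "real \<Rightarrow> complex"
  assumes f: "continuous_on {0..1} f" and n: "n > 0"
    and e: "\<And>u v. u \<in> {0..1} \<Longrightarrow> v \<in> {0..1} \<Longrightarrow> \<bar>u - v\<bar> \<le> 1 / real n \<Longrightarrow> norm (f u - f v) \<le> e"
  shows "norm (integral {0..1} f - (\<Sum>j<n. f (real j / real n)) / of_nat n) \<le> e"
proof -
  have e0: "e \<ge> 0" using e[of 0 0] by simp
  have "norm (integral {0..real m / real n} f - (\<Sum>j<m. f (real j / real n)) / of_nat n)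
      \<le> e * (real m / real n)" if "m \<le> n" for m
    using that
  proof (induction m)
    case 0
    then show ?case by simp
  next
    case (Suc m)
    let ?a = "real m / real n" and ?b = "real (Suc m) / real n"
    have ab: "0 \<le> ?a" "?a \<le> ?b" "?b \<le> 1" "?b - ?a = 1 / real n"
      using Suc.prems n by (auto simp: field_simps)
    have int: "f integrable_on {0..?b}"
      using ab by (intro integrable_continuous_interval continuous_on_subset[OF f]) auto
    have split: "integral {0..?b} f = integral {0..?a} f + integral {?a..?b} f"
      by (rule Henstock_Kurzweil_Integration.integral_combine[OF ab(1,2) int, symmetric])
    have fab: "continuous_on {?a..?b} f"
      using ab by (intro continuous_on_subset[OF f]) auto
    have "integral {?a..?b} f - f ?a / of_nat n = integral {?a..?b} (\<lambda>v. f v - f ?a)"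
      using ab n integrable_continuous_interval[OF fab]
      by (subst Henstock_Kurzweil_Integration.integral_diff) (auto simp: scaleR_conv_of_real)
    also have "norm \<dots> \<le> e * (?b - ?a)"
      using ab by (intro integral_bound continuous_intros fab e) (auto intro: order_trans[OF ab(1)])
    finally have *: "norm (integral {?a..?b} f - f ?a / of_nat n) \<le> e * (?b - ?a)" .
    have "integral {0..?b} f - (\<Sum>j<Suc m. f (real j / real n)) / of_nat n =
       (integral {0..?a} f - (\<Sum>j<m. f (real j / real n)) / of_nat n) +
       (integral {?a..?b} f - f ?a / of_nat n)"
      unfolding split by (simp add: add_divide_distrib[of "sum _ _"] del: of_nat_Suc)
    also have "norm \<dots> \<le> e * ?a + e * (?b - ?a)"
      using Suc by (intro norm_triangle_mono *) auto
    finally show ?case by (simp add: algebra_simps)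
  qed
  from this[of n] n show ?thesis by simp
qed

text \<open>The Riemann sums in the parameter \<open>v\<close> are holomorphic and, by uniform continuity on compact sets,
  converge locally uniformly; so joint continuity of \<open>h\<close> is enough, and the derivative in \<open>s\<close> need not be
  controlled.\<close>

lemma holomorphic_on_integral:
  fixes h :: "complex \<Rightarrow> real \<Rightarrow> complex"
  assumes S: "open S" and cont: "continuous_on (S \<times> {0..1}) (\<lambda>(s, v). h s v)"
    and hol: "\<And>v. v \<in> {0..1} \<Longrightarrow> (\<lambda>s. h s v) holomorphic_on S"
  shows "(\<lambda>s. integral {0..1} (h s)) holomorphic_on S"
proof (rule holomorphic_uniform_sequence[OF S])
  show "(\<lambda>s. (\<Sum>j<Suc n. h s (real j / real (Suc n))) / of_nat (Suc n)) holomorphic_on S" for n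
    by (intro holomorphic_intros hol) (auto simp: field_simps)
  fix x assume "x \<in> S"
  then obtain d where d: "d > 0" "cball x d \<subseteq> S" using S open_contains_cball by blast
  have "uniform_limit (cball x d)
      (\<lambda>n s. (\<Sum>j<Suc n. h s (real j / real (Suc n))) / of_nat (Suc n))
      (\<lambda>s. integral {0..1} (h s)) sequentially"
  proof (rule uniform_limitI)
    fix e :: real assume e: "e > 0"
    have "uniformly_continuous_on (cball x d \<times> {0..1}) (\<lambda>(s, v). h s v)"
      using d by (intro compact_uniformly_continuous compact_Times continuous_on_subset[OF cont]) auto
    then obtain \<delta> where \<delta>: "\<delta> > 0" "\<And>p q. p \<in> cball x d \<times> {0..1} \<Longrightarrow> q \<in> cball x d \<times> {0..1} \<Longrightarrow>
        dist q p < \<delta> \<Longrightarrow> dist (case q of (s, v) \<Rightarrow> h s v) (case p of (s, v) \<Rightarrow> h s v) < e / 2"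
      unfolding uniformly_continuous_on_def using e by (metis half_gt_zero)
    have "(\<lambda>n. 1 / real (Suc n)) \<longlonglongrightarrow> 0" by real_asymp
    then have "\<forall>\<^sub>F n in sequentially. 1 / real (Suc n) < \<delta>"
      using \<delta>(1) by (rule order_tendstoD)
    then show "\<forall>\<^sub>F n in sequentially. \<forall>s\<in>cball x d.
       dist ((\<Sum>j<Suc n. h s (real j / real (Suc n))) / of_nat (Suc n)) (integral {0..1} (h s)) < e"
    proof eventually_elim
      case (elim n)
      show ?case
      proof
        fix s assume s: "s \<in> cball x d"
        have "norm (integral {0..1} (h s) - (\<Sum>j<Suc n. h s (real j / real (Suc n))) / of_nat (Suc n)) \<le> e / 2"
        proof (rule riemann_sum_error)
          show "continuous_on {0..1} (h s)"
          proof -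
            have "continuous_on {0..1} (\<lambda>v. case (s, v) of (s, v) \<Rightarrow> h s v)"
              using s d by (intro continuous_on_compose2[OF cont] continuous_intros) auto
            then show ?thesis by simp
          qed
          fix u v :: real assume "u \<in> {0..1}" "v \<in> {0..1}" "\<bar>u - v\<bar> \<le> 1 / real (Suc n)"
          then show "norm (h s u - h s v) \<le> e / 2"
            using \<delta>(2)[of "(s, v)" "(s, u)"] s elim
            by (simp add: dist_norm dist_Pair_Pair)
        qed simp
        with e show "dist ((\<Sum>j<Suc n. h s (real j / real (Suc n))) / of_nat (Suc n)) (integral {0..1} (h s)) < e"
          by (simp add: dist_norm norm_minus_commute)
      qed
    qed
  qed
  with d show "\<exists>d>0. cball x d \<subseteq> S \<and> uniform_limit (cball x d)
      (\<lambda>n s. (\<Sum>j<Suc n. h s (real j / real (Suc n))) / of_nat (Suc n))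
      (\<lambda>s. integral {0..1} (h s)) sequentially"
    by blast
qed

definition hz_series :: "complex \<Rightarrow> real \<Rightarrow> complex" where
  "hz_series s a = (\<Sum>n. complex_of_real (real n + a) powr (- s))"

lemma norm_real_powr: "x > 0 \<Longrightarrow> norm (complex_of_real x powr s) = x powr Re s"
  by (simp add: norm_powr_real_powr)

text \<open>Weierstrass M-test. The term \<open>n = 0\<close> is bounded separately, because \<open>a\<close> may be smaller
  than \<open>1\<close>.\<close>

lemma uniform_limit_hz_series:
  fixes b c C :: real
  assumes "b > 0" "c > 1"
  shows "uniform_limit {(s, a). c \<le> Re s \<and> Re s \<le> C \<and> b \<le> a}
     (\<lambda>N (s, a). \<Sum>n<N. complex_of_real (real n + a) powr (- s))
     (\<lambda>(s, a). hz_series s a) sequentially"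
proof -
  define M where "M = (\<lambda>n::nat. if n = 0 then b powr (- C) + 1 else real n powr (- c))"
  have "summable (\<lambda>n. M (Suc n))"
    unfolding M_def using assms(2) summable_Suc_iff[of "\<lambda>n. real n powr (-c)"]
    by (simp add: summable_real_powr_iff del: of_nat_Suc)
  then have M: "summable M" by (simp add: summable_Suc_iff)
  have "uniform_limit {(s, a). c \<le> Re s \<and> Re s \<le> C \<and> b \<le> a}
     (\<lambda>N p. \<Sum>n<N. case p of (s, a) \<Rightarrow> complex_of_real (real n + a) powr (- s))
     (\<lambda>p. \<Sum>n. case p of (s, a) \<Rightarrow> complex_of_real (real n + a) powr (- s)) sequentially"
  proof (rule Weierstrass_m_test[OF _ M], clarify)
    fix n s a assume sa: "c \<le> Re s" "Re s \<le> C" "b \<le> a"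
    have "norm (complex_of_real (real n + a) powr (- s)) = (real n + a) powr (- Re s)"
      using norm_real_powr[of "real n + a" "- s"] sa assms by simp
    also have "\<dots> \<le> M n"
    proof (cases "n = 0")
      case True
      show ?thesis
      proof (cases "a \<ge> 1")
        case True
        then have "a powr (- Re s) \<le> 1 powr (- Re s)"
          using sa assms by (intro powr_mono2') auto
        with \<open>n = 0\<close> show ?thesis by (simp add: M_def add_increasing)
      next
        case False
        have "a powr (- Re s) \<le> b powr (- Re s)"
          using sa assms by (intro powr_mono2') auto
        also have "\<dots> \<le> b powr (- C)"
          using False sa assms by (intro powr_mono') auto
        finally show ?thesis using \<open>n = 0\<close> by (simp add: M_def)
      qed
    next
      case False
      have "(real n + a) powr (- Re s) \<le> real n powr (- Re s)"
        using sa assms False by (intro powr_mono2') auto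
      also have "\<dots> \<le> real n powr (- c)"
        using False sa assms by (intro powr_mono) auto
      finally show ?thesis using False by (simp add: M_def)
    qed
    finally show "norm (complex_of_real (real n + a) powr (- s)) \<le> M n" .
  qed
  then show ?thesis by (simp add: hz_series_def case_prod_unfold)
qed

lemma summable_hz_series:
  assumes "Re s > 1" "a > 0"
  shows "(\<lambda>n. complex_of_real (real n + a) powr (- s)) sums hz_series s a"
proof -
  have "(\<lambda>N. \<Sum>n<N. complex_of_real (real n + a) powr (- s)) \<longlonglongrightarrow> hz_series s a"
    using tendsto_uniform_limitI[OF uniform_limit_hz_series[of a "Re s" "Re s"], of "(s, a)"] assms
    by simp
  then show ?thesis by (simp add: sums_def)
qed

lemma real_powr_eq_exp: "x > 0 \<Longrightarrow> complex_of_real x powr s = exp (s * complex_of_real (ln x))"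
  by (simp add: powr_def Ln_of_real)

lemma hz_partial_sum_eq_exp:
  "a > 0 \<Longrightarrow> (\<Sum>n<N. complex_of_real (real n + a) powr s) =
     (\<Sum>n<N. exp (s * complex_of_real (ln (real n + a))))"
  by (intro sum.cong refl real_powr_eq_exp) auto

lemma continuous_on_hz_series:
  "continuous_on ({s. Re s > 1} \<times> {0<..}) (\<lambda>(s, a). hz_series s a)"
proof (rule continuous_at_imp_continuous_on, rule ballI)
  fix p :: "complex \<times> real" assume p: "p \<in> {s. Re s > 1} \<times> {0<..}"
  then obtain s a where sa: "p = (s, a)" and s: "Re s > 1" and a: "a \<in> {0<..}" by auto
  define c where "c = (1 + Re s) / 2"
  define X where "X = {(s', a'). c \<le> Re s' \<and> Re s' \<le> Re s + 1 \<and> a / 2 \<le> a'}"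
  have c: "c > 1" "c < Re s" using s by (auto simp: c_def)
  have "continuous_on X (\<lambda>(s, a). hz_series s a)"
  proof (rule uniform_limit_theorem)
    show "uniform_limit X (\<lambda>N (s, a). \<Sum>n<N. complex_of_real (real n + a) powr (- s))
        (\<lambda>(s, a). hz_series s a) sequentially"
      unfolding X_def using a c by (intro uniform_limit_hz_series) auto
    have "continuous_on X (\<lambda>p. \<Sum>n<N. exp (- fst p * complex_of_real (ln (real n + snd p))))" for N
      unfolding X_def using a by (intro continuous_intros) (auto simp: add_nonneg_pos)
    moreover have "(\<Sum>n<N. exp (- fst p * complex_of_real (ln (real n + snd p)))) =
        (case p of (s, a) \<Rightarrow> \<Sum>n<N. complex_of_real (real n + a) powr (- s))" if "p \<in> X" for N p
      using that a unfolding X_def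
      by (cases p) (auto simp: hz_partial_sum_eq_exp simp del: of_real_add)
    ultimately have "continuous_on X (\<lambda>(s, a). \<Sum>n<N. complex_of_real (real n + a) powr (- s))" for N
      by (metis (no_types, lifting) continuous_on_cong)
    then show "\<forall>\<^sub>F N in sequentially. continuous_on X
        (\<lambda>(s, a). \<Sum>n<N. complex_of_real (real n + a) powr (- s))"
      by (intro always_eventually allI)
  qed auto
  moreover have "(s, a) \<in> interior X"
  proof (rule interiorI)
    show "open (({s'. c < Re s'} \<inter> {s'. Re s' < Re s + 1}) \<times> {a / 2<..})"
      by (intro open_Times open_Int open_halfspace_Re_gt open_halfspace_Re_lt open_greaterThan)
  qed (use a c in \<open>auto simp: X_def\<close>)
  ultimately show "isCont (\<lambda>(s, a). hz_series s a) p"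
    unfolding sa by (rule continuous_on_interior)
qed

lemma holomorphic_hz_series:
  assumes "a > 0"
  shows "(\<lambda>s. hz_series s a) holomorphic_on {s. Re s > 1}"
proof (rule holomorphic_uniform_sequence)
  show "open {s. Re s > 1}" by (rule open_halfspace_Re_gt)
  have "(\<lambda>s. \<Sum>n<N. exp (- s * complex_of_real (ln (real n + a)))) holomorphic_on {s. Re s > 1}" for N
    by (intro holomorphic_intros)
  then show "(\<lambda>s. \<Sum>n<N. complex_of_real (real n + a) powr (- s)) holomorphic_on {s. Re s > 1}" for N
    using assms by (simp only: hz_partial_sum_eq_exp)
  fix x assume "x \<in> {s. Re s > 1}"
  then have x: "Re x > 1" by simp
  define d where "d = (Re x - 1) / 2"
  have d: "d > 0" "Re x - d > 1" using x by (auto simp: d_def field_simps)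
  have Re: "Re x - d \<le> Re s \<and> Re s \<le> Re x + d" if "s \<in> cball x d" for s
    using that abs_Re_le_cmod[of "x - s"] by (auto simp: dist_norm abs_le_iff)
  have "uniform_limit (cball x d)
     (\<lambda>N s. case (s, a) of (s, a) \<Rightarrow> \<Sum>n<N. complex_of_real (real n + a) powr (- s))
     (\<lambda>s. case (s, a) of (s, a) \<Rightarrow> hz_series s a) sequentially"
    by (rule uniform_limit_compose'[OF uniform_limit_hz_series[of a "Re x - d" "Re x + d"]])
       (use assms d Re in auto)
  moreover have "cball x d \<subseteq> {s. Re s > 1}" using Re d by fastforce
  ultimately show "\<exists>d>0. cball x d \<subseteq> {s. Re s > 1} \<and>
      uniform_limit (cball x d) (\<lambda>N s. \<Sum>n<N. complex_of_real (real n + a) powr (- s))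
        (\<lambda>s. hz_series s a) sequentially"
    using d by auto
qed

text \<open>The function \<open>G s a = (s - 1) * \<zeta>(s; a)\<close> is entire in \<open>s\<close> and satisfies
  \<open>G s a = a powr (1 - s) + (s - 1) * (\<integral>v. (1 - v) * G (s + 1) (a + v))\<close> over \<open>0 \<le> v \<le> 1\<close>. The right-hand side
  makes sense in a half-plane that is larger by one, so that iterating it continues \<open>G\<close>
  to the whole plane.\<close>

definition hz_step :: "(complex \<Rightarrow> real \<Rightarrow> complex) \<Rightarrow> complex \<Rightarrow> real \<Rightarrow> complex" where
  "hz_step G s a = complex_of_real a powr (1 - s) +
     (s - 1) * integral {0..1} (\<lambda>v. complex_of_real (1 - v) * G (s + 1) (a + v))"

lemma continuous_on_hz_step:
  assumes "continuous_on ({s. Re s > c} \<times> {0<..}) (\<lambda>(s, a). G s a)"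
  shows "continuous_on ({s. Re s > c - 1} \<times> {0<..}) (\<lambda>(s, a). hz_step G s a)"
proof -
  let ?U = "{s. Re s > c - 1} \<times> {0<..} :: (complex \<times> real) set"
  have "continuous_on (?U \<times> cbox 0 1)
      (\<lambda>(p, v). complex_of_real (1 - v) * (case (fst p + 1, snd p + v) of (s, a) \<Rightarrow> G s a))"
    by (subst case_prod_unfold, intro continuous_intros continuous_on_compose2[OF assms]) auto
  then have "continuous_on ?U (\<lambda>p. integral (cbox 0 1)
      (\<lambda>v. complex_of_real (1 - v) * (case (fst p + 1, snd p + v) of (s, a) \<Rightarrow> G s a)))"
    by (rule integral_continuous_on_param)
  then have "continuous_on ?U (\<lambda>p. exp ((1 - fst p) * complex_of_real (ln (snd p))) +
     (fst p - 1) * integral (cbox 0 1)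
      (\<lambda>v. complex_of_real (1 - v) * (case (fst p + 1, snd p + v) of (s, a) \<Rightarrow> G s a)))"
    by (intro continuous_intros) auto
  then show ?thesis
    by (rule continuous_on_cong[THEN iffD1, rotated -1])
       (auto simp: hz_step_def real_powr_eq_exp)
qed

lemma holomorphic_hz_step:
  assumes "continuous_on ({s. Re s > c} \<times> {0<..}) (\<lambda>(s, a). G s a)"
    and hol: "\<And>a. a > 0 \<Longrightarrow> (\<lambda>s. G s a) holomorphic_on {s. Re s > c}" and a: "a > 0"
  shows "(\<lambda>s. hz_step G s a) holomorphic_on {s. Re s > c - 1}"
proof -
  have "(\<lambda>s. integral {0..1} (\<lambda>v. complex_of_real (1 - v) * G (s + 1) (a + v)))
      holomorphic_on {s. Re s > c - 1}"
  proof (rule holomorphic_on_integral)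
    show "open {s. Re s > c - 1}" by (rule open_halfspace_Re_gt)
    have "continuous_on ({s. Re s > c - 1} \<times> {0..1})
      (\<lambda>p. complex_of_real (1 - snd p) * (case (fst p + 1, a + snd p) of (s, a) \<Rightarrow> G s a))"
      using a by (intro continuous_intros continuous_on_compose2[OF assms(1)]) auto
    then show "continuous_on ({s. Re s > c - 1} \<times> {0..1})
      (\<lambda>(s, v). complex_of_real (1 - v) * G (s + 1) (a + v))"
      by (simp add: case_prod_unfold)
    fix v :: real assume "v \<in> {0..1}"
    then have "(\<lambda>s. G s (a + v)) holomorphic_on {s. Re s > c}" using a by (intro hol) auto
    then have "((\<lambda>s. G s (a + v)) \<circ> (\<lambda>s. s + 1)) holomorphic_on {s. Re s > c - 1}"
      by (intro holomorphic_on_compose_gen[where t = "{s. Re s > c}"] holomorphic_intros) auto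
    then show "(\<lambda>s. complex_of_real (1 - v) * G (s + 1) (a + v)) holomorphic_on {s. Re s > c - 1}"
      by (intro holomorphic_intros) (simp add: o_def)
  qed
  then have "(\<lambda>s. exp ((1 - s) * complex_of_real (ln a)) + (s - 1) *
     integral {0..1} (\<lambda>v. complex_of_real (1 - v) * G (s + 1) (a + v)))
      holomorphic_on {s. Re s > c - 1}"
    by (intro holomorphic_intros)
  then show ?thesis using a by (simp add: hz_step_def real_powr_eq_exp)
qed

text \<open>Integration by parts; the antiderivative is written down explicitly.\<close>

lemma integral_taylor_remainder_powr:
  assumes x: "x > 0" and s: "s \<noteq> 1"
  shows "((\<lambda>v. complex_of_real (1 - v) * (s * complex_of_real (x + v) powr (- s - 1))) has_integral
     complex_of_real x powr (- s) -
       (complex_of_real x powr (1 - s) - complex_of_real (x + 1) powr (1 - s)) / (s - 1)) {0..1}"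
proof -
  define c where "c = 1 / (s - 1)"
  have c: "c * (1 - s) = -1" using s by (simp add: c_def field_simps)
  define F where "F = (\<lambda>z. - (1 - z) * (complex_of_real x + z) powr (- s) +
      c * (complex_of_real x + z) powr (1 - s))"
  have "((\<lambda>v. F (complex_of_real v)) has_vector_derivative
      complex_of_real (1 - v) * (s * complex_of_real (x + v) powr (- s - 1))) (at v within {0..1})"
    if v: "v \<in> {0..1}" for v
  proof (rule has_vector_derivative_real_field)
    let ?w = "complex_of_real x + complex_of_real v"
    have nn: "?w \<notin> \<real>\<^sub>\<le>\<^sub>0"
    proof -
      have "complex_of_real (x + v) \<notin> \<real>\<^sub>\<le>\<^sub>0" using x v
        by (simp only: complex_nonpos_Reals_iff) auto
      then show ?thesis by simp
    qed
    have "(F has_field_derivative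
      ?w powr (- s) - (1 - complex_of_real v) * (- s * ?w powr (- s - 1)) +
      (c * (1 - s)) * ?w powr (1 - s - 1)) (at (complex_of_real v))"
      unfolding F_def using nn
      by (auto intro!: derivative_eq_intros simp: algebra_simps)
    moreover have "?w powr (- s) - (1 - complex_of_real v) * (- s * ?w powr (- s - 1)) +
      (c * (1 - s)) * ?w powr (1 - s - 1) =
      complex_of_real (1 - v) * (s * complex_of_real (x + v) powr (- s - 1))"
      unfolding c by simp
    ultimately show "(F has_field_derivative
        complex_of_real (1 - v) * (s * complex_of_real (x + v) powr (- s - 1)))
      (at (complex_of_real v))"
      by (simp only:)
  qed
  then have "((\<lambda>v. complex_of_real (1 - v) * (s * complex_of_real (x + v) powr (- s - 1)))
      has_integral F (complex_of_real 1) - F (complex_of_real 0)) {0..1}"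
    by (intro fundamental_theorem_of_calculus) auto
  moreover have "F (complex_of_real 1) - F (complex_of_real 0) = complex_of_real x powr (- s) -
       (complex_of_real x powr (1 - s) - complex_of_real (x + 1) powr (1 - s)) / (s - 1)"
    by (simp add: F_def c_def diff_divide_distrib)
  ultimately show ?thesis by simp
qed

text \<open>Summing \<open>integral_taylor_remainder_powr\<close> over \<open>x = n + a\<close> makes the differences of powers
  telescope.\<close>

lemma hz_step_series:
  assumes s: "Re s > 1" and a: "a > 0"
  shows "hz_step (\<lambda>s a. (s - 1) * hz_series s a) s a = (s - 1) * hz_series s a"
proof -
  have s1: "s \<noteq> 1" using s by auto
  define f where "f = (\<lambda>N v. complex_of_real (1 - v) *
      (s * (\<Sum>n<N. complex_of_real (real n + (a + v)) powr (- (s + 1)))))"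
  define g where "g = (\<lambda>v. complex_of_real (1 - v) * (s * hz_series (s + 1) (a + v)))"
  define I where "I = (\<lambda>N. (\<Sum>n<N. complex_of_real (real n + a) powr (- s)) -
      (complex_of_real a powr (1 - s) - complex_of_real (real N + a) powr (1 - s)) / (s - 1))"
  have fI: "(f N has_integral I N) {0..1}" for N
  proof (induction N)
    case 0
    then show ?case by (simp add: f_def I_def)
  next
    case (Suc N)
    have "((\<lambda>v. f N v + complex_of_real (1 - v) * (s * complex_of_real ((real N + a) + v) powr (- s - 1)))
       has_integral I N + (complex_of_real (real N + a) powr (- s) -
       (complex_of_real (real N + a) powr (1 - s) - complex_of_real ((real N + a) + 1) powr (1 - s)) / (s - 1))) {0..1}"
      using a s1 by (intro has_integral_add Suc integral_taylor_remainder_powr) auto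
    moreover have "(\<lambda>v. f N v + complex_of_real (1 - v) *
        (s * complex_of_real ((real N + a) + v) powr (- s - 1))) = f (Suc N)"
    proof
      fix v
      have "- (s + 1) = - s - 1" by simp
      then show "f N v + complex_of_real (1 - v) *
          (s * complex_of_real ((real N + a) + v) powr (- s - 1)) = f (Suc N) v"
        by (simp only: f_def sum.lessThan_Suc distrib_left add.assoc)
    qed
    moreover have "I N + (complex_of_real (real N + a) powr (- s) -
       (complex_of_real (real N + a) powr (1 - s) - complex_of_real ((real N + a) + 1) powr (1 - s)) / (s - 1))
        = I (Suc N)"
    proof -
      have "real (Suc N) + a = real N + a + 1" by simp
      then show ?thesis
        by (simp only: I_def sum.lessThan_Suc diff_divide_distrib)
           (simp add: algebra_simps del: of_real_add)
    qed
    ultimately show ?case by (simp only:)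
  qed
  have "uniform_limit {0..1}
     (\<lambda>N v. case (s + 1, a + v) of (s, a) \<Rightarrow> \<Sum>n<N. complex_of_real (real n + a) powr (- s))
     (\<lambda>v. case (s + 1, a + v) of (s, a) \<Rightarrow> hz_series s a) sequentially"
    by (rule uniform_limit_compose'[OF uniform_limit_hz_series[of a "Re s + 1" "Re s + 1"]])
       (use a s in auto)
  then have lim: "uniform_limit {0..1} (\<lambda>N v. \<Sum>n<N. complex_of_real (real n + (a + v)) powr (- (s + 1)))
     (\<lambda>v. hz_series (s + 1) (a + v)) sequentially"
    by simp
  have cont: "continuous_on {0..1} (\<lambda>v. hz_series (s + 1) (a + v))"
  proof -
    have "continuous_on {0..1} (\<lambda>v. case (s + 1, a + v) of (s, a) \<Rightarrow> hz_series s a)"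
      using a s by (intro continuous_on_compose2[OF continuous_on_hz_series] continuous_intros) auto
    then show ?thesis by simp
  qed
  have "uniform_limit {0..1}
      (\<lambda>N v. (complex_of_real (1 - v) * s) * (\<Sum>n<N. complex_of_real (real n + (a + v)) powr (- (s + 1))))
      (\<lambda>v. (complex_of_real (1 - v) * s) * hz_series (s + 1) (a + v)) sequentially"
    by (intro uniform_lim_mult uniform_limit_const lim compact_imp_bounded
        compact_continuous_image cont continuous_intros) auto
  then have "uniform_limit {0..1} f g sequentially"
    unfolding f_def g_def by (simp only: mult.assoc)
  moreover have "continuous_on {0..1} (f N)" for N
  proof -
    have "continuous_on {0..1} (\<lambda>v. complex_of_real (1 - v) *
      (s * (\<Sum>n<N. exp (- (s + 1) * complex_of_real (ln (real n + (a + v)))))))"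
      using a by (intro continuous_intros) (auto simp: add_nonneg_pos)
    then show ?thesis unfolding f_def
      by (rule continuous_on_cong[THEN iffD1, rotated -1])
         (use a in \<open>auto simp: hz_partial_sum_eq_exp simp del: of_real_add\<close>)
  qed
  ultimately obtain I' J where I': "\<And>N. (f N has_integral I' N) {0..1}"
    and J: "(g has_integral J) {0..1}" and IJ: "I' \<longlonglongrightarrow> J"
    by (rule uniform_limit_integral) auto
  have "I' = I" using has_integral_unique[OF I' fI] by auto
  have "(\<lambda>N. complex_of_real (real N + a) powr (1 - s)) \<longlonglongrightarrow> 0"
  proof (rule Lim_null_comparison)
    show "\<forall>\<^sub>F N in sequentially. norm (complex_of_real (real N + a) powr (1 - s)) \<le>
        (real N + a) powr (1 - Re s)"
      using a norm_real_powr[of _ "1 - s"]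
      by (intro always_eventually allI) (simp add: add_nonneg_pos del: of_real_add)
    show "(\<lambda>N. (real N + a) powr (1 - Re s)) \<longlonglongrightarrow> 0"
      using s a by real_asymp
  qed
  moreover have "(\<lambda>N. \<Sum>n<N. complex_of_real (real n + a) powr (- s)) \<longlonglongrightarrow> hz_series s a"
    using summable_hz_series[OF s a] by (simp add: sums_def)
  ultimately have "I \<longlonglongrightarrow> hz_series s a - (complex_of_real a powr (1 - s) - 0) / (s - 1)"
    unfolding I_def using s1 by (intro tendsto_intros) auto
  with IJ have "J = hz_series s a - complex_of_real a powr (1 - s) / (s - 1)"
    unfolding \<open>I' = I\<close> using LIMSEQ_unique by fastforce
  moreover have "integral {0..1} (\<lambda>v. complex_of_real (1 - v) *
      ((s + 1 - 1) * hz_series (s + 1) (a + v))) = J"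
    using J by (simp add: g_def integral_unique)
  ultimately show ?thesis
    unfolding hz_step_def using s1 by (simp add: field_simps)
qed

text \<open>Defined and holomorphic in \<open>s\<close> for \<open>Re s > 1 - K\<close>.\<close>

definition hz_iter :: "nat \<Rightarrow> complex \<Rightarrow> real \<Rightarrow> complex" where
  "hz_iter K = (hz_step ^^ K) (\<lambda>s a. (s - 1) * hz_series s a)"

lemma hz_iter_regular:
  "continuous_on ({s. Re s > 1 - real K} \<times> {0<..}) (\<lambda>(s, a). hz_iter K s a)"
  "a > 0 \<Longrightarrow> (\<lambda>s. hz_iter K s a) holomorphic_on {s. Re s > 1 - real K}"
proof (induction K arbitrary: a)
  case 0
  {
    case 1
    have "continuous_on ({s. Re s > 1} \<times> {0<..})
        (\<lambda>p. (fst p - 1) * (case p of (s, a) \<Rightarrow> hz_series s a))"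
      by (intro continuous_intros continuous_on_hz_series)
    then show ?case by (simp add: hz_iter_def case_prod_unfold)
  next
    case 2
    then show ?case by (auto simp: hz_iter_def intro!: holomorphic_intros holomorphic_hz_series)
  }
next
  case (Suc K)
  have eq: "hz_iter (Suc K) = hz_step (hz_iter K)" "1 - real (Suc K) = (1 - real K) - 1"
    by (simp_all add: hz_iter_def)
  {
    case 1
    show ?case unfolding eq by (rule continuous_on_hz_step[OF Suc.IH(1)])
  next
    case 2
    then show ?case unfolding eq by (intro holomorphic_hz_step Suc.IH)
  }
qed

lemma hz_iter_series:
  assumes "Re s > 1" "a > 0"
  shows "hz_iter K s a = (s - 1) * hz_series s a"
  using assms
proof (induction K arbitrary: s a)
  case 0
  then show ?case by (simp add: hz_iter_def)
next
  case (Suc K)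
  have "hz_iter (Suc K) s a = hz_step (hz_iter K) s a" by (simp add: hz_iter_def)
  also have "\<dots> = hz_step (\<lambda>s a. (s - 1) * hz_series s a) s a"
  proof -
    have "integral {0..1} (\<lambda>v. complex_of_real (1 - v) * hz_iter K (s + 1) (a + v)) =
        integral {0..1} (\<lambda>v. complex_of_real (1 - v) * ((s + 1 - 1) * hz_series (s + 1) (a + v)))"
      using Suc.prems by (intro integral_cong) (simp add: Suc.IH)
    then show ?thesis by (simp only: hz_step_def)
  qed
  also have "\<dots> = (s - 1) * hz_series s a" using Suc.prems by (rule hz_step_series)
  finally show ?case .
qed

lemma hz_iter_eq:
  assumes "a > 0" "K \<le> L" "Re s > 1 - real K"
  shows "hz_iter L s a = hz_iter K s a"
proof (rule analytic_continuation_open[of "{s. Re s > 1}" "{s. Re s > 1 - real K}"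
      "\<lambda>s. hz_iter L s a" "\<lambda>s. hz_iter K s a"])
  show "{s. Re s > 1} \<noteq> {}" using one_complex.sel(1) by (auto intro!: exI[of _ 2])
  show "connected {s. Re s > 1 - real K}"
    by (intro convex_connected convex_halfspace_Re_gt)
  show "(\<lambda>s. hz_iter L s a) holomorphic_on {s. Re s > 1 - real K}"
    by (rule holomorphic_on_subset[OF hz_iter_regular(2)[OF assms(1)]]) (use assms(2) in auto)
qed (use assms in \<open>auto simp: open_halfspace_Re_gt hz_iter_regular hz_iter_series\<close>)

text \<open>The iterates agree on common half-planes by the identity theorem, so they glue to an entire
  function.\<close>

lemma entire_continuation:
  assumes a: "a > 0"
  obtains E where "E holomorphic_on UNIV" "\<And>K s. Re s > 1 - real K \<Longrightarrow> E s = hz_iter K s a"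
proof -
  define E where "E = (\<lambda>s. hz_iter (nat \<lceil>2 - Re s\<rceil>) s a)"
  have E: "E s = hz_iter K s a" if s: "Re s > 1 - real K" for K s
  proof -
    let ?L = "nat \<lceil>2 - Re s\<rceil>"
    have L: "Re s > 1 - real ?L" by linarith
    show ?thesis
    proof (cases "K \<le> ?L")
      case True
      with hz_iter_eq[OF a True s] show ?thesis by (simp add: E_def)
    next
      case False
      with hz_iter_eq[OF a, of ?L K s] L show ?thesis by (simp add: E_def)
    qed
  qed
  have "E field_differentiable at s" for s
  proof -
    obtain K :: nat where K: "1 - Re s < real K" using reals_Archimedean2 by blast
    have "E holomorphic_on {s. Re s > 1 - real K}"
      using hz_iter_regular(2)[OF a, of K] by (rule holomorphic_transform) (use E[of K] in auto)
    then show ?thesis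
      using K by (auto simp: holomorphic_on_open open_halfspace_Re_gt field_differentiable_def)
  qed
  then have "E holomorphic_on UNIV" by (simp add: holomorphic_on_def field_differentiable_at_within)
  with E that show ?thesis by blast
qed

lemma connected_punctured_plane: "connected (- {1 :: complex})"
  using connected_open_delete[of "UNIV :: complex set" 1]
  by (simp add: Compl_eq_Diff_UNIV connected_UNIV)

text \<open>The definite description in the definition of \<open>hurwitz_zeta\<close> denotes: existence is
  \<open>entire_continuation\<close>, and uniqueness is the identity theorem on the connected set \<open>- {1}\<close>.\<close>

lemma hurwitz_zeta_characterization:
  assumes a: "a > 0"
  shows "(\<lambda>s. hurwitz_zeta s a) holomorphic_on - {1}" "Re s > 1 \<Longrightarrow> hurwitz_zeta s a = hz_series s a"
proof -
  define P where "P = (\<lambda>g. g holomorphic_on (- {1}) \<and>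
             (\<forall>z. Re z > 1 \<longrightarrow> g z = hz_series z a) \<and> g 1 = (0 :: complex))"
  obtain E where E: "E holomorphic_on UNIV" "\<And>K s. Re s > 1 - real K \<Longrightarrow> E s = hz_iter K s a"
    using entire_continuation[OF a] by blast
  have "P (\<lambda>s. E s / (s - 1))"
    unfolding P_def using E(2)[of 0] a hz_iter_series[of _ a 0]
    by (auto intro!: holomorphic_intros holomorphic_on_subset[OF E(1)])
  moreover have "g = h" if g: "P g" and h: "P h" for g h
  proof
    fix z show "g z = h z"
    proof (cases "z = 1")
      case False
      show ?thesis
        by (rule analytic_continuation_open[of "{s. Re s > 1}" "- {1}" g h])
           (use g h False connected_punctured_plane in
            \<open>auto simp: P_def open_halfspace_Re_gt intro!: exI[of _ 2]\<close>)
    qed (use g h in \<open>simp add: P_def\<close>)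
  qed
  ultimately have "\<exists>!g. P g" by blast
  from theI'[OF this] have "P (THE g. P g)" .
  moreover have "(\<lambda>s. hurwitz_zeta s a) = (THE g. P g)"
    by (rule ext) (simp add: hurwitz_zeta_def P_def hz_series_def)
  ultimately have "P (\<lambda>s. hurwitz_zeta s a)" by simp
  then show "(\<lambda>s. hurwitz_zeta s a) holomorphic_on - {1}"
    "Re s > 1 \<Longrightarrow> hurwitz_zeta s a = hz_series s a"
    by (auto simp: P_def)
qed

lemma hurwitz_zeta_eqI:
  assumes "a > 0" "f holomorphic_on S" "open S" "connected S" "{s. Re s > 1} \<subseteq> S" "1 \<notin> S"
    and "\<And>s. Re s > 1 \<Longrightarrow> f s = hz_series s a" "s \<in> S"
  shows "hurwitz_zeta s a = f s"
proof (rule analytic_continuation_open[of "{s. Re s > 1}" S "\<lambda>s. hurwitz_zeta s a" f])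
  show "(\<lambda>s. hurwitz_zeta s a) holomorphic_on S"
    by (rule holomorphic_on_subset[OF hurwitz_zeta_characterization(1)[OF assms(1)]])
       (use assms(6) in auto)
qed (use assms hurwitz_zeta_characterization(2)[OF assms(1)] in
      \<open>auto simp: open_halfspace_Re_gt intro!: exI[of _ 2]\<close>)

lemma hurwitz_zeta_shift:
  assumes a: "a > 0" and s: "s \<noteq> 1"
  shows "hurwitz_zeta s a =
    (\<Sum>n<X. complex_of_real (real n + a) powr (- s)) + hurwitz_zeta s (a + real X)"
proof (rule hurwitz_zeta_eqI[OF a, of _ "- {1}"])
  have "(\<lambda>s. (\<Sum>n<X. exp (- s * complex_of_real (ln (real n + a)))) + hurwitz_zeta s (a + real X))
      holomorphic_on - {1}"
    using a by (intro holomorphic_intros hurwitz_zeta_characterization) (auto simp: add_pos_nonneg)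
  then show "(\<lambda>s. (\<Sum>n<X. complex_of_real (real n + a) powr (- s)) + hurwitz_zeta s (a + real X))
      holomorphic_on - {1}"
    using a by (simp only: hz_partial_sum_eq_exp)
  fix s assume s: "Re s > 1"
  have "hz_series s a = (\<Sum>n. complex_of_real (real (n + X) + a) powr (- s)) +
      (\<Sum>n<X. complex_of_real (real n + a) powr (- s))"
    unfolding hz_series_def
    by (rule suminf_split_initial_segment) (rule sums_summable[OF summable_hz_series[OF s a]])
  moreover have "(\<Sum>n. complex_of_real (real (n + X) + a) powr (- s)) = hurwitz_zeta s (a + real X)"
    using a s by (subst hurwitz_zeta_characterization(2)) (auto simp: hz_series_def add_ac add_pos_nonneg)
  ultimately show "(\<Sum>n<X. complex_of_real (real n + a) powr (- s)) + hurwitz_zeta s (a + real X) =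
      hz_series s a" by simp
qed (use s connected_punctured_plane in auto)

text \<open>One application of the recursion already reaches \<open>Re s > 0\<close>, where the integrand is an absolutely
  convergent series.\<close>

lemma hurwitz_zeta_step:
  assumes a: "a > 0" and s: "Re s > 0" "s \<noteq> 1"
  shows "hurwitz_zeta s a = complex_of_real a powr (1 - s) / (s - 1) +
     integral {0..1} (\<lambda>v. complex_of_real (1 - v) * (s * hz_series (s + 1) (a + v)))"
proof -
  have "hurwitz_zeta s a = hz_iter 1 s a / (s - 1)"
  proof (rule hurwitz_zeta_eqI[OF a, of _ "{s. Re s > 0} - {1}"])
    show "(\<lambda>s. hz_iter 1 s a / (s - 1)) holomorphic_on {s. Re s > 0} - {1}"
      using hz_iter_regular(2)[OF a, of 1]
      by (auto intro!: holomorphic_intros elim: holomorphic_on_subset)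
    show "connected ({s. Re s > 0} - {1 :: complex})"
      by (intro connected_open_delete convex_connected convex_halfspace_Re_gt
          open_halfspace_Re_gt) auto
    show "hz_iter 1 s a / (s - 1) = hz_series s a" if "Re s > 1" for s
      using that a by (auto simp: hz_iter_series)
  qed (use s in \<open>auto simp: open_halfspace_Re_gt\<close>)
  with s show ?thesis by (simp add: hz_iter_def hz_step_def add_divide_distrib)
qed

text \<open>Comparison of the sum with the integral of \<open>x powr (- Re s)\<close>.\<close>

lemma norm_hz_series_le:
  assumes s: "Re s > 1" and a: "a > 0"
  shows "norm (hz_series s a) \<le> a powr (- Re s) + a powr (1 - Re s) / (Re s - 1)"
proof -
  let ?\<sigma> = "Re s"
  have step: "(x + 1) powr (- ?\<sigma>) \<le> (x powr (1 - ?\<sigma>) - (x + 1) powr (1 - ?\<sigma>)) / (?\<sigma> - 1)"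
    if x: "x > 0" for x :: real
  proof -
    have "\<exists>z>x. z < x + 1 \<and> (x + 1) powr (1 - ?\<sigma>) - x powr (1 - ?\<sigma>) =
        (x + 1 - x) * ((1 - ?\<sigma>) * z powr (1 - ?\<sigma> - 1))"
      using x by (intro MVT2) (auto intro!: derivative_eq_intros)
    then obtain z where z: "x < z" "z < x + 1"
      and eq: "(x + 1) powr (1 - ?\<sigma>) - x powr (1 - ?\<sigma>) = (1 - ?\<sigma>) * z powr (- ?\<sigma>)"
      by auto
    from eq have "z powr (- ?\<sigma>) = (x powr (1 - ?\<sigma>) - (x + 1) powr (1 - ?\<sigma>)) / (?\<sigma> - 1)"
      using s by (simp add: field_simps)
    moreover have "(x + 1) powr (- ?\<sigma>) \<le> z powr (- ?\<sigma>)"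
      using z x s by (intro powr_mono2') auto
    ultimately show ?thesis by simp
  qed
  have fin: "(\<Sum>n<Suc N. norm (complex_of_real (real n + a) powr (- s))) \<le>
     a powr (- ?\<sigma>) + (a powr (1 - ?\<sigma>) - (real N + a) powr (1 - ?\<sigma>)) / (?\<sigma> - 1)" for N
  proof (induction N)
    case 0
    then show ?case using norm_real_powr[of a "- s"] a by simp
  next
    case (Suc N)
    have "norm (complex_of_real (real (Suc N) + a) powr (- s)) = ((real N + a) + 1) powr (- ?\<sigma>)"
      using norm_real_powr[of "real (Suc N) + a" "- s"] a by (simp add: add_ac add_nonneg_pos)
    also have "\<dots> \<le> ((real N + a) powr (1 - ?\<sigma>) - ((real N + a) + 1) powr (1 - ?\<sigma>)) / (?\<sigma> - 1)"
      using a by (intro step) auto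
    finally have "norm (complex_of_real (real (Suc N) + a) powr (- s)) \<le>
       ((real N + a) powr (1 - ?\<sigma>) - (real (Suc N) + a) powr (1 - ?\<sigma>)) / (?\<sigma> - 1)"
      by (simp add: add_ac)
    with Suc show ?case by (simp add: diff_divide_distrib)
  qed
  have "norm (\<Sum>n<N. complex_of_real (real n + a) powr (- s)) \<le>
     a powr (- ?\<sigma>) + a powr (1 - ?\<sigma>) / (?\<sigma> - 1)" for N
  proof (cases N)
    case 0
    then show ?thesis using s by simp
  next
    case (Suc m)
    have "norm (\<Sum>n<N. complex_of_real (real n + a) powr (- s)) \<le>
        (\<Sum>n<Suc m. norm (complex_of_real (real n + a) powr (- s)))"
      unfolding Suc by (rule norm_sum)
    also note fin[of m]
    also have "a powr (- ?\<sigma>) + (a powr (1 - ?\<sigma>) - (real m + a) powr (1 - ?\<sigma>)) / (?\<sigma> - 1) \<le>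
       a powr (- ?\<sigma>) + a powr (1 - ?\<sigma>) / (?\<sigma> - 1)"
      using s by (intro add_left_mono divide_right_mono) auto
    finally show ?thesis .
  qed
  moreover have "(\<lambda>N. \<Sum>n<N. complex_of_real (real n + a) powr (- s)) \<longlonglongrightarrow> hz_series s a"
    using summable_hz_series[OF s a] by (simp add: sums_def)
  ultimately show ?thesis
    by (intro LIMSEQ_le_const2[OF tendsto_norm]) auto
qed

text \<open>For large \<open>a\<close> this is the first-order Euler--Maclaurin approximation; combined with
  \<open>hurwitz_zeta_shift\<close> it approximates \<open>\<zeta>(s; \<alpha>)\<close> by a Dirichlet polynomial.\<close>

lemma hurwitz_zeta_approx:
  assumes a: "a > 0" and s: "Re s > 0" "s \<noteq> 1"
  shows "norm (hurwitz_zeta s a - complex_of_real a powr (1 - s) / (s - 1)) \<le>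
    norm s * (a powr (- Re s - 1) + a powr (- Re s) / Re s)"
proof -
  have cont: "continuous_on {0..1} (\<lambda>v. hz_series (s + 1) (a + v))"
  proof -
    have "continuous_on {0..1} (\<lambda>v. case (s + 1, a + v) of (s, a) \<Rightarrow> hz_series s a)"
      using a s by (intro continuous_on_compose2[OF continuous_on_hz_series] continuous_intros) auto
    then show ?thesis by simp
  qed
  have "norm (integral {0..1} (\<lambda>v. complex_of_real (1 - v) * (s * hz_series (s + 1) (a + v)))) \<le>
      (norm s * (a powr (- Re s - 1) + a powr (- Re s) / Re s)) * (1 - 0)"
  proof (rule integral_bound)
    fix v :: real assume v: "v \<in> {0..1}"
    have "norm (hz_series (s + 1) (a + v)) \<le>
        (a + v) powr (- Re (s + 1)) + (a + v) powr (1 - Re (s + 1)) / (Re (s + 1) - 1)"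
      using s a v by (intro norm_hz_series_le) auto
    also have "\<dots> \<le> a powr (- Re (s + 1)) + a powr (1 - Re (s + 1)) / (Re (s + 1) - 1)"
      using s a v by (intro add_mono divide_right_mono powr_mono2') auto
    finally have "norm (hz_series (s + 1) (a + v)) \<le> a powr (- Re s - 1) + a powr (- Re s) / Re s"
      by simp
    then have "norm s * norm (hz_series (s + 1) (a + v)) \<le>
        norm s * (a powr (- Re s - 1) + a powr (- Re s) / Re s)"
      by (rule mult_left_mono) simp
    moreover have "\<bar>1 - v\<bar> * (norm s * norm (hz_series (s + 1) (a + v))) \<le>
        1 * (norm s * norm (hz_series (s + 1) (a + v)))"
      using v by (intro mult_right_mono) auto
    ultimately show "norm (complex_of_real (1 - v) * (s * hz_series (s + 1) (a + v))) \<le>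
        norm s * (a powr (- Re s - 1) + a powr (- Re s) / Re s)"
      by (simp only: norm_mult norm_of_real)
  qed (intro continuous_intros cont | simp)+
  then show ?thesis using hurwitz_zeta_step[OF assms] by simp
qed

section \<open>Resultants and a Liouville inequality\<close>

lemma prod_of_sums:
  fixes f :: "'a \<Rightarrow> 'b \<Rightarrow> 'c :: comm_semiring_1"
  assumes "finite A" "\<And>x. x \<in> A \<Longrightarrow> finite (B x)"
  shows "(\<Prod>x\<in>A. \<Sum>y\<in>B x. f x y) = (\<Sum>h\<in>PiE A B. \<Prod>x\<in>A. f x (h x))"
  using assms
proof (induction A rule: finite_induct)
  case empty
  then show ?case by simp
next
  case (insert a A)
  have inj: "inj_on (\<lambda>(y, g). g(a := y)) (B a \<times> PiE A B)"
    using inj_combinator[OF insert.hyps(2), where T = B] by simp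
  have "(\<Sum>h\<in>PiE (insert a A) B. \<Prod>x\<in>insert a A. f x (h x)) =
      (\<Sum>(y, g)\<in>B a \<times> PiE A B. \<Prod>x\<in>insert a A. f x ((g(a := y)) x))"
    unfolding PiE_insert_eq by (subst sum.reindex[OF inj]) (simp add: case_prod_unfold)
  also have "\<dots> = (\<Sum>(y, g)\<in>B a \<times> PiE A B. f a y * (\<Prod>x\<in>A. f x (g x)))"
  proof (intro sum.cong refl, clarify)
    fix y g
    have "(\<Prod>x\<in>A. f x ((g(a := y)) x)) = (\<Prod>x\<in>A. f x (g x))"
      using insert.hyps by (intro prod.cong) auto
    then show "(\<Prod>x\<in>insert a A. f x ((g(a := y)) x)) = f a y * (\<Prod>x\<in>A. f x (g x))"
      using insert.hyps by simp
  qed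
  also have "\<dots> = (\<Sum>y\<in>B a. f a y) * (\<Sum>g\<in>PiE A B. \<Prod>x\<in>A. f x (g x))"
    by (simp add: sum_product sum.cartesian_product)
  finally show ?case using insert by simp
qed

definition poly_l1 :: "int poly \<Rightarrow> int" where
  "poly_l1 p = (\<Sum>i\<le>degree p. \<bar>coeff p i\<bar>)"

lemma sum_abs_coeff_le_poly_l1:
  assumes "finite A"
  shows "(\<Sum>i\<in>A. \<bar>coeff p i\<bar>) \<le> poly_l1 p"
proof -
  have "(\<Sum>i\<in>A. \<bar>coeff p i\<bar>) = (\<Sum>i\<in>A \<inter> {..degree p}. \<bar>coeff p i\<bar>)"
    using assms by (intro sum.mono_neutral_right) (auto intro: le_degree)
  also have "\<dots> \<le> poly_l1 p" unfolding poly_l1_def by (intro sum_mono2) auto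
  finally show ?thesis .
qed

lemma poly_l1_nonneg: "poly_l1 p \<ge> 0"
  unfolding poly_l1_def by (simp add: sum_nonneg)

lemma poly_l1_ge_1: "p \<noteq> 0 \<Longrightarrow> poly_l1 p \<ge> 1"
proof -
  assume "p \<noteq> 0"
  then have "1 \<le> \<bar>lead_coeff p\<bar>" by (simp add: leading_coeff_0_iff int_one_le_iff_zero_less)
  also have "\<dots> \<le> poly_l1 p" using sum_abs_coeff_le_poly_l1[of "{degree p}" p] by simp
  finally show ?thesis .
qed

lemma ipoly_altdef: "ipoly p x = (\<Sum>i\<le>degree p. real_of_int (coeff p i) * x ^ i)"
  by (simp add: poly_altdef degree_map_poly coeff_map_poly)

lemma ipoly_sum_atMost:
  assumes "degree p \<le> n"
  shows "ipoly p x = (\<Sum>i\<le>n. real_of_int (coeff p i) * x ^ i)"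
  unfolding ipoly_altdef
  using assms by (intro sum.mono_neutral_left) (auto simp: coeff_eq_0)

lemma ipoly_mult: "ipoly (p * q) x = ipoly p x * ipoly q x"
  by (simp add: of_int_poly_hom.hom_mult)

lemma ipoly_monom: "ipoly (monom 1 k) x = x ^ k"
  by (simp add: map_poly_monom poly_monom)

text \<open>The Leibniz expansion is part of the expansion of the product of the row sums.\<close>

lemma abs_det_le_prod_row_sums:
  assumes "A \<in> carrier_mat n n"
  shows "\<bar>Determinant.det A :: int\<bar> \<le> (\<Prod>i<n. \<Sum>j<n. \<bar>index_mat A (i, j)\<bar>)"
proof -
  let ?P = "{p. p permutes {0..<n}}"
  have fin: "finite ?P" by (simp add: finite_permutations)
  have "\<bar>Determinant.det A\<bar> \<le> (\<Sum>p\<in>?P. \<bar>signof p * (\<Prod>i=0..<n. index_mat A (i, p i))\<bar>)"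
    unfolding det_def'[OF assms] by (rule sum_abs)
  also have "\<dots> = (\<Sum>p\<in>?P. \<Prod>i<n. \<bar>index_mat A (i, p i)\<bar>)"
    by (intro sum.cong) (auto simp: abs_mult abs_prod sign_def atLeast0LessThan)
  also have "\<dots> = (\<Sum>h\<in>(\<lambda>p. restrict p {..<n}) ` ?P. \<Prod>i<n. \<bar>index_mat A (i, h i)\<bar>)"
  proof (subst sum.reindex)
    show "inj_on (\<lambda>p. restrict p {..<n}) ?P"
    proof (rule inj_onI)
      fix p q assume p: "p \<in> ?P" and q: "q \<in> ?P" and eq: "restrict p {..<n} = restrict q {..<n}"
      show "p = q"
      proof
        fix x show "p x = q x"
        proof (cases "x < n")
          case True
          then show ?thesis using fun_cong[OF eq, of x] by simp
        next
          case False
          then show ?thesis using p q by (simp add: permutes_def)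
        qed
      qed
    qed
  qed (auto intro!: sum.cong prod.cong)
  also have "\<dots> \<le> (\<Sum>h\<in>PiE {..<n} (\<lambda>_. {..<n}). \<Prod>i<n. \<bar>index_mat A (i, h i)\<bar>)"
  proof (rule sum_mono2)
    show "(\<lambda>p. restrict p {..<n}) ` ?P \<subseteq> PiE {..<n} (\<lambda>_. {..<n})"
    proof clarify
      fix p :: "nat \<Rightarrow> nat" assume "p permutes {0..<n}"
      from permutes_in_image[OF this]
      show "restrict p {..<n} \<in> PiE {..<n} (\<lambda>_. {..<n})" by auto
    qed
  qed (auto intro!: finite_PiE prod_nonneg)
  also have "\<dots> = (\<Prod>i<n. \<Sum>j<n. \<bar>index_mat A (i, j)\<bar>)"
    by (rule prod_of_sums[symmetric]) auto
  finally show ?thesis .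
qed

lemma sylvester_row_sum_le:
  fixes p :: "int poly"
  shows "(\<Sum>j<n. \<bar>coeff (monom 1 k * p) (n - j)\<bar>) \<le> poly_l1 p"
proof -
  have "(\<Sum>j<n. \<bar>coeff (monom 1 k * p) (n - j)\<bar>) =
      (\<Sum>j\<in>{j. j < n \<and> k \<le> n - j}. \<bar>coeff p (n - j - k)\<bar>)"
    by (intro sum.mono_neutral_cong_right) (auto simp: coeff_monom_mult)
  also have "\<dots> = (\<Sum>l\<in>(\<lambda>j. n - j - k) ` {j. j < n \<and> k \<le> n - j}. \<bar>coeff p l\<bar>)"
    by (subst sum.reindex) (auto intro!: inj_onI)
  also have "\<dots> \<le> poly_l1 p" by (rule sum_abs_coeff_le_poly_l1) auto
  finally show ?thesis .
qed

lemma sum_lessThan_top_down: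
  fixes h :: "nat \<Rightarrow> real"
  assumes "h 0 = 0"
  shows "(\<Sum>j<n. h (n - j)) = (\<Sum>i\<le>n. h i)"
proof -
  have "(\<Sum>j<n. h (n - j)) = (\<Sum>j<n. h (Suc j))"
    by (rule sum.reindex_bij_witness[of _ "\<lambda>j. n - Suc j" "\<lambda>j. n - Suc j"])
       (auto simp: Suc_diff_Suc)
  also have "\<dots> = (\<Sum>i\<le>n. h i)"
    by (simp add: sum.atMost_shift assms)
  finally show ?thesis .
qed

text \<open>The rows of the Sylvester matrix are the coefficient vectors of \<open>X ^ i * p\<close> and \<open>X ^ i * q\<close>, so the
  matrix maps the vector of powers of \<open>x\<close> to multiples of \<open>p(x)\<close> and \<open>q(x)\<close>.\<close>

lemma sylvester_times_powers:
  fixes p q :: "int poly" and x :: real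
  defines "n \<equiv> degree p + degree q"
  assumes i: "i < n"
  shows "(\<Sum>j<n. real_of_int (index_mat (sylvester_mat p q) (i, j)) * x ^ (n - j)) =
     (if i < degree q then x ^ (degree q - i) * ipoly p x else x ^ (n - i) * ipoly q x)"
proof -
  have gen: "(\<Sum>j<n. real_of_int (coeff (monom 1 k * f) (n - j)) * x ^ (n - j)) = x ^ k * ipoly f x"
    if "0 < k" "k + degree f \<le> n" for k and f :: "int poly"
  proof -
    have "(\<Sum>j<n. real_of_int (coeff (monom 1 k * f) (n - j)) * x ^ (n - j)) =
        (\<Sum>i\<le>n. real_of_int (coeff (monom 1 k * f) i) * x ^ i)"
      by (rule sum_lessThan_top_down) (use that in \<open>simp add: coeff_monom_mult\<close>)
    also have "\<dots> = ipoly (monom 1 k * f) x"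
    proof (rule ipoly_sum_atMost[symmetric])
      have "degree (monom 1 k * f) \<le> degree (monom (1::int) k) + degree f"
        by (rule degree_mult_le)
      with that show "degree (monom 1 k * f) \<le> n" using degree_monom_le[of "1::int" k] by linarith
    qed
    also have "\<dots> = x ^ k * ipoly f x" by (simp only: ipoly_mult ipoly_monom)
    finally show ?thesis .
  qed
  show ?thesis
  proof (cases "i < degree q")
    case True
    then have "(\<Sum>j<n. real_of_int (index_mat (sylvester_mat p q) (i, j)) * x ^ (n - j)) =
      (\<Sum>j<n. real_of_int (coeff (monom 1 (degree q - i) * p) (n - j)) * x ^ (n - j))"
      using i unfolding n_def by (intro sum.cong refl) (simp add: sylvester_index_mat2)
    with True show ?thesis using gen[of "degree q - i" p] by (simp add: n_def)
  next
    case False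
    then have "(\<Sum>j<n. real_of_int (index_mat (sylvester_mat p q) (i, j)) * x ^ (n - j)) =
      (\<Sum>j<n. real_of_int (coeff (monom 1 (n - i) * q) (n - j)) * x ^ (n - j))"
      using i unfolding n_def by (intro sum.cong refl) (simp add: sylvester_index_mat2)
    with False i show ?thesis using gen[of "n - i" q] by (simp add: n_def)
  qed
qed

lemma abs_cofactor_sylvester_le:
  fixes p q :: "int poly"
  defines "n \<equiv> degree p + degree q"
  assumes i: "degree q \<le> i" "i < n" and j: "j < n"
  shows "\<bar>cofactor (sylvester_mat p q) i j\<bar> \<le>
     poly_l1 p ^ degree q * poly_l1 q ^ (degree p - 1)"
proof -
  let ?S = "sylvester_mat p q"
  have S: "?S \<in> carrier_mat n n" unfolding n_def by (rule sylvester_carrier_mat)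
  let ?A = "mat_delete ?S i j"
  have A: "?A \<in> carrier_mat (n - 1) (n - 1)" by (rule mat_delete_carrier[OF S])
  have "\<bar>cofactor ?S i j\<bar> = \<bar>Determinant.det ?A\<bar>"
    unfolding cofactor_def by (simp add: abs_mult power_abs)
  also have "\<dots> \<le> (\<Prod>r<n - 1. \<Sum>c<n - 1. \<bar>index_mat ?A (r, c)\<bar>)"
    by (rule abs_det_le_prod_row_sums[OF A])
  also have "\<dots> \<le> (\<Prod>r<n - 1. if r < degree q then poly_l1 p else poly_l1 q)"
  proof (rule prod_mono)
    fix r assume "r \<in> {..<n - 1}"
    then have r: "r < n - 1" by simp
    define r' where "r' = insert_index i r"
    have r': "r' < n" using r by (auto simp: r'_def insert_index_def)
    have "(\<Sum>c<n - 1. \<bar>index_mat ?A (r, c)\<bar>) =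
        (\<Sum>c<n - 1. \<bar>index_mat ?S (r', insert_index j c)\<bar>)"
      using r i j n_def by (intro sum.cong refl) (simp add: mat_delete_def r'_def insert_index_def)
    also have "\<dots> = (\<Sum>c\<in>insert_index j ` {..<n - 1}. \<bar>index_mat ?S (r', c)\<bar>)"
      by (subst sum.reindex) (auto simp: insert_index_inj_on)
    also have "\<dots> \<le> (\<Sum>c<n. \<bar>index_mat ?S (r', c)\<bar>)"
      by (intro sum_mono2) (auto simp: insert_index_def)
    also have "\<dots> \<le> (if r < degree q then poly_l1 p else poly_l1 q)"
    proof (cases "r < degree q")
      case True
      with i have "r' < degree q" by (simp add: r'_def)
      then have "(\<Sum>c<n. \<bar>index_mat ?S (r', c)\<bar>) =
          (\<Sum>c<n. \<bar>coeff (monom 1 (degree q - r') * p) (n - c)\<bar>)"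
        using r' unfolding n_def by (intro sum.cong refl) (simp add: sylvester_index_mat2)
      with True sylvester_row_sum_le show ?thesis by simp
    next
      case False
      with i have "\<not> r' < degree q" by (auto simp: r'_def insert_index_def)
      then have "(\<Sum>c<n. \<bar>index_mat ?S (r', c)\<bar>) =
          (\<Sum>c<n. \<bar>coeff (monom 1 (n - r') * q) (n - c)\<bar>)"
        using r' unfolding n_def by (intro sum.cong refl) (simp add: sylvester_index_mat2)
      with False sylvester_row_sum_le show ?thesis by simp
    qed
    finally show "0 \<le> (\<Sum>c<n - 1. \<bar>index_mat ?A (r, c)\<bar>) \<and>
       (\<Sum>c<n - 1. \<bar>index_mat ?A (r, c)\<bar>) \<le> (if r < degree q then poly_l1 p else poly_l1 q)"
      by (simp add: sum_nonneg)
  qed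
  also have "\<dots> = poly_l1 p ^ degree q * poly_l1 q ^ (degree p - 1)"
  proof -
    have "{..<n - 1} = {..<degree q} \<union> {degree q..<n - 1}" using i by auto
    then have "(\<Prod>r<n - 1. if r < degree q then poly_l1 p else poly_l1 q) =
       (\<Prod>r<degree q. if r < degree q then poly_l1 p else poly_l1 q) *
       (\<Prod>r\<in>{degree q..<n - 1}. if r < degree q then poly_l1 p else poly_l1 q)"
      by (metis (no_types, lifting) prod.union_disjoint finite_lessThan finite_atLeastLessThan ivl_disj_int_one(2))
    also have "\<dots> = poly_l1 p ^ degree q * poly_l1 q ^ (n - 1 - degree q)" by simp
    finally show ?thesis using i by (simp add: n_def)
  qed
  finally show ?thesis .
qed

text \<open>Cramer's rule: if \<open>p(x) = 0\<close>, the resultant is a combination of multiples of \<open>q(x)\<close>, with cofactors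
  of the Sylvester matrix as coefficients.\<close>

lemma abs_resultant_le:
  fixes p q :: "int poly" and x :: real
  assumes px: "ipoly p x = 0" and x: "0 < x" "x \<le> 1" and deg: "degree p > 0"
  shows "\<bar>real_of_int (resultant p q)\<bar> \<le> \<bar>ipoly q x\<bar> * real (degree p) *
     real_of_int (poly_l1 p) ^ degree q * real_of_int (poly_l1 q) ^ (degree p - 1)"
proof -
  let ?S = "sylvester_mat p q"
  define n where "n = degree p + degree q"
  have S: "?S \<in> carrier_mat n n" unfolding n_def by (rule sylvester_carrier_mat)
  define C where "C = (\<lambda>i. real_of_int (cofactor ?S i (n - 1)))"
  have n0: "n > 0" using deg by (simp add: n_def)
  \<comment> \<open>the last row of the adjugate times the matrix is \<open>det\<close> times the last unit vector\<close>
  have orth: "(\<Sum>i<n. C i * real_of_int (index_mat ?S (i, j))) =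
      (if j = n - 1 then real_of_int (Determinant.det ?S) else 0)" if "j < n" for j
  proof -
    have "index_mat (adj_mat ?S * ?S) (n - 1, j) = index_mat (Determinant.det ?S \<cdot>\<^sub>m 1\<^sub>m n) (n - 1, j)"
      by (simp only: adj_mat(3)[OF S])
    moreover have "index_mat (adj_mat ?S * ?S) (n - 1, j) =
        (\<Sum>i<n. cofactor ?S i (n - 1) * index_mat ?S (i, j))"
      using that n0 S adj_mat(1)[OF S]
      by (simp add: times_mat_def scalar_prod_def atLeast0LessThan)
         (simp add: adj_mat_def n_def)
    ultimately have "(\<Sum>i<n. cofactor ?S i (n - 1) * index_mat ?S (i, j)) =
        (if j = n - 1 then Determinant.det ?S else 0)"
      using that n0 by auto
    from arg_cong[OF this, of real_of_int] show ?thesis by (simp add: C_def)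
  qed
  have "real_of_int (Determinant.det ?S) * x =
      (\<Sum>j<n. (if j = n - 1 then real_of_int (Determinant.det ?S) else 0) * x ^ (n - j))"
    using n0 by (subst sum.remove[of _ "n - 1"]) auto
  also have "\<dots> = (\<Sum>j<n. \<Sum>i<n. C i * real_of_int (index_mat ?S (i, j)) * x ^ (n - j))"
  proof (intro sum.cong refl)
    fix j assume "j \<in> {..<n}"
    then show "(if j = n - 1 then real_of_int (Determinant.det ?S) else 0) * x ^ (n - j) =
        (\<Sum>i<n. C i * real_of_int (index_mat ?S (i, j)) * x ^ (n - j))"
      by (subst orth[symmetric]) (simp_all only: lessThan_iff sum_distrib_right)
  qed
  also have "\<dots> = (\<Sum>i<n. C i * (\<Sum>j<n. real_of_int (index_mat ?S (i, j)) * x ^ (n - j)))"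
    by (subst sum.swap) (simp add: sum_distrib_left mult.assoc)
  also have "\<dots> = (\<Sum>i<n. if i < degree q then 0 else C i * (x ^ (n - i) * ipoly q x))"
    unfolding n_def
    by (intro sum.cong refl) (auto simp: sylvester_times_powers px simp del: of_int_poly_hom.hom_mult)
  also have "\<dots> = (\<Sum>i\<in>{degree q..<n}. C i * (x ^ (n - i) * ipoly q x))"
    by (intro sum.mono_neutral_cong_right) auto
  finally have "\<bar>real_of_int (Determinant.det ?S) * x\<bar> \<le>
      (\<Sum>i\<in>{degree q..<n}. \<bar>C i * (x ^ (n - i) * ipoly q x)\<bar>)"
    by (simp only: sum_abs)
  also have "\<dots> \<le> (\<Sum>i\<in>{degree q..<n}.
      real_of_int (poly_l1 p ^ degree q * poly_l1 q ^ (degree p - 1)) * (x * \<bar>ipoly q x\<bar>))"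
  proof (rule sum_mono)
    fix i assume i: "i \<in> {degree q..<n}"
    then have "\<bar>C i\<bar> \<le> real_of_int (poly_l1 p ^ degree q * poly_l1 q ^ (degree p - 1))"
      unfolding C_def using abs_cofactor_sylvester_le[of q i p "n - 1"] n0
      by (simp only: n_def of_int_abs[symmetric] of_int_le_iff) auto
    moreover have "\<bar>x ^ (n - i) * ipoly q x\<bar> \<le> x * \<bar>ipoly q x\<bar>"
    proof -
      have "x ^ (n - i) \<le> x ^ 1" using i x by (intro power_decreasing) auto
      then show ?thesis using x by (simp add: abs_mult mult_right_mono)
    qed
    ultimately show "\<bar>C i * (x ^ (n - i) * ipoly q x)\<bar> \<le>
      real_of_int (poly_l1 p ^ degree q * poly_l1 q ^ (degree p - 1)) * (x * \<bar>ipoly q x\<bar>)"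
      unfolding abs_mult[of "C i"] by (intro mult_mono) (auto simp: poly_l1_nonneg)
  qed
  also have "\<dots> = real (degree p) * real_of_int (poly_l1 p ^ degree q * poly_l1 q ^ (degree p - 1)) *
      \<bar>ipoly q x\<bar> * x"
    by (simp add: n_def)
  finally have "\<bar>real_of_int (Determinant.det ?S)\<bar> * x \<le>
      (real (degree p) * real_of_int (poly_l1 p ^ degree q * poly_l1 q ^ (degree p - 1)) *
      \<bar>ipoly q x\<bar>) * x"
    using x by (simp add: abs_mult)
  then have "\<bar>real_of_int (Determinant.det ?S)\<bar> \<le>
      real (degree p) * real_of_int (poly_l1 p ^ degree q * poly_l1 q ^ (degree p - 1)) *
      \<bar>ipoly q x\<bar>"
    using x by simp
  then show ?thesis by (simp add: mult_ac resultant_def)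
qed

lemma irreducible_degree_pos:
  assumes "irreducible p" "ipoly p x = 0"
  shows "degree p > 0"
proof (rule ccontr)
  assume "\<not> degree p > 0"
  then obtain c where c: "p = [:c:]" by (metis degree_eq_zeroE gr0I)
  have "c = 0" using assms(2) unfolding ipoly_altdef c by simp
  with assms(1) c show False by simp
qed

lemma irreducible_resultant_nonzero:
  fixes p q :: "int poly"
  assumes "irreducible p" "\<not> p dvd q"
  shows "resultant p q \<noteq> 0"
proof
  assume "resultant p q = 0"
  then have "degree (gcd p q) \<noteq> 0" by (simp add: resultant_0_gcd)
  then have "\<not> is_unit (gcd p q)" by (metis is_unit_poly_iff degree_pCons_0)
  then have "p dvd gcd p q" using irreducibleD'[OF assms(1), of "gcd p q"] by simp
  with assms(2) show False by (meson dvd_trans gcd_dvd2)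
qed

text \<open>If \<open>p\<close> does not divide \<open>q\<close>, their resultant is a nonzero integer, but it is bounded by a multiple of
  \<open>q(x) = 0\<close>.\<close>

lemma irreducible_root_imp_dvd:
  fixes p q :: "int poly" and x :: real
  assumes "irreducible p" "ipoly p x = 0" "ipoly q x = 0" "0 < x" "x \<le> 1"
  shows "p dvd q"
  using abs_resultant_le[of p x q] irreducible_resultant_nonzero[of p q] assms
    irreducible_degree_pos[of p x] by auto

text \<open>The resultant of \<open>p\<close> and \<open>q\<close> is a nonzero integer and so has absolute value at least \<open>1\<close>.\<close>

theorem liouville_inequality:
  fixes p q :: "int poly" and x :: real
  assumes irr: "irreducible p" and px: "ipoly p x = 0" and qx: "ipoly q x \<noteq> 0"
    and x: "0 < x" "x \<le> 1"
  shows "1 \<le> \<bar>ipoly q x\<bar> * real (degree p) *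
     real_of_int (poly_l1 p) ^ degree q * real_of_int (poly_l1 q) ^ (degree p - 1)"
proof -
  have "\<not> p dvd q"
  proof
    assume "p dvd q"
    then obtain r where "q = p * r" by (elim dvdE)
    with px qx show False by (simp only: ipoly_mult)
  qed
  then have "1 \<le> \<bar>real_of_int (resultant p q)\<bar>"
    using irreducible_resultant_nonzero[OF irr, of q] by linarith
  also note abs_resultant_le[OF px x irreducible_degree_pos[OF irr px], of q]
  finally show ?thesis .
qed

lemma min_int_poly_unique:
  assumes p: "irreducible p" "lead_coeff p > 0" "ipoly p x = 0"
    and q: "irreducible q" "lead_coeff q > 0" "ipoly q x = 0"
    and x: "0 < x" "x \<le> 1"
  shows "p = q"
proof -
  have "p dvd q" "q dvd p" using irreducible_root_imp_dvd p q x by auto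
  then have "normalize p = normalize q" by (rule associatedI)
  moreover have "normalize r = r" if "lead_coeff r > 0" for r :: "int poly"
    using that by (simp add: normalize_poly_def)
  ultimately show ?thesis using p q by metis
qed

lemma min_int_poly_exists:
  fixes x :: real
  assumes "algebraic x"
  shows "\<exists>p. irreducible p \<and> lead_coeff p > 0 \<and> ipoly p x = 0"
proof -
  obtain p where p: "p \<noteq> 0" "ipoly p x = 0" using algebraicE'[OF assms] by blast
  have "\<exists>q. irreducible q \<and> ipoly q x = 0"
  proof -
    have "p = 0 \<or> ipoly p x \<noteq> 0 \<or> (\<exists>q. irreducible q \<and> ipoly q x = 0)"
    proof (induction p rule: prime_divisors_induct)
      case zero
      then show ?case by simp
    next
      case (unit p)
      then show ?case by (auto simp: is_unit_poly_iff)
    next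
      case (factor q p)
      then show ?case by (auto simp: ipoly_mult prime_elem_imp_irreducible simp del: of_int_poly_hom.hom_mult
            dest: prime_imp_prime_elem)
    qed
    with p show ?thesis by blast
  qed
  then obtain q where q: "irreducible q" "ipoly q x = 0" by blast
  show ?thesis
  proof (cases "lead_coeff q > 0")
    case True
    with q show ?thesis by blast
  next
    case False
    with q(1) have "lead_coeff q < 0" by (metis irreducible_def leading_coeff_0_iff linorder_neqE)
    moreover have "irreducible (- q)"
      using q(1) irreducible_mult_unit_left[of "-1" q] by simp
    ultimately show ?thesis using q(2)
      by (intro exI[of _ "- q"]) (simp add: of_int_poly_hom.hom_uminus)
  qed
qed

lemma min_int_poly:
  assumes "algebraic x" "0 < x" "x \<le> 1"
  shows "irreducible (min_int_poly x)" "lead_coeff (min_int_poly x) > 0"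
    "ipoly (min_int_poly x) x = 0"
proof -
  have "\<exists>!p. irreducible p \<and> lead_coeff p > 0 \<and> ipoly p x = 0"
    using min_int_poly_exists[OF assms(1)] min_int_poly_unique assms(2,3) by blast
  from theI'[OF this] show "irreducible (min_int_poly x)" "lead_coeff (min_int_poly x) > 0"
    "ipoly (min_int_poly x) x = 0"
    unfolding min_int_poly_def by auto
qed

lemma finite_range_coeff: "finite (range (\<lambda>i. \<bar>coeff p i\<bar>))" for p :: "int poly"
proof (rule finite_subset)
  show "range (\<lambda>i. \<bar>coeff p i\<bar>) \<subseteq> insert 0 ((\<lambda>i. \<bar>coeff p i\<bar>) ` {..degree p})"
    using le_degree[of p] by (auto simp: image_iff)
qed auto

lemma abs_coeff_le_poly_height: "\<bar>coeff p i\<bar> \<le> poly_height p"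
  unfolding poly_height_def by (rule Max_ge[OF finite_range_coeff]) simp

lemma poly_height_ge_1: "p \<noteq> 0 \<Longrightarrow> poly_height p \<ge> 1"
  using abs_coeff_le_poly_height[of p "degree p"] leading_coeff_0_iff[of p] by linarith

lemma poly_l1_le_height: "poly_l1 p \<le> (int (degree p) + 1) * poly_height p"
proof -
  have "poly_l1 p \<le> (\<Sum>i\<le>degree p. poly_height p)"
    unfolding poly_l1_def by (intro sum_mono abs_coeff_le_poly_height)
  then show ?thesis by (simp add: algebra_simps)
qed

text \<open>A root of an irreducible polynomial cannot be very small, because the constant coefficient is a
  nonzero integer.\<close>

lemma inverse_root_le:
  fixes x :: real
  assumes irr: "irreducible p" and px: "ipoly p x = 0" and x: "0 < x" "x \<le> 1"
  shows "1 \<le> x * real_of_int (poly_l1 p)"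
proof -
  have c0: "coeff p 0 \<noteq> 0"
  proof
    assume "coeff p 0 = 0"
    then have "[:0, 1:] dvd p"
      using poly_eq_0_iff_dvd[of p 0] by (simp add: poly_0_coeff_0)
    then have "p dvd [:0, 1:]" using irreducibleD'[OF irr, of "[:0, 1:]"]
      by (auto simp: is_unit_poly_iff)
    then obtain r where "[:0, 1:] = p * r" by (elim dvdE)
    then have "ipoly [:0, 1:] x = ipoly p x * ipoly r x" by (simp only: ipoly_mult)
    with px x show False by simp
  qed
  have "1 \<le> \<bar>real_of_int (coeff p 0)\<bar>" using c0 by linarith
  also have "real_of_int (coeff p 0) = - (\<Sum>i\<in>{1..degree p}. real_of_int (coeff p i) * x ^ i)"
  proof -
    have "{..degree p} = insert 0 {1..degree p}" by auto
    then show ?thesis using px unfolding ipoly_altdef by simp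
  qed
  also have "\<bar>\<dots>\<bar> \<le> (\<Sum>i\<in>{1..degree p}. \<bar>real_of_int (coeff p i) * x ^ i\<bar>)"
    by (simp only: abs_minus_cancel sum_abs)
  also have "\<dots> \<le> (\<Sum>i\<in>{1..degree p}. \<bar>real_of_int (coeff p i)\<bar> * x)"
  proof (rule sum_mono)
    fix i assume "i \<in> {1..degree p}"
    then have "x ^ i \<le> x ^ 1" using x by (intro power_decreasing) auto
    then show "\<bar>real_of_int (coeff p i) * x ^ i\<bar> \<le> \<bar>real_of_int (coeff p i)\<bar> * x"
      using x by (simp add: abs_mult mult_left_mono)
  qed
  also have "\<dots> = x * real_of_int (\<Sum>i\<in>{1..degree p}. \<bar>coeff p i\<bar>)"
    by (simp add: sum_distrib_left mult.commute)
  also have "\<dots> \<le> x * real_of_int (poly_l1 p)"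
    using x sum_abs_coeff_le_poly_l1[of "{1..degree p}" p]
    by (intro mult_left_mono) (simp_all only: of_int_le_iff less_imp_le finite_atLeastAtMost)
  finally show ?thesis .
qed

section \<open>Multiplicative relations between shifts of an admissible number\<close>

lemma ipoly_prod: "ipoly (\<Prod>i\<in>I. f i) x = (\<Prod>i\<in>I. ipoly (f i) x)"
  by (simp add: of_int_poly_hom.hom_prod poly_prod)

lemma ipoly_linear_power: "ipoly ([:c, 1:] ^ k) x = (real_of_int c + x) ^ k"
  by (simp add: of_int_poly_hom.hom_power)

lemma ipoly_Qplus: "ipoly (Qplus Q m) x = (\<Prod>n\<in>{n. n < Q \<and> m n > 0}. (real n + x) ^ nat (m n))"
  unfolding Qplus_def ipoly_prod ipoly_linear_power by simp

lemma Qminus_eq_Qplus: "Qminus Q m = Qplus Q (\<lambda>n. - m n)"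
  by (simp add: Qminus_def Qplus_def)

lemma ipoly_Qplus_pos: "x > 0 \<Longrightarrow> ipoly (Qplus Q m) x > 0"
  unfolding ipoly_Qplus by (intro prod_pos) (auto intro!: zero_less_power add_nonneg_pos)

lemma ln_ipoly_Qplus:
  assumes "x > 0"
  shows "ln (ipoly (Qplus Q m) x) = (\<Sum>n\<in>{n. n < Q \<and> m n > 0}. real_of_int (m n) * ln (real n + x))"
proof -
  have "ln (ipoly (Qplus Q m) x) = (\<Sum>n\<in>{n. n < Q \<and> m n > 0}. ln ((real n + x) ^ nat (m n)))"
    unfolding ipoly_Qplus using assms by (intro ln_prod) (auto intro!: zero_less_power add_nonneg_pos)
  also have "\<dots> = (\<Sum>n\<in>{n. n < Q \<and> m n > 0}. real_of_int (m n) * ln (real n + x))"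
    using assms by (intro sum.cong refl) (auto simp: ln_realpow add_nonneg_pos)
  finally show ?thesis .
qed

lemma ln_Qplus_minus_ln_Qminus:
  assumes "x > 0"
  shows "ln (ipoly (Qplus Q m) x) - ln (ipoly (Qminus Q m) x) =
     (\<Sum>n<Q. real_of_int (m n) * ln (real n + x))"
proof -
  have "(\<Sum>n<Q. real_of_int (m n) * ln (real n + x)) =
     (\<Sum>n\<in>{n. n < Q \<and> m n > 0} \<union> {n. n < Q \<and> - m n > 0}. real_of_int (m n) * ln (real n + x))"
    by (intro sum.mono_neutral_right) auto
  also have "\<dots> = (\<Sum>n\<in>{n. n < Q \<and> m n > 0}. real_of_int (m n) * ln (real n + x)) +
     (\<Sum>n\<in>{n. n < Q \<and> - m n > 0}. real_of_int (m n) * ln (real n + x))"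
    by (intro sum.union_disjoint) auto
  finally show ?thesis
    unfolding Qminus_eq_Qplus ln_ipoly_Qplus[OF assms] by (simp add: sum_negf)
qed

lemma poly_Qplus: "poly (Qplus Q m) z = (\<Prod>n\<in>{n. n < Q \<and> m n > 0}. (int n + z) ^ nat (m n))"
  unfolding Qplus_def by (simp add: poly_prod)

lemma Qplus_neq_Qminus:
  assumes "n < Q" "m n \<noteq> 0"
  shows "Qplus Q m \<noteq> Qminus Q m"
proof -
  have *: "poly (Qplus Q m) (- int n) = 0 \<and> poly (Qminus Q m) (- int n) \<noteq> 0"
    if "n < Q" "m n > 0" for m :: "nat \<Rightarrow> int"
    using that unfolding Qminus_eq_Qplus poly_Qplus by auto
  show ?thesis
  proof (cases "m n > 0")
    case True
    with *[of m] assms show ?thesis by metis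
  next
    case False
    with *[of "\<lambda>n. - m n"] assms show ?thesis
      by (auto simp: Qminus_eq_Qplus)
  qed
qed

text \<open>Its vanishing at \<open>\<alpha>\<close> expresses the multiplicative relation
  \<open>(\<Prod>n<Q. (n + \<alpha>) powi m n) = (y + \<alpha>) / (x + \<alpha>)\<close>.\<close>

definition relation_poly :: "nat \<Rightarrow> (nat \<Rightarrow> int) \<Rightarrow> int \<Rightarrow> int \<Rightarrow> int poly" where
  "relation_poly Q m x y = Qplus Q m * [:x, 1:] - Qminus Q m * [:y, 1:]"

text \<open>Evaluation at \<open>- y\<close> or, if \<open>x = y\<close>, comparison of the roots of the coprime polynomials \<open>Qplus Q m\<close> and
  \<open>Qminus Q m\<close>.\<close>

lemma relation_poly_nonzero:
  assumes xy: "x \<ge> int Q" "y \<ge> int Q" and ne: "x \<noteq> y \<or> (\<exists>n<Q. m n \<noteq> 0)"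
  shows "relation_poly Q m x y \<noteq> 0"
proof (cases "x = y")
  case True
  with ne obtain n where "n < Q" "m n \<noteq> 0" by blast
  from Qplus_neq_Qminus[of n Q m, OF this] have "(Qplus Q m - Qminus Q m) * [:y, 1:] \<noteq> 0"
    by (simp only: mult_eq_0_iff) simp
  then show ?thesis using True unfolding relation_poly_def by (simp only: left_diff_distrib not_False_eq_True)
next
  case False
  have "poly (Qplus Q m) (- y) \<noteq> 0" unfolding poly_Qplus using xy by auto
  then have "poly (relation_poly Q m x y) (- y) \<noteq> 0"
    using False unfolding relation_poly_def by simp
  then show ?thesis by auto
qed

lemma ipoly_diff: "ipoly (p - q) x = ipoly p x - ipoly q x"
  by (simp add: of_int_poly_hom.hom_minus)

lemma ipoly_relation_poly:
  "ipoly (relation_poly Q m x y) \<alpha> =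
     ipoly (Qplus Q m) \<alpha> * (real_of_int x + \<alpha>) - ipoly (Qminus Q m) \<alpha> * (real_of_int y + \<alpha>)"
  unfolding relation_poly_def ipoly_diff ipoly_mult by simp

lemma sum_pos_parts_le:
  fixes m :: "nat \<Rightarrow> int"
  assumes "\<And>n. n < Q \<Longrightarrow> \<bar>m n\<bar> \<le> int k"
  shows "(\<Sum>n\<in>{n. n < Q \<and> m n > 0}. nat (m n)) \<le> k * Q"
proof -
  have "(\<Sum>n\<in>{n. n < Q \<and> m n > 0}. nat (m n)) \<le> (\<Sum>n\<in>{n. n < Q \<and> m n > 0}. k)"
    using assms by (intro sum_mono) force
  also have "\<dots> \<le> (\<Sum>n<Q. k)" by (intro sum_mono2) auto
  finally show ?thesis by (simp add: mult.commute)
qed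

lemma degree_Qplus_le:
  assumes "\<And>n. n < Q \<Longrightarrow> \<bar>m n\<bar> \<le> int k"
  shows "degree (Qplus Q m) \<le> k * Q"
proof -
  have "degree (Qplus Q m) \<le> (\<Sum>n\<in>{n. n < Q \<and> m n > 0}. nat (m n))"
    unfolding Qplus_def
    by (rule order_trans[OF degree_prod_sum_le]) (auto intro!: sum_mono simp: degree_power_eq)
  with sum_pos_parts_le[of Q m k, OF assms] show ?thesis by linarith
qed

lemma degree_relation_poly_le:
  assumes "\<And>n. n < Q \<Longrightarrow> \<bar>m n\<bar> \<le> int k"
  shows "degree (relation_poly Q m x y) \<le> k * Q + 1"
proof -
  have "degree (Qplus Q m' * [:c, 1:]) \<le> k * Q + 1" if "\<And>n. n < Q \<Longrightarrow> \<bar>m' n\<bar> \<le> int k" for m' c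
    using degree_mult_le[of "Qplus Q m'" "[:c, 1:]"] degree_Qplus_le[of Q m' k, OF that] by simp
  then show ?thesis unfolding relation_poly_def Qminus_eq_Qplus
    using assms by (intro degree_diff_le) auto
qed

text \<open>As \<open>Qplus\<close> and \<open>Qminus\<close> have nonnegative coefficients, this makes \<open>poly_l1\<close> multiplicative on
  them.\<close>

lemma poly_l1_eq_eval_1:
  assumes "\<And>i. coeff p i \<ge> 0"
  shows "poly_l1 p = poly p 1"
  using assms by (simp add: poly_l1_def poly_altdef)

lemma poly_l1_diff_le: "poly_l1 (p - q) \<le> poly_l1 p + poly_l1 q"
proof -
  have "poly_l1 (p - q) \<le> (\<Sum>i\<le>degree (p - q). \<bar>coeff p i\<bar>) + (\<Sum>i\<le>degree (p - q). \<bar>coeff q i\<bar>)"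
    unfolding poly_l1_def sum.distrib[symmetric] by (intro sum_mono) (simp add: abs_triangle_ineq4)
  also have "\<dots> \<le> poly_l1 p + poly_l1 q"
    by (intro add_mono sum_abs_coeff_le_poly_l1) auto
  finally show ?thesis .
qed

lemma coeff_mult_nonneg:
  fixes p q :: "int poly"
  assumes "\<And>i. coeff p i \<ge> 0" "\<And>i. coeff q i \<ge> 0"
  shows "coeff (p * q) i \<ge> 0"
  unfolding coeff_mult by (intro sum_nonneg mult_nonneg_nonneg assms)

lemma coeff_Qplus_nonneg: "coeff (Qplus Q m) i \<ge> 0"
proof -
  have lin: "coeff [:int n, 1:] i \<ge> 0" for n i
    by (cases i) (auto simp: coeff_pCons split: nat.split)
  have pow: "coeff ([:int n, 1:] ^ k) i \<ge> 0" for n k i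
  proof (induction k arbitrary: i)
    case 0
    then show ?case by simp
  next
    case (Suc k)
    then show ?case unfolding power_Suc by (intro coeff_mult_nonneg lin)
  qed
  have "coeff (\<Prod>n\<in>I. [:int n, 1:] ^ k n) i \<ge> 0" if "finite I" for I and k :: "nat \<Rightarrow> nat" and i
    using that
  proof (induction I arbitrary: i rule: finite_induct)
    case empty
    then show ?case by simp
  next
    case (insert n I)
    from coeff_mult_nonneg[OF pow[of n "k n"] insert.IH] insert.hyps show ?case by simp
  qed
  then show ?thesis unfolding Qplus_def by simp
qed

lemma ipoly_Qplus_le:
  assumes m: "\<And>n. n < Q \<Longrightarrow> \<bar>m n\<bar> \<le> int k" and x: "0 < x" "x \<le> 1"
  shows "ipoly (Qplus Q m) x \<le> real Q ^ (k * Q)"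
proof (cases "Q = 0")
  case True
  then show ?thesis by (simp add: ipoly_Qplus)
next
  case False
  have "ipoly (Qplus Q m) x \<le> (\<Prod>n\<in>{n. n < Q \<and> m n > 0}. real Q ^ nat (m n))"
    unfolding ipoly_Qplus using x by (intro prod_mono) (auto intro!: power_mono)
  also have "\<dots> = real Q ^ (\<Sum>n\<in>{n. n < Q \<and> m n > 0}. nat (m n))"
    by (simp add: power_sum)
  also have "\<dots> \<le> real Q ^ (k * Q)"
    using False sum_pos_parts_le[of Q m k, OF m] by (intro power_increasing) auto
  finally show ?thesis .
qed

lemma poly_l1_relation_poly_le:
  assumes m: "\<And>n. n < Q \<Longrightarrow> \<bar>m n\<bar> \<le> int k"
    and xy: "0 \<le> x" "x < int Y" "0 \<le> y" "y < int Y"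
  shows "real_of_int (poly_l1 (relation_poly Q m x y)) \<le> 2 * (real Q ^ (k * Q) * real Y)"
proof -
  have "real_of_int (poly_l1 (Qplus Q m' * [:c, 1:])) \<le> real Q ^ (k * Q) * real Y"
    if m': "\<And>n. n < Q \<Longrightarrow> \<bar>m' n\<bar> \<le> int k" and c: "0 \<le> c" "c < int Y" for m' c
  proof -
    have "coeff [:c, 1:] i \<ge> 0" for i using c
      by (cases i) (auto simp: coeff_pCons split: nat.split)
    then have "poly_l1 (Qplus Q m' * [:c, 1:]) = poly (Qplus Q m' * [:c, 1:]) 1"
      by (intro poly_l1_eq_eval_1 coeff_mult_nonneg coeff_Qplus_nonneg)
    then have "real_of_int (poly_l1 (Qplus Q m' * [:c, 1:])) = real_of_int (poly (Qplus Q m') 1) * (real_of_int c + 1)"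
      by (simp only: poly_mult) (simp add: add.commute)
    also have "real_of_int (poly (Qplus Q m') 1) = ipoly (Qplus Q m') 1"
      by (simp add: poly_Qplus ipoly_Qplus)
    also have "ipoly (Qplus Q m') 1 * (real_of_int c + 1) \<le> real Q ^ (k * Q) * real Y"
      using c ipoly_Qplus_le[of Q m' k 1, OF m'] by (intro mult_mono) auto
    finally show ?thesis .
  qed
  note le = this
  have "real_of_int (poly_l1 (Qplus Q m * [:x, 1:])) \<le> real Q ^ (k * Q) * real Y"
    "real_of_int (poly_l1 (Qminus Q m * [:y, 1:])) \<le> real Q ^ (k * Q) * real Y"
    unfolding Qminus_eq_Qplus by (rule le; use m xy in simp)+
  then have "real_of_int (poly_l1 (Qplus Q m * [:x, 1:]) + poly_l1 (Qminus Q m * [:y, 1:])) \<le>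
      2 * (real Q ^ (k * Q) * real Y)"
    unfolding of_int_add by linarith
  moreover have "poly_l1 (relation_poly Q m x y) \<le>
     poly_l1 (Qplus Q m * [:x, 1:]) + poly_l1 (Qminus Q m * [:y, 1:])"
    unfolding relation_poly_def by (rule poly_l1_diff_le)
  ultimately show ?thesis by linarith
qed

lemma Qplus_cong: "(\<And>n. n < Q \<Longrightarrow> m n = m' n) \<Longrightarrow> Qplus Q m = Qplus Q m'"
  unfolding Qplus_def by (intro prod.cong) auto

lemma admissible_range:
  assumes "\<alpha> \<in> admissible Q M" "Q \<ge> 1" "M \<ge> 1"
  shows "\<alpha> \<in> alg_irrationals" "0 < \<alpha>" "\<alpha> \<le> 1"
proof -
  have "exponent_vectors Q M \<noteq> {}"
  proof -
    have "(\<lambda>n. if n < Q then 1 else undefined) \<in> exponent_vectors Q M"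
      using assms by (auto simp: exponent_vectors_def PiE_def extensional_def intro!: exI[of _ 0])
    then show ?thesis by blast
  qed
  with assms(1) show a: "\<alpha> \<in> alg_irrationals"
    by (auto simp: admissible_def admissible1_def admissible2_def admissible2_at_def)
  then have "\<alpha> \<noteq> 0" by (auto simp: alg_irrationals_def)
  with a show "0 < \<alpha>" "\<alpha> \<le> 1" by (auto simp: alg_irrationals_def)
qed

text \<open>An admissible number either has a degree exceeding that of the polynomial, or the relation is
  excluded by the definition of \<open>admissible2_at\<close>; the case \<open>x = y\<close> of that definition excludes
  \<open>Qplus Q m = Qminus Q m\<close> at \<open>\<alpha>\<close>.\<close>

lemma relation_poly_not_root:
  assumes adm: "\<alpha> \<in> admissible Q M" and QM: "Q \<ge> 1" "M \<ge> 1"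
    and m: "\<And>n. n < Q \<Longrightarrow> \<bar>m n\<bar> \<le> int M"
    and xy: "x \<ge> int Q" "real_of_int x \<le> exp (2 * real Q ^ 2)"
       "y \<ge> int Q" "real_of_int y \<le> exp (2 * real Q ^ 2)"
    and ne: "x \<noteq> y \<or> (\<exists>n<Q. m n \<noteq> 0)"
  shows "ipoly (relation_poly Q m x y) \<alpha> \<noteq> 0"
proof
  assume root: "ipoly (relation_poly Q m x y) \<alpha> = 0"
  note range = admissible_range[OF adm QM]
  have alg: "algebraic \<alpha>" using range(1) by (simp add: alg_irrationals_def)
  note mp = min_int_poly[OF alg range(2,3)]
  from adm consider "\<alpha> \<in> admissible1 Q M" | "\<alpha> \<in> admissible2 Q M" by (auto simp: admissible_def)
  then show False
  proof cases
    case 1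
    have "min_int_poly \<alpha> dvd relation_poly Q m x y"
      using irreducible_root_imp_dvd[OF mp(1,3) root range(2,3)] .
    then have "alg_degree \<alpha> \<le> degree (relation_poly Q m x y)"
      unfolding alg_degree_def using relation_poly_nonzero[OF xy(1,3) ne] by (rule dvd_imp_degree_le)
    also have "\<dots> \<le> M * Q + 1" by (rule degree_relation_poly_le[OF m])
    finally show False using 1 by (simp add: admissible1_def)
  next
    case 2
    have pos: "real_of_int x + \<alpha> > 0" "real_of_int y + \<alpha> > 0"
      using xy QM range by (auto intro!: add_nonneg_pos)
    show False
    proof (cases "\<exists>n<Q. m n \<noteq> 0")
      case True
      define m' where "m' = restrict m {..<Q}"
      have "m n \<in> {- int M..int M}" if "n < Q" for n using m[OF that] by (simp add: abs_le_iff)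
      then have "m' \<in> exponent_vectors Q M"
        using True by (auto simp: exponent_vectors_def m'_def)
      with 2 have "\<alpha> \<in> admissible2_at Q M m'" by (auto simp: admissible2_def)
      then have "ipoly (Qplus Q m') \<alpha> / ipoly (Qminus Q m') \<alpha> \<noteq> (real_of_int y + \<alpha>) / (real_of_int x + \<alpha>)"
        using xy unfolding admissible2_at_def by auto
      moreover have "Qplus Q m' = Qplus Q m" "Qminus Q m' = Qminus Q m"
        unfolding Qminus_eq_Qplus by (auto intro!: Qplus_cong simp: m'_def)
      ultimately show False using root pos ipoly_Qplus_pos[OF range(2), of Q "\<lambda>n. - m n"]
        unfolding ipoly_relation_poly by (auto simp: field_simps Qminus_eq_Qplus)
    next
      case False
      then have "Qplus Q m = 1" "Qminus Q m = 1"
        by (auto simp: Qplus_def Qminus_def intro!: prod.neutral)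
      with root False ne show False unfolding ipoly_relation_poly by auto
    qed
  qed
qed

lemma abs_ln_diff_ge:
  fixes u v b :: real
  assumes "0 < u" "u \<le> b" "0 < v" "v \<le> b"
  shows "\<bar>u - v\<bar> / b \<le> \<bar>ln u - ln v\<bar>"
proof -
  have *: "(u - v) / b \<le> ln u - ln v" if "0 < v" "v \<le> u" "u \<le> b" for u v :: real
  proof -
    have "ln (v / u) \<le> v / u - 1" using that by (intro ln_le_minus_one) auto
    then have "(u - v) / u \<le> ln u - ln v" using that by (simp add: ln_div diff_divide_distrib)
    moreover have "(u - v) / b \<le> (u - v) / u" using that by (intro divide_left_mono) auto
    ultimately show ?thesis by linarith
  qed
  show ?thesis
  proof (cases "v \<le> u")
    case True
    with *[of v u] assms show ?thesis by simp
  next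
    case False
    with *[of u v] assms show ?thesis by simp
  qed
qed

text \<open>The frequency is \<open>ln U - ln V\<close> with \<open>U - V\<close> the value of the relation polynomial at \<open>\<alpha>\<close>; this value is nonzero
  and bounded below by the Liouville inequality. Both \<open>U\<close> and \<open>V\<close> are at most \<open>B\<close>, and the relation polynomial
  has \<open>poly_l1\<close> at most \<open>2 * B\<close>.\<close>

theorem frequency_separation:
  fixes \<mu> :: "nat \<Rightarrow> int" and x y :: nat
  assumes adm: "\<alpha> \<in> admissible Q M" and QM: "Q \<ge> 1" "M \<ge> 1"
    and k: "k \<le> M" and \<mu>: "\<And>n. n < Q \<Longrightarrow> \<bar>\<mu> n\<bar> \<le> int k"
    and Y: "real Y \<le> exp (2 * real Q ^ 2)" and xy: "x \<in> {Q..<Y}" "y \<in> {Q..<Y}"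
    and ne: "x \<noteq> y \<or> (\<exists>n<Q. \<mu> n \<noteq> 0)"
  defines "B \<equiv> real Q ^ (k * Q) * real Y" and "p \<equiv> min_int_poly \<alpha>"
  shows "1 \<le> B * (real (alg_degree \<alpha>) * real_of_int (poly_l1 p) ^ (k * Q + 1) *
     (2 * B) ^ (alg_degree \<alpha> - 1)) *
     \<bar>(\<Sum>n<Q. real_of_int (\<mu> n) * ln (real n + \<alpha>)) + (ln (real y + \<alpha>) - ln (real x + \<alpha>))\<bar>"
proof -
  note range = admissible_range[OF adm QM]
  have alg: "algebraic \<alpha>" using range(1) by (simp add: alg_irrationals_def)
  note mp = min_int_poly[OF alg range(2,3), folded p_def]
  let ?P = "relation_poly Q \<mu> (int y) (int x)"
  have p1: "real_of_int (poly_l1 p) \<ge> 1" using poly_l1_ge_1[of p] mp(1) by (auto simp: irreducible_def)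
  have root: "ipoly ?P \<alpha> \<noteq> 0"
  proof (rule relation_poly_not_root[OF adm QM])
    show "\<bar>\<mu> n\<bar> \<le> int M" if "n < Q" for n using \<mu>[OF that] k by linarith
  qed (use xy Y ne in auto)
  have l1: "real_of_int (poly_l1 ?P) \<le> 2 * B"
    unfolding B_def by (rule poly_l1_relation_poly_le[OF \<mu>]) (use xy in auto)
  have B0: "B > 0" unfolding B_def using xy QM by simp
  define U where "U = ipoly (Qplus Q \<mu>) \<alpha> * (real y + \<alpha>)"
  define V where "V = ipoly (Qminus Q \<mu>) \<alpha> * (real x + \<alpha>)"
  have UV: "ipoly ?P \<alpha> = U - V" by (simp add: ipoly_relation_poly U_def V_def)
  have U: "0 < U" "U \<le> B"
    unfolding U_def B_def using xy range ipoly_Qplus_pos[of \<alpha> Q \<mu>] ipoly_Qplus_le[of Q \<mu> k \<alpha>, OF \<mu>]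
    by (auto intro!: mult_pos_pos add_nonneg_pos mult_mono)
  have V: "0 < V" "V \<le> B"
    unfolding V_def B_def Qminus_eq_Qplus using xy range ipoly_Qplus_pos[of \<alpha> Q "\<lambda>n. - \<mu> n"]
      ipoly_Qplus_le[of Q "\<lambda>n. - \<mu> n" k \<alpha>] \<mu>
    by (auto intro!: mult_pos_pos add_nonneg_pos mult_mono)
  have lnUV: "ln U - ln V = (\<Sum>n<Q. real_of_int (\<mu> n) * ln (real n + \<alpha>)) + (ln (real y + \<alpha>) - ln (real x + \<alpha>))"
    unfolding ln_Qplus_minus_ln_Qminus[OF range(2), symmetric] U_def V_def
    using range ipoly_Qplus_pos[of \<alpha> Q \<mu>] ipoly_Qplus_pos[of \<alpha> Q "\<lambda>n. - \<mu> n"]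
    by (subst ln_mult, simp_all add: Qminus_eq_Qplus add_nonneg_pos)
       (subst ln_mult, simp_all add: add_nonneg_pos)
  have "1 \<le> \<bar>ipoly ?P \<alpha>\<bar> * real (degree p) *
     real_of_int (poly_l1 p) ^ degree ?P * real_of_int (poly_l1 ?P) ^ (degree p - 1)"
    by (rule liouville_inequality[OF mp(1,3) root range(2,3)])
  also have "\<dots> \<le> \<bar>ipoly ?P \<alpha>\<bar> * real (degree p) *
     real_of_int (poly_l1 p) ^ (k * Q + 1) * (2 * B) ^ (degree p - 1)"
    using p1 l1 degree_relation_poly_le[of Q \<mu> k "int y" "int x", OF \<mu>] poly_l1_nonneg[of ?P] B0
    by (intro mult_mono mult_left_mono power_increasing power_mono) auto
  also have "\<dots> = \<bar>U - V\<bar> * (real (degree p) * real_of_int (poly_l1 p) ^ (k * Q + 1) * (2 * B) ^ (degree p - 1))"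
    by (simp add: UV mult_ac)
  also have "\<dots> \<le> (B * \<bar>ln U - ln V\<bar>) * (real (degree p) * real_of_int (poly_l1 p) ^ (k * Q + 1) * (2 * B) ^ (degree p - 1))"
  proof (rule mult_right_mono)
    show "\<bar>U - V\<bar> \<le> B * \<bar>ln U - ln V\<bar>"
      using abs_ln_diff_ge[OF U V] B0 by (simp add: field_simps)
  qed (use p1 B0 in auto)
  finally show ?thesis unfolding lnUV alg_degree_def p_def by (simp only: mult_ac)
qed

lemma poly_l1_min_poly_le:
  "real_of_int (poly_l1 (min_int_poly \<alpha>)) \<le> (real (alg_degree \<alpha>) + 1) * real_of_int (alg_height \<alpha>)"
proof -
  have "real_of_int (poly_l1 (min_int_poly \<alpha>)) \<le>
      real_of_int ((int (degree (min_int_poly \<alpha>)) + 1) * poly_height (min_int_poly \<alpha>))"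
    by (rule of_int_le_iff[THEN iffD2]) (rule poly_l1_le_height)
  then show ?thesis by (simp add: alg_degree_def alg_height_def)
qed

lemma alg_height_ge_1:
  assumes "algebraic \<alpha>" "0 < \<alpha>" "\<alpha> \<le> 1"
  shows "alg_height \<alpha> \<ge> 1"
  unfolding alg_height_def using min_int_poly(1)[OF assms] by (intro poly_height_ge_1) auto

text \<open>In \<open>bigK\<close> the exponent \<open>M * Q + 1\<close> exceeds twice the degree \<open>e\<close> that occurs here; this slack absorbs the
  difference between \<open>(D + 1) * height\<close>, which bounds \<open>poly_l1\<close>, and \<open>sqrt (D + 1) * height\<close>.\<close>

lemma liouville_constant_le_bigK:
  assumes \<alpha>: "algebraic \<alpha>" "0 < \<alpha>" "\<alpha> \<le> 1" and H: "H \<ge> 1" and e: "2 * e + 2 \<le> M * Q + 1"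
    and B: "0 \<le> B" "B \<le> real (M * Q + 2)"
  shows "real (alg_degree \<alpha>) * real_of_int (poly_l1 (min_int_poly \<alpha>)) ^ e * B ^ (alg_degree \<alpha> - 1)
     \<le> bigK H Q M \<alpha>"
proof -
  define D where "D = real (alg_degree \<alpha>)"
  define h where "h = real_of_int (alg_height \<alpha>)"
  have h: "h \<ge> 1" using alg_height_ge_1[OF \<alpha>] by (simp add: h_def)
  have D: "D \<ge> 0" by (simp add: D_def)
  have "D * real_of_int (poly_l1 (min_int_poly \<alpha>)) ^ e \<le> (D + 1) * ((D + 1) * h) ^ e"
    using poly_l1_min_poly_le[of \<alpha>] D h poly_l1_nonneg[of "min_int_poly \<alpha>"]
    unfolding D_def[symmetric] h_def[symmetric] by (intro mult_mono power_mono) auto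
  also have "\<dots> = (D + 1) ^ (e + 1) * h ^ e" by (simp add: power_mult_distrib)
  also have "\<dots> \<le> (D + 1) ^ (e + 1) * h ^ (2 * e + 2)"
    using D h by (intro mult_left_mono power_increasing) auto
  also have "(D + 1) ^ (e + 1) = sqrt (D + 1) ^ (2 * e + 2)"
  proof -
    have "sqrt (D + 1) ^ (2 * e + 2) = (sqrt (D + 1) ^ 2) ^ (e + 1)"
      by (simp only: power_mult[symmetric]) (simp add: algebra_simps)
    then show ?thesis using D by simp
  qed
  also have "sqrt (D + 1) ^ (2 * e + 2) * h ^ (2 * e + 2) = (h * sqrt (D + 1)) ^ (2 * e + 2)"
    by (simp only: power_mult_distrib mult.commute)
  also have "\<dots> \<le> (h * sqrt (D + 1)) ^ (M * Q + 1)"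
  proof (rule power_increasing[OF e])
    have "1 * 1 \<le> h * sqrt (D + 1)" using h D by (intro mult_mono) auto
    then show "1 \<le> h * sqrt (D + 1)" by simp
  qed
  finally have 1: "D * real_of_int (poly_l1 (min_int_poly \<alpha>)) ^ e \<le> (h * sqrt (D + 1)) ^ (M * Q + 1)" .
  have "B \<le> H * real (M * Q + 2)"
    using B H mult_right_mono[of 1 H "real (M * Q + 2)"] by simp
  then have 2: "B ^ (alg_degree \<alpha> - 1) \<le> (H * real (M * Q + 2)) ^ (alg_degree \<alpha> - 1)"
    using B by (intro power_mono) auto
  have "D * real_of_int (poly_l1 (min_int_poly \<alpha>)) ^ e * B ^ (alg_degree \<alpha> - 1) \<le>
     (h * sqrt (D + 1)) ^ (M * Q + 1) * (H * real (M * Q + 2)) ^ (alg_degree \<alpha> - 1)"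
    using 1 2 B D h by (intro mult_mono) auto
  then show ?thesis unfolding bigK_def D_def h_def by (simp only: mult.commute)
qed

lemma one_over_alg_le_bigK:
  assumes \<alpha>: "algebraic \<alpha>" "0 < \<alpha>" "\<alpha> \<le> 1" and H: "H \<ge> 1" and MQ: "4 \<le> M * Q + 1"
  shows "1 \<le> \<alpha> * bigK H Q M \<alpha>" "1 \<le> bigK H Q M \<alpha>"
proof -
  note mp = min_int_poly[OF \<alpha>]
  have D: "real (alg_degree \<alpha>) \<ge> 1"
    unfolding alg_degree_def using irreducible_degree_pos[OF mp(1,3)] by simp
  have "1 \<le> \<alpha> * real_of_int (poly_l1 (min_int_poly \<alpha>))"
    by (rule inverse_root_le[OF mp(1,3) \<alpha>(2,3)])
  also have "\<dots> \<le> \<alpha> * (real (alg_degree \<alpha>) * real_of_int (poly_l1 (min_int_poly \<alpha>)))"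
    using D \<alpha> poly_l1_nonneg[of "min_int_poly \<alpha>"] mult_right_mono[OF D, of "real_of_int (poly_l1 (min_int_poly \<alpha>))"]
    by (intro mult_left_mono) auto
  also have "\<dots> \<le> \<alpha> * bigK H Q M \<alpha>"
    using liouville_constant_le_bigK[OF \<alpha> H, of 1 M Q 1] MQ \<alpha> by (intro mult_left_mono) auto
  finally show *: "1 \<le> \<alpha> * bigK H Q M \<alpha>" .
  then have "bigK H Q M \<alpha> > 0" using \<alpha> by (smt (verit) mult_nonneg_nonpos)
  then have "\<alpha> * bigK H Q M \<alpha> \<le> 1 * bigK H Q M \<alpha>" using \<alpha> by (intro mult_right_mono) auto
  with * show "1 \<le> bigK H Q M \<alpha>" by simp
qed

lemma height_bound_ge_1:
  assumes "Q \<ge> 1" "M \<ge> 1" "\<And>P. P \<in> difference_polys Q M \<Longrightarrow> real_of_int (poly_height P) \<le> H"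
  shows "H \<ge> 1"
proof -
  define m :: "nat \<Rightarrow> int" where "m = (\<lambda>n. if n < Q then 1 else undefined)"
  have m: "m \<in> exponent_vectors Q M"
    using assms by (auto simp: m_def exponent_vectors_def PiE_def extensional_def intro!: exI[of _ 0])
  have "Qplus Q m \<noteq> Qminus Q m" using assms(1) by (intro Qplus_neq_Qminus[of 0]) (auto simp: m_def)
  then have "poly_height (Qplus Q m - Qminus Q m) \<ge> 1" by (intro poly_height_ge_1) simp
  moreover have "real_of_int (poly_height (Qplus Q m - Qminus Q m)) \<le> H"
    using m by (intro assms(3)) (auto simp: difference_polys_def)
  ultimately show ?thesis by linarith
qed

text \<open>If \<open>\<alpha>\<close> is not admissible, some relation with bounded exponents and with \<open>x\<close>, \<open>y\<close> in a bounded range holds,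
  so \<open>\<alpha>\<close> is a root of one of finitely many nonzero relation polynomials.\<close>

theorem finite_exceptional:
  assumes "A > 0"
  shows "finite {\<alpha> \<in> {A..1}. algebraic \<alpha> \<and> \<alpha> \<notin> \<rat> \<and> \<alpha> \<notin> admissible Q M}"
proof (rule finite_subset)
  define R where "R = {x :: int. real_of_int x \<in> {real Q..exp (2 * real Q ^ 2)}}"
  define E where "E = (\<Union>m\<in>exponent_vectors Q M. \<Union>x\<in>R. \<Union>y\<in>R. {\<alpha>. ipoly (relation_poly Q m y x) \<alpha> = 0})"
  have "R \<subseteq> {int Q..\<lfloor>exp (2 * real Q ^ 2)\<rfloor>}" by (auto simp: R_def le_floor_iff)
  then have "finite R" by (rule finite_subset) simp
  moreover have "finite (exponent_vectors Q M)"
    unfolding exponent_vectors_def by (rule finite_subset[OF _ finite_PiE[of "{..<Q}" "\<lambda>_. {- int M..int M}"]]) auto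
  moreover have "finite {\<alpha>. ipoly (relation_poly Q m y x) \<alpha> = 0}"
    if "m \<in> exponent_vectors Q M" "x \<in> R" "y \<in> R" for m x y
  proof (rule poly_roots_finite)
    have "relation_poly Q m y x \<noteq> 0"
      using that by (intro relation_poly_nonzero) (auto simp: R_def exponent_vectors_def)
    then show "map_poly real_of_int (relation_poly Q m y x) \<noteq> 0" by simp
  qed
  ultimately show "finite E" unfolding E_def by blast
  show "{\<alpha> \<in> {A..1}. algebraic \<alpha> \<and> \<alpha> \<notin> \<rat> \<and> \<alpha> \<notin> admissible Q M} \<subseteq> E"
  proof clarify
    fix \<alpha> assume \<alpha>: "\<alpha> \<in> {A..1}" "algebraic \<alpha>" "\<alpha> \<notin> \<rat>" "\<alpha> \<notin> admissible Q M"
    then have "\<alpha> \<in> alg_irrationals" "\<alpha> > 0" using assms by (auto simp: alg_irrationals_def)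
    with \<alpha>(4) obtain m where m: "m \<in> exponent_vectors Q M" "\<alpha> \<notin> admissible2_at Q M m" "\<alpha> \<notin> admissible1 Q M"
      by (auto simp: admissible_def admissible2_def)
    with \<open>\<alpha> \<in> alg_irrationals\<close> obtain x y where xy: "x \<in> R" "y \<in> R"
      "ipoly (Qplus Q m) \<alpha> / ipoly (Qminus Q m) \<alpha> = (real_of_int x + \<alpha>) / (real_of_int y + \<alpha>)"
      by (auto simp: admissible2_at_def R_def)
    have "real_of_int y + \<alpha> > 0" using xy(2) \<open>\<alpha> > 0\<close> by (auto simp: R_def intro!: add_nonneg_pos)
    then have "ipoly (relation_poly Q m y x) \<alpha> = 0"
      unfolding ipoly_relation_poly using xy(3) ipoly_Qplus_pos[OF \<open>\<alpha> > 0\<close>, of Q "\<lambda>n. - m n"]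
      by (simp add: field_simps Qminus_eq_Qplus)
    with m xy show "\<alpha> \<in> E" by (auto simp: E_def)
  qed
qed

section \<open>Closed polygons\<close>

text \<open>By the intermediate value theorem \<open>\<bar>b + c * cis t\<bar>\<close> takes the value \<open>\<bar>z\<bar>\<close> for some \<open>t\<close>; rotate.\<close>

lemma two_circles:
  fixes z :: complex
  assumes "0 \<le> b" "0 \<le> c" "\<bar>b - c\<bar> \<le> norm z" "norm z \<le> b + c"
  shows "\<exists>p q. norm p = 1 \<and> norm q = 1 \<and> of_real b * p + of_real c * q = z"
proof -
  define f where "f = (\<lambda>t. norm (of_real b + of_real c * cis t))"
  have f0: "f 0 = b + c" using assms by (simp add: f_def flip: of_real_add)
  have fpi: "f pi = \<bar>b - c\<bar>" by (simp add: f_def flip: of_real_diff)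
  have "continuous_on {0..pi} f" unfolding f_def by (intro continuous_intros)
  then obtain t where t: "f t = norm z"
    using IVT2'[of f pi "norm z" 0] f0 fpi assms by auto
  show ?thesis
  proof (cases "z = 0")
    case True
    with t have "of_real b * 1 + of_real c * cis t = z" by (simp add: f_def)
    then show ?thesis by (intro exI[of _ 1] exI[of _ "cis t"]) simp
  next
    case False
    define v where "v = of_real b + of_real c * cis t"
    have v: "norm v = norm z" using t by (simp add: f_def v_def)
    with False have v0: "v \<noteq> 0" by auto
    have "of_real b * (z / v) + of_real c * (z / v * cis t) = z / v * v"
    proof -
      have "z / v * v = z / v * (of_real b + of_real c * cis t)" by (simp only: v_def)
      then show ?thesis by (simp only: distrib_left mult_ac)
    qed
    with v v0 False show ?thesis
      by (intro exI[of _ "z / v"] exI[of _ "z / v * cis t"]) (simp add: norm_mult norm_divide)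
  qed
qed

text \<open>Greedy choice: each new term gets the sign opposite to the current partial sum.\<close>

lemma balanced_signs:
  fixes a :: "nat \<Rightarrow> real"
  assumes "\<And>n. 0 \<le> a n" "\<And>n. a n \<le> M"
  shows "\<exists>e. (\<forall>n. e n = 1 \<or> e n = - 1) \<and> \<bar>\<Sum>n<m. e n * a n\<bar> \<le> M"
proof (induction m)
  case 0
  then show ?case using assms[of 0] by (intro exI[of _ "\<lambda>_. 1"]) auto
next
  case (Suc m)
  then obtain e where e: "\<forall>n. e n = 1 \<or> e n = - 1" "\<bar>\<Sum>n<m. e n * a n\<bar> \<le> M" by blast
  define s where "s = (\<Sum>n<m. e n * a n)"
  define x :: real where "x = (if s \<ge> 0 then - 1 else 1)"
  have "(\<Sum>n<Suc m. (e(m := x)) n * a n) = s + x * a m"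
    unfolding s_def by simp
  moreover have "\<bar>s + x * a m\<bar> \<le> M"
    using assms[of m] e(2) unfolding s_def[symmetric] x_def by auto
  ultimately show ?case using e(1)
    by (intro exI[of _ "e(m := x)"]) (auto simp: x_def)
qed

text \<open>Point the longest side \<open>a 0\<close> away from \<open>w\<close>; then the remaining sides have to reach a point at distance
  \<open>\<bar>w\<bar> + a 0\<close>. Split them into two groups whose lengths differ by at most \<open>a 0\<close>, keep the sides within each group
  parallel, and apply \<open>two_circles\<close>.\<close>

lemma polygon:
  fixes a :: "nat \<Rightarrow> real" and w :: complex
  assumes a: "\<And>n. 0 \<le> a n" "\<And>n. a (Suc n) \<le> a 0" and w: "w \<noteq> 0"
    and le: "norm w + a 0 \<le> (\<Sum>n<m. a (Suc n))"
  shows "\<exists>u. (\<forall>n. norm (u n) = 1) \<and> (\<Sum>n<Suc m. of_real (a n) * u n) = w"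
proof -
  obtain e where e: "\<And>n. e n = 1 \<or> e n = - 1" "\<bar>\<Sum>n<m. e n * a (Suc n)\<bar> \<le> a 0"
    using balanced_signs[of "\<lambda>n. a (Suc n)" "a 0" m] a by blast
  define B where "B = {n. n < m \<and> e n = 1}"
  define C where "C = {n. n < m \<and> e n \<noteq> 1}"
  have BC: "finite B" "finite C" "B \<inter> C = {}" "{..<m} = B \<union> C" by (auto simp: B_def C_def)
  define b where "b = (\<Sum>n\<in>B. a (Suc n))"
  define c where "c = (\<Sum>n\<in>C. a (Suc n))"
  have sum_split: "(\<Sum>n<m. g n) = sum g B + sum g C" for g :: "nat \<Rightarrow> 'z :: comm_monoid_add"
    unfolding BC(4) using BC by (intro sum.union_disjoint) auto
  have bc: "b + c = (\<Sum>n<m. a (Suc n))" by (simp add: sum_split b_def c_def)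
  have "(\<Sum>n<m. e n * a (Suc n)) = b - c"
  proof -
    have "(\<Sum>n\<in>B. e n * a (Suc n)) = b" unfolding b_def by (intro sum.cong) (auto simp: B_def)
    moreover have "(\<Sum>n\<in>C. e n * a (Suc n)) = (\<Sum>n\<in>C. - a (Suc n))"
    proof (intro sum.cong refl)
      fix n assume "n \<in> C"
      then have "e n = - 1" using e(1)[of n] by (auto simp: C_def)
      then show "e n * a (Suc n) = - a (Suc n)" by simp
    qed
    ultimately show ?thesis by (simp add: sum_split c_def sum_negf)
  qed
  with e(2) have diff: "\<bar>b - c\<bar> \<le> a 0" by simp
  \<comment> \<open>the longest side is turned away from \<open>w\<close>, so that \<open>z\<close> is not shorter than \<open>a 0\<close>\<close>
  define u0 where "u0 = - w / of_real (norm w)"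
  have u0: "norm u0 = 1" using w by (simp add: u0_def norm_divide)
  define z where "z = w - of_real (a 0) * u0"
  have "z = w * of_real (1 + a 0 / norm w)" using w by (simp add: z_def u0_def field_simps)
  then have "norm z = norm w * \<bar>1 + a 0 / norm w\<bar>" by (simp only: norm_mult norm_of_real)
  also have "\<bar>1 + a 0 / norm w\<bar> = 1 + a 0 / norm w" using a(1)[of 0] by simp
  finally have nz: "norm z = norm w + a 0" using w by (simp add: distrib_left)
  obtain p q where pq: "norm p = 1" "norm q = 1" "of_real b * p + of_real c * q = z"
  proof -
    have "0 \<le> b" "0 \<le> c" using a by (auto simp: b_def c_def sum_nonneg)
    moreover have "\<bar>b - c\<bar> \<le> norm z" "norm z \<le> b + c" using diff nz le bc norm_ge_zero[of w] by linarith+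
    ultimately show ?thesis using two_circles that by blast
  qed
  define u where "u = (\<lambda>n. case n of 0 \<Rightarrow> u0 | Suc n \<Rightarrow> if e n = 1 then p else q)"
  have "(\<Sum>n<Suc m. of_real (a n) * u n) = of_real (a 0) * u0 + (\<Sum>n<m. of_real (a (Suc n)) * u (Suc n))"
    by (subst sum.lessThan_Suc_shift) (simp add: u_def)
  also have "(\<Sum>n<m. of_real (a (Suc n)) * u (Suc n)) = of_real b * p + of_real c * q"
  proof -
    have "(\<Sum>n\<in>B. of_real (a (Suc n)) * u (Suc n)) = of_real b * p"
      unfolding b_def of_real_sum sum_distrib_right by (intro sum.cong) (auto simp: B_def u_def)
    moreover have "(\<Sum>n\<in>C. of_real (a (Suc n)) * u (Suc n)) = of_real c * q"
      unfolding c_def of_real_sum sum_distrib_right by (intro sum.cong) (auto simp: C_def u_def)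
    ultimately show ?thesis by (simp add: sum_split)
  qed
  also have "of_real (a 0) * u0 + (of_real b * p + of_real c * q) = w" by (simp add: pq z_def)
  finally have "(\<Sum>n<Suc m. of_real (a n) * u n) = w" .
  moreover have "norm (u n) = 1" for n by (cases n) (simp_all add: u_def u0 pq)
  ultimately show ?thesis by blast
qed

section \<open>A nonnegative kernel on the torus and weighted mean squares\<close>

lemma norm_integral_cis_le:
  assumes "\<omega> \<noteq> (0::real)" "c \<le> d"
  shows "norm (integral {c..d} (\<lambda>t. cis (t * \<omega>))) \<le> 2 / \<bar>\<omega>\<bar>"
proof -
  define F where "F = (\<lambda>z. exp (\<i> * of_real \<omega> * z) / (\<i> * of_real \<omega>))"
  have cis_eq: "cis (t * \<omega>) = exp (\<i> * of_real \<omega> * of_real t)" for t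
    by (simp add: cis_conv_exp mult_ac)
  have "((\<lambda>t. cis (t * \<omega>)) has_integral F (of_real d) - F (of_real c)) {c..d}"
  proof (rule fundamental_theorem_of_calculus[OF assms(2)])
    fix t assume "t \<in> {c..d}"
    show "((\<lambda>t. F (of_real t)) has_vector_derivative cis (t * \<omega>)) (at t within {c..d})"
      unfolding F_def cis_eq using assms(1)
      by (intro has_vector_derivative_real_field) (auto intro!: derivative_eq_intros)
  qed
  then have "integral {c..d} (\<lambda>t. cis (t * \<omega>)) = F (of_real d) - F (of_real c)"
    by (rule integral_unique)
  also have "norm \<dots> \<le> norm (F (of_real d)) + norm (F (of_real c))" by (rule norm_triangle_ineq4)
  also have "\<dots> = 2 / \<bar>\<omega>\<bar>" by (simp add: F_def norm_divide norm_mult)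
  finally show ?thesis .
qed

text \<open>\<open>(1 + cos t) / 2 = cis (- t) * (1 + cis t)\<^sup>2 / 4\<close> and the binomial theorem.\<close>

lemma cos_kernel_expansion:
  "complex_of_real (((1 + cos t) / 2) ^ k) =
     (\<Sum>j\<le>2 * k. of_real (real (2 * k choose j) / 4 ^ k) * cis ((real j - real k) * t))"
proof -
  have "complex_of_real ((1 + cos t) / 2) = cis (- t) * (1 + cis t) ^ 2 / 4"
  proof -
    have "cis (- t) * (1 + cis t) ^ 2 = cis (- t) + 2 * (cis (- t) * cis t) + cis (- t) * cis t * cis t"
      by (simp add: power2_eq_square algebra_simps)
    also have "\<dots> = cis (- t) + 2 + cis t" by (simp add: cis_mult)
    also have "\<dots> = of_real (2 + 2 * cos t)" by (simp add: complex_eq_iff)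
    finally show ?thesis by simp
  qed
  then have "complex_of_real (((1 + cos t) / 2) ^ k) = (cis (- t) * (1 + cis t) ^ 2 / 4) ^ k"
    by (simp only: of_real_power)
  also have "\<dots> = cis (- (real k * t)) * (cis t + 1) ^ (2 * k) / 4 ^ k"
    using Complex.DeMoivre[of "- t" k]
    by (simp add: power_divide power_mult_distrib power_mult add.commute)
  also have "(cis t + 1) ^ (2 * k) = (\<Sum>j\<le>2 * k. of_nat (2 * k choose j) * cis (real j * t))"
    by (simp add: binomial_ring Complex.DeMoivre)
  also have "cis (- (real k * t)) * \<dots> / 4 ^ k =
      (\<Sum>j\<le>2 * k. of_real (real (2 * k choose j) / 4 ^ k) * cis ((real j - real k) * t))"
    unfolding sum_distrib_left sum_divide_distrib
  proof (intro sum.cong refl)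
    fix j
    have "cis ((real j - real k) * t) = cis (- (real k * t)) * cis (real j * t)"
      by (simp add: cis_mult algebra_simps)
    then show "cis (- (real k * t)) * (of_nat (2 * k choose j) * cis (real j * t)) / 4 ^ k =
       of_real (real (2 * k choose j) / 4 ^ k) * cis ((real j - real k) * t)" by simp
  qed
  finally show ?thesis .
qed

text \<open>The exponents \<open>\<kappa> n\<close> may differ, because multiplying the kernel by \<open>(1 + cos \<theta>\<^sub>j) / 2\<close> raises a single one of
  them.\<close>

definition torus_kernel :: "nat \<Rightarrow> (nat \<Rightarrow> real) \<Rightarrow> (nat \<Rightarrow> real) \<Rightarrow> (nat \<Rightarrow> nat) \<Rightarrow> real \<Rightarrow> real" where
  "torus_kernel Q \<phi> l \<kappa> t = (\<Prod>n<Q. ((1 + cos (\<phi> n + t * l n)) / 2) ^ \<kappa> n)"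

text \<open>The mean of the kernel over the torus, i.e. its constant Fourier coefficient.\<close>

definition kernel_mean :: "nat \<Rightarrow> (nat \<Rightarrow> nat) \<Rightarrow> real" where
  "kernel_mean Q \<kappa> = (\<Prod>n<Q. real (2 * \<kappa> n choose \<kappa> n) / 4 ^ \<kappa> n)"

lemma torus_kernel_bounds: "0 \<le> torus_kernel Q \<phi> l \<kappa> t" "torus_kernel Q \<phi> l \<kappa> t \<le> 1"
proof -
  have c: "0 \<le> (1 + cos x) / 2 \<and> (1 + cos x) / 2 \<le> 1" for x :: real
  proof -
    have "(1 + cos x) / 2 = (cos (x / 2))\<^sup>2" using cos_double_cos[of "x / 2"] by simp
    then show ?thesis by (simp add: abs_square_le_1)
  qed
  then show "0 \<le> torus_kernel Q \<phi> l \<kappa> t" "torus_kernel Q \<phi> l \<kappa> t \<le> 1"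
    unfolding torus_kernel_def by (auto intro!: prod_nonneg prod_le_1 power_le_one)
qed

lemma continuous_torus_kernel [continuous_intros]:
  "continuous_on S (\<lambda>t. torus_kernel Q \<phi> l \<kappa> t)"
  unfolding torus_kernel_def by (intro continuous_intros) auto

lemma torus_kernel_expansion:
  "complex_of_real (torus_kernel Q \<phi> l \<kappa> t) =
    (\<Sum>m\<in>PiE {..<Q} (\<lambda>n. {..2 * \<kappa> n}). of_real (\<Prod>n<Q. real (2 * \<kappa> n choose m n) / 4 ^ \<kappa> n) *
       (cis (\<Sum>n<Q. (real (m n) - real (\<kappa> n)) * \<phi> n) *
        cis (t * (\<Sum>n<Q. (real (m n) - real (\<kappa> n)) * l n))))"
proof -
  have cis_sum: "(\<Prod>n<Q. cis (h n)) = cis (\<Sum>n<Q. h n)" for h :: "nat \<Rightarrow> real" and Q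
    by (induction Q) (simp_all add: cis_mult)
  have "complex_of_real (torus_kernel Q \<phi> l \<kappa> t) =
    (\<Prod>n<Q. \<Sum>j\<le>2 * \<kappa> n. of_real (real (2 * \<kappa> n choose j) / 4 ^ \<kappa> n) *
       cis ((real j - real (\<kappa> n)) * (\<phi> n + t * l n)))"
    unfolding torus_kernel_def of_real_prod by (intro prod.cong refl cos_kernel_expansion)
  also have "\<dots> = (\<Sum>m\<in>PiE {..<Q} (\<lambda>n. {..2 * \<kappa> n}). \<Prod>n<Q. of_real (real (2 * \<kappa> n choose m n) / 4 ^ \<kappa> n) *
       cis ((real (m n) - real (\<kappa> n)) * (\<phi> n + t * l n)))"
    by (rule prod_of_sums) auto
  also have "\<dots> = (\<Sum>m\<in>PiE {..<Q} (\<lambda>n. {..2 * \<kappa> n}). of_real (\<Prod>n<Q. real (2 * \<kappa> n choose m n) / 4 ^ \<kappa> n) *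
       (cis (\<Sum>n<Q. (real (m n) - real (\<kappa> n)) * \<phi> n) *
        cis (t * (\<Sum>n<Q. (real (m n) - real (\<kappa> n)) * l n))))"
  proof (intro sum.cong refl)
    fix m
    have "(\<Prod>n<Q. cis ((real (m n) - real (\<kappa> n)) * (\<phi> n + t * l n))) =
      cis ((\<Sum>n<Q. (real (m n) - real (\<kappa> n)) * \<phi> n) + t * (\<Sum>n<Q. (real (m n) - real (\<kappa> n)) * l n))"
      unfolding cis_sum sum_distrib_left sum.distrib[symmetric]
      by (rule arg_cong[where f = cis], intro sum.cong refl) (simp add: algebra_simps)
    then show "(\<Prod>n<Q. of_real (real (2 * \<kappa> n choose m n) / 4 ^ \<kappa> n) *
       cis ((real (m n) - real (\<kappa> n)) * (\<phi> n + t * l n))) =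
       of_real (\<Prod>n<Q. real (2 * \<kappa> n choose m n) / 4 ^ \<kappa> n) *
       (cis (\<Sum>n<Q. (real (m n) - real (\<kappa> n)) * \<phi> n) *
        cis (t * (\<Sum>n<Q. (real (m n) - real (\<kappa> n)) * l n)))"
      by (simp only: prod.distrib cis_mult of_real_prod)
  qed
  finally show ?thesis .
qed

lemma sum_kernel_coeffs:
  fixes Q :: nat
  shows
  "(\<Sum>m\<in>PiE {..<Q} (\<lambda>n. {..2 * \<kappa> n}). \<Prod>n<Q. real (2 * \<kappa> n choose m n) / 4 ^ \<kappa> n) = 1"
proof -
  have "(\<Sum>j\<le>2 * k. real (2 * k choose j) / 4 ^ k) = 1" for k
  proof -
    have "(\<Sum>j\<le>2 * k. real (2 * k choose j)) = real (2 ^ (2 * k))"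
      unfolding choose_row_sum[symmetric] by simp
    then show ?thesis by (simp add: power_mult flip: sum_divide_distrib)
  qed
  note row = this
  have "(\<Sum>m\<in>PiE {..<Q} (\<lambda>n. {..2 * \<kappa> n}). \<Prod>n<Q. real (2 * \<kappa> n choose m n) / 4 ^ \<kappa> n) =
      (\<Prod>n<Q. \<Sum>j\<le>2 * \<kappa> n. real (2 * \<kappa> n choose j) / 4 ^ \<kappa> n)"
    by (rule prod_of_sums[symmetric]) auto
  then show ?thesis by (simp only: row prod.neutral_const)
qed

text \<open>Expand the kernel. The Fourier coefficients are nonnegative with sum \<open>1\<close>, and every nonzero frequency
  \<open>\<ge> \<eta>\<close> contributes at most \<open>2 / \<eta>\<close>; only the constant term has frequency zero, and only if \<open>\<omega> = 0\<close>.\<close>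

lemma norm_kernel_integral_minus_mean_le:
  fixes \<omega> \<eta> c d :: real
  assumes \<eta>: "\<eta> > 0" and cd: "c \<le> d"
    and sep: "\<And>m. m \<in> PiE {..<Q} (\<lambda>n. {..2 * \<kappa> n}) \<Longrightarrow> \<omega> \<noteq> 0 \<or> (\<exists>n<Q. m n \<noteq> \<kappa> n) \<Longrightarrow>
        \<eta> \<le> \<bar>(\<Sum>n<Q. (real (m n) - real (\<kappa> n)) * l n) + \<omega>\<bar>"
  shows "norm (integral {c..d} (\<lambda>t. of_real (torus_kernel Q \<phi> l \<kappa> t) * cis (t * \<omega>)) -
     (if \<omega> = 0 then of_real (kernel_mean Q \<kappa> * (d - c)) else 0)) \<le> 2 / \<eta>"
proof -
  define I where "I = PiE {..<Q} (\<lambda>n. {..2 * \<kappa> n})"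
  define P where "P = (\<lambda>m. \<Prod>n<Q. real (2 * \<kappa> n choose m n) / 4 ^ \<kappa> n)"
  define \<Phi> where "\<Phi> = (\<lambda>m. \<Sum>n<Q. (real (m n) - real (\<kappa> n)) * \<phi> n)"
  define L where "L = (\<lambda>m. \<Sum>n<Q. (real (m n) - real (\<kappa> n)) * l n)"
  define m0 where "m0 = restrict \<kappa> {..<Q}"
  have finI: "finite I" unfolding I_def by (intro finite_PiE) auto
  have P0: "P m \<ge> 0" for m unfolding P_def by (intro prod_nonneg) auto
  have m0: "m0 \<in> I" by (auto simp: m0_def I_def)
  have "of_real (torus_kernel Q \<phi> l \<kappa> t) * cis (t * \<omega>) =
      (\<Sum>m\<in>I. (of_real (P m) * cis (\<Phi> m)) * cis (t * (L m + \<omega>)))" for t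
  proof -
    have "of_real (torus_kernel Q \<phi> l \<kappa> t) * cis (t * \<omega>) =
        (\<Sum>m\<in>I. of_real (P m) * (cis (\<Phi> m) * cis (t * L m)) * cis (t * \<omega>))"
      unfolding torus_kernel_expansion I_def P_def L_def \<Phi>_def by (rule sum_distrib_right)
    also have "\<dots> = (\<Sum>m\<in>I. (of_real (P m) * cis (\<Phi> m)) * cis (t * (L m + \<omega>)))"
    proof (intro sum.cong refl)
      fix m
      have "cis (t * (L m + \<omega>)) = cis (t * L m) * cis (t * \<omega>)" by (simp only: cis_mult distrib_left)
      then show "of_real (P m) * (cis (\<Phi> m) * cis (t * L m)) * cis (t * \<omega>) =
          (of_real (P m) * cis (\<Phi> m)) * cis (t * (L m + \<omega>))" by (simp only: mult.assoc)
    qed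
    finally show ?thesis .
  qed
  then have "integral {c..d} (\<lambda>t. of_real (torus_kernel Q \<phi> l \<kappa> t) * cis (t * \<omega>)) =
      integral {c..d} (\<lambda>t. \<Sum>m\<in>I. (of_real (P m) * cis (\<Phi> m)) * cis (t * (L m + \<omega>)))"
    by (simp only:)
  also have "\<dots> = (\<Sum>m\<in>I. integral {c..d} (\<lambda>t. (of_real (P m) * cis (\<Phi> m)) * cis (t * (L m + \<omega>))))"
    by (intro Henstock_Kurzweil_Integration.integral_sum finI integrable_continuous_interval continuous_intros)
  also have "\<dots> = (\<Sum>m\<in>I. of_real (P m) * cis (\<Phi> m) * integral {c..d} (\<lambda>t. cis (t * (L m + \<omega>))))"
    by simp
  finally have eq: "integral {c..d} (\<lambda>t. of_real (torus_kernel Q \<phi> l \<kappa> t) * cis (t * \<omega>)) =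
      (\<Sum>m\<in>I. of_real (P m) * cis (\<Phi> m) * integral {c..d} (\<lambda>t. cis (t * (L m + \<omega>))))" .
  have zero: "\<Phi> m0 = 0" "L m0 = 0" "P m0 = kernel_mean Q \<kappa>"
    by (simp_all add: \<Phi>_def L_def P_def m0_def kernel_mean_def)
  have bound: "norm (of_real (P m) * cis (\<Phi> m) * integral {c..d} (\<lambda>t. cis (t * (L m + \<omega>)))) \<le>
     P m * (2 / \<eta>)" if m: "m \<in> I" and ne: "\<omega> \<noteq> 0 \<or> m \<noteq> m0" for m
  proof -
    have "\<omega> \<noteq> 0 \<or> (\<exists>n<Q. m n \<noteq> \<kappa> n)"
    proof (rule ccontr)
      assume *: "\<not> (\<omega> \<noteq> 0 \<or> (\<exists>n<Q. m n \<noteq> \<kappa> n))"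
      have "m = m0"
      proof
        fix n show "m n = m0 n"
          using m * by (cases "n < Q") (auto simp: I_def m0_def PiE_def extensional_def)
      qed
      with * ne show False by blast
    qed
    then have "\<eta> \<le> \<bar>L m + \<omega>\<bar>" using sep[of m] m by (simp add: I_def L_def)
    then have "norm (integral {c..d} (\<lambda>t. cis (t * (L m + \<omega>)))) \<le> 2 / \<bar>L m + \<omega>\<bar>"
      using \<eta> by (intro norm_integral_cis_le cd) auto
    also have "\<dots> \<le> 2 / \<eta>" using \<eta> \<open>\<eta> \<le> _\<close> by (intro divide_left_mono) auto
    finally have "norm (integral {c..d} (\<lambda>t. cis (t * (L m + \<omega>)))) \<le> 2 / \<eta>" .
    from mult_left_mono[OF this P0[of m]]
    show ?thesis using P0[of m] by (simp add: norm_mult)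
  qed
  have sumP: "(\<Sum>m\<in>I. P m) = 1" unfolding I_def P_def by (rule sum_kernel_coeffs)
  show ?thesis
  proof (cases "\<omega> = 0")
    case False
    have "norm (integral {c..d} (\<lambda>t. of_real (torus_kernel Q \<phi> l \<kappa> t) * cis (t * \<omega>))) \<le>
        (\<Sum>m\<in>I. P m * (2 / \<eta>))"
      unfolding eq by (rule sum_norm_le) (use bound False in auto)
    with False sumP show ?thesis by (simp flip: sum_divide_distrib sum_distrib_right)
  next
    case True
    have "integral {c..d} (\<lambda>t. of_real (torus_kernel Q \<phi> l \<kappa> t) * cis (t * \<omega>)) -
       of_real (kernel_mean Q \<kappa> * (d - c)) =
       (\<Sum>m\<in>I - {m0}. of_real (P m) * cis (\<Phi> m) * integral {c..d} (\<lambda>t. cis (t * (L m + \<omega>))))"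
      unfolding eq using True cd
      by (subst sum.remove[OF finI m0]) (simp add: zero scaleR_conv_of_real)
    also have "norm \<dots> \<le> (\<Sum>m\<in>I - {m0}. P m * (2 / \<eta>))"
      by (rule sum_norm_le) (use bound in auto)
    also have "\<dots> \<le> (\<Sum>m\<in>I. P m * (2 / \<eta>))"
      using finI P0 \<eta> by (intro sum_mono2) auto
    also have "\<dots> = 2 / \<eta>" using sumP by (simp flip: sum_divide_distrib sum_distrib_right)
    finally show ?thesis using True by simp
  qed
qed

lemma integral_complex_of_real_continuous:
  assumes "continuous_on {c..d::real} f"
  shows "integral {c..d} (\<lambda>t. complex_of_real (f t)) = of_real (integral {c..d} f)"
  by (intro integral_unique has_integral_of_real integrable_integral
      integrable_continuous_interval assms)

text \<open>Expanding the square, with the diagonal terms kept apart.\<close>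

lemma weighted_mean_square_le:
  fixes W :: "real \<Rightarrow> real" and l :: "nat \<Rightarrow> real" and b :: "nat \<Rightarrow> complex"
  assumes J: "finite J" and W: "continuous_on {c..d} W"
    and off: "\<And>x y. x \<in> J \<Longrightarrow> y \<in> J \<Longrightarrow> x \<noteq> y \<Longrightarrow>
        norm (integral {c..d} (\<lambda>t. of_real (W t) * cis (t * (l y - l x)))) \<le> B x y"
  shows "integral {c..d} (\<lambda>t. W t * (norm (\<Sum>n\<in>J. b n * cis (- (t * l n))))\<^sup>2) \<le>
     (\<Sum>x\<in>J. (norm (b x))\<^sup>2) * integral {c..d} W +
     (\<Sum>x\<in>J. \<Sum>y\<in>J - {x}. norm (b x) * norm (b y) * B x y)"
proof -
  define D where "D = (\<lambda>x y. integral {c..d} (\<lambda>t. complex_of_real (W t) * cis (t * (l y - l x))))"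
  have Wc: "continuous_on {c..d} (\<lambda>t. complex_of_real (W t))" by (intro continuous_intros W)
  have expand: "complex_of_real (W t * (norm (\<Sum>n\<in>J. b n * cis (- (t * l n))))\<^sup>2) =
     (\<Sum>x\<in>J. \<Sum>y\<in>J. (b x * cnj (b y)) * (of_real (W t) * cis (t * (l y - l x))))" for t
  proof -
    let ?s = "\<Sum>n\<in>J. b n * cis (- (t * l n))"
    have "complex_of_real (W t * (norm ?s)\<^sup>2) = of_real (W t) * (?s * cnj ?s)"
      by (simp only: of_real_mult complex_norm_square)
    also have "\<dots> = (\<Sum>x\<in>J. \<Sum>y\<in>J. of_real (W t) * ((b x * cis (- (t * l x))) * cnj (b y * cis (- (t * l y)))))"

      by (simp only: cnj_sum sum_product) (simp only: sum_distrib_left)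
    also have "\<dots> = (\<Sum>x\<in>J. \<Sum>y\<in>J. (b x * cnj (b y)) * (of_real (W t) * cis (t * (l y - l x))))"
    proof (intro sum.cong refl)
      fix x y
      have "cis (t * (l y - l x)) = cis (- (t * l x)) * cis (t * l y)"
        by (simp add: cis_mult algebra_simps)
      then show "of_real (W t) * ((b x * cis (- (t * l x))) * cnj (b y * cis (- (t * l y)))) =
         (b x * cnj (b y)) * (of_real (W t) * cis (t * (l y - l x)))"
        by (simp add: cis_cnj)
    qed
    finally show ?thesis .
  qed
  have "complex_of_real (integral {c..d} (\<lambda>t. W t * (norm (\<Sum>n\<in>J. b n * cis (- (t * l n))))\<^sup>2)) =
      integral {c..d} (\<lambda>t. complex_of_real (W t * (norm (\<Sum>n\<in>J. b n * cis (- (t * l n))))\<^sup>2))"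
    by (subst integral_complex_of_real_continuous) (intro continuous_intros W refl)+
  also have "\<dots> = integral {c..d} (\<lambda>t. \<Sum>x\<in>J. \<Sum>y\<in>J. (b x * cnj (b y)) * (of_real (W t) * cis (t * (l y - l x))))"
    by (simp only: expand)
  also have "\<dots> = (\<Sum>x\<in>J. \<Sum>y\<in>J. integral {c..d} (\<lambda>t. (b x * cnj (b y)) * (of_real (W t) * cis (t * (l y - l x)))))"
  proof -
    have "integral {c..d} (\<lambda>t. \<Sum>x\<in>J. \<Sum>y\<in>J. (b x * cnj (b y)) * (of_real (W t) * cis (t * (l y - l x)))) =
       (\<Sum>x\<in>J. integral {c..d} (\<lambda>t. \<Sum>y\<in>J. (b x * cnj (b y)) * (of_real (W t) * cis (t * (l y - l x)))))"
      by (intro Henstock_Kurzweil_Integration.integral_sum J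
          integrable_continuous_interval continuous_intros Wc)
    also have "\<dots> = (\<Sum>x\<in>J. \<Sum>y\<in>J. integral {c..d} (\<lambda>t. (b x * cnj (b y)) * (of_real (W t) * cis (t * (l y - l x)))))"
      by (intro sum.cong refl Henstock_Kurzweil_Integration.integral_sum J
          integrable_continuous_interval continuous_intros Wc)
    finally show ?thesis .
  qed
  also have "\<dots> = (\<Sum>x\<in>J. \<Sum>y\<in>J. b x * cnj (b y) * D x y)" by (simp add: D_def)
  finally have eq: "complex_of_real (integral {c..d} (\<lambda>t. W t * (norm (\<Sum>n\<in>J. b n * cis (- (t * l n))))\<^sup>2)) =
     (\<Sum>x\<in>J. \<Sum>y\<in>J. b x * cnj (b y) * D x y)" .
  have Dxx: "D x x = of_real (integral {c..d} W)" for x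
    by (simp add: D_def integral_complex_of_real_continuous[OF W])
  have "integral {c..d} (\<lambda>t. W t * (norm (\<Sum>n\<in>J. b n * cis (- (t * l n))))\<^sup>2) =
      Re (\<Sum>x\<in>J. \<Sum>y\<in>J. b x * cnj (b y) * D x y)"
    unfolding eq[symmetric] by simp
  also have "\<dots> = (\<Sum>x\<in>J. Re (b x * cnj (b x) * D x x) + (\<Sum>y\<in>J - {x}. Re (b x * cnj (b y) * D x y)))"
    unfolding Re_sum by (intro sum.cong refl) (simp add: sum.remove[OF J])
  also have "\<dots> \<le> (\<Sum>x\<in>J. (norm (b x))\<^sup>2 * integral {c..d} W +
      (\<Sum>y\<in>J - {x}. norm (b x) * norm (b y) * B x y))"
  proof (intro sum_mono add_mono)
    fix x assume x: "x \<in> J"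
    show "Re (b x * cnj (b x) * D x x) \<le> (norm (b x))\<^sup>2 * integral {c..d} W"
      unfolding Dxx complex_norm_square[symmetric] by simp
    fix y assume y: "y \<in> J - {x}"
    have "Re (b x * cnj (b y) * D x y) \<le> norm (b x * cnj (b y) * D x y)" by (rule complex_Re_le_cmod)
    also have "\<dots> = norm (b x) * norm (b y) * norm (D x y)" by (simp add: norm_mult)
    also have "\<dots> \<le> norm (b x) * norm (b y) * B x y"
      unfolding D_def using x y by (intro mult_left_mono off) auto
    finally show "Re (b x * cnj (b y) * D x y) \<le> norm (b x) * norm (b y) * B x y" .
  qed
  also have "\<dots> = (\<Sum>x\<in>J. (norm (b x))\<^sup>2) * integral {c..d} W +
     (\<Sum>x\<in>J. \<Sum>y\<in>J - {x}. norm (b x) * norm (b y) * B x y)"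
    by (simp add: sum.distrib sum_distrib_right)
  finally show ?thesis .
qed

lemma kernel_integral_bounds:
  fixes \<eta> T :: real
  assumes "\<eta> > 0" "T > 0"
    and "\<And>m. m \<in> PiE {..<Q} (\<lambda>n. {..2 * \<kappa> n}) \<Longrightarrow> (\<exists>n<Q. m n \<noteq> \<kappa> n) \<Longrightarrow>
        \<eta> \<le> \<bar>\<Sum>n<Q. (real (m n) - real (\<kappa> n)) * l n\<bar>"
  shows "\<bar>integral {T..2 * T} (torus_kernel Q \<phi> l \<kappa>) - kernel_mean Q \<kappa> * T\<bar> \<le> 2 / \<eta>"
proof -
  have "norm (integral {T..2 * T} (\<lambda>t. of_real (torus_kernel Q \<phi> l \<kappa> t) * cis (t * 0)) -
     (if (0::real) = 0 then of_real (kernel_mean Q \<kappa> * (2 * T - T)) else 0)) \<le> 2 / \<eta>"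
    by (rule norm_kernel_integral_minus_mean_le) (use assms in auto)
  moreover have "integral {T..2 * T} (\<lambda>t. of_real (torus_kernel Q \<phi> l \<kappa> t) * cis (t * 0)) =
      complex_of_real (integral {T..2 * T} (torus_kernel Q \<phi> l \<kappa>))"
    using integral_complex_of_real_continuous[OF continuous_torus_kernel] by simp
  ultimately have "norm (complex_of_real (integral {T..2 * T} (torus_kernel Q \<phi> l \<kappa>)) -
      complex_of_real (kernel_mean Q \<kappa> * T)) \<le> 2 / \<eta>" by simp
  then show ?thesis by (metis norm_of_real of_real_diff)
qed

lemma kernel_mean_const: "kernel_mean Q (\<lambda>_. k) = (real (2 * k choose k) / 4 ^ k) ^ Q"
  by (simp add: kernel_mean_def)

lemma central_binomial_Suc:
  "real (2 * Suc k choose Suc k) / 4 ^ Suc k =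
     (real (2 * k choose k) / 4 ^ k) * ((2 * real k + 1) / (2 * real k + 2))"
proof -
  have "(k + 1) * (2 * k + 2 choose (k + 1)) = (2 * k + 2) * (2 * k + 1 choose k)"
    using Suc_times_binomial_eq[of "2 * k + 1" k] by (simp add: algebra_simps)
  moreover have "(k + 1) * (2 * k + 1 choose k) = (2 * k + 1) * (2 * k choose k)"
  proof -
    have "(2 * k + 1 choose k) = (2 * k + 1 choose (k + 1))"
      using binomial_symmetric[of k "2 * k + 1"] by simp
    then show ?thesis using Suc_times_binomial_eq[of "2 * k" k] by (simp add: algebra_simps)
  qed
  ultimately have "(k + 1) * ((k + 1) * (2 * k + 2 choose (k + 1))) =
      (2 * k + 2) * ((2 * k + 1) * (2 * k choose k))"
    by (metis mult.left_commute)
  then have "real ((k + 1) * ((k + 1) * (2 * k + 2 choose (k + 1)))) =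
      real ((2 * k + 2) * ((2 * k + 1) * (2 * k choose k)))" by (simp only:)
  then have "(real k + 1) * ((real k + 1) * real (2 * k + 2 choose (k + 1))) =
      (real k + 1) * (2 * (2 * real k + 1) * real (2 * k choose k))"
    by (simp add: algebra_simps)
  then have "(real k + 1) * real (2 * k + 2 choose (k + 1)) =
      2 * (2 * real k + 1) * real (2 * k choose k)" by simp
  then have B: "real (2 * k + 2 choose (k + 1)) =
      2 * (2 * real k + 1) * real (2 * k choose k) / (real k + 1)"
    by (simp add: field_simps del: binomial_Suc_Suc)
  define C where "C = real (2 * k choose k)"
  have "2 * Suc k = 2 * k + 2" "Suc k = k + 1" by simp_all
  then have "real (2 * Suc k choose Suc k) = 2 * (2 * real k + 1) * C / (real k + 1)"
    unfolding C_def using B by (simp only:)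
  moreover have "2 * (2 * x + 1) * C / y / 4 ^ Suc k = C / 4 ^ k * ((2 * x + 1) / (2 * y))"
    if "y > 0" for x y :: real using that by (simp add: field_simps)
  from this[of "real k + 1" "real k"]
  have "2 * (2 * real k + 1) * C / (real k + 1) / 4 ^ Suc k =
      C / 4 ^ k * ((2 * real k + 1) / (2 * real k + 2))" by (simp add: distrib_left)
  ultimately show ?thesis unfolding C_def[symmetric] by (simp only:)
qed

text \<open>This quotient controls the weighted mean of \<open>1 - (1 + cos \<theta>\<^sub>j) / 2\<close>, that is, how well the kernel is
  concentrated.\<close>

lemma kernel_mean_bump:
  assumes "j < Q"
  shows "kernel_mean Q ((\<lambda>_. k)(j := Suc k)) =
     kernel_mean Q (\<lambda>_. k) * ((2 * real k + 1) / (2 * real k + 2))"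
proof -
  define c where "c = (\<lambda>k. real (2 * k choose k) / 4 ^ k)"
  have km: "kernel_mean Q \<kappa> = c (\<kappa> j) * (\<Prod>n\<in>{..<Q} - {j}. c (\<kappa> n))" for \<kappa>
    unfolding kernel_mean_def c_def using assms by (intro prod.remove) auto
  have "kernel_mean Q ((\<lambda>_. k)(j := Suc k)) = c (Suc k) * (\<Prod>n\<in>{..<Q} - {j}. c k)"
    unfolding km by (auto intro!: prod.cong)
  also have "c (Suc k) = c k * ((2 * real k + 1) / (2 * real k + 2))"
    unfolding c_def by (rule central_binomial_Suc)
  also have "c k * ((2 * real k + 1) / (2 * real k + 2)) * (\<Prod>n\<in>{..<Q} - {j}. c k) =
     (c k * (\<Prod>n\<in>{..<Q} - {j}. c k)) * ((2 * real k + 1) / (2 * real k + 2))" by simp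
  also have "c k * (\<Prod>n\<in>{..<Q} - {j}. c k) = kernel_mean Q (\<lambda>_. k)"
    unfolding km ..
  finally show ?thesis .
qed

text \<open>The central one of the \<open>2 * k + 1\<close> binomial coefficients with sum \<open>4 ^ k\<close> is the largest.\<close>

lemma kernel_mean_ge: "kernel_mean Q (\<lambda>_. k) \<ge> 1 / (2 * real k + 1) ^ Q"
proof -
  have "4 ^ k = (\<Sum>j\<le>2 * k. 2 * k choose j)" by (simp add: choose_row_sum power_mult)
  also have "\<dots> \<le> (\<Sum>j\<le>2 * k. 2 * k choose k)"
    using binomial_maximum[of "2 * k"] by (intro sum_mono) simp
  finally have "4 ^ k \<le> (2 * k + 1) * (2 * k choose k)" by simp
  then have "real (4 ^ k) \<le> real ((2 * k + 1) * (2 * k choose k))" by (simp only: of_nat_le_iff)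
  then have "1 / (2 * real k + 1) \<le> real (2 * k choose k) / 4 ^ k"
    by (simp add: field_simps)
  then have "(1 / (2 * real k + 1)) ^ Q \<le> (real (2 * k choose k) / 4 ^ k) ^ Q"
    by (rule power_mono) auto
  then show ?thesis by (simp add: kernel_mean_const power_divide)
qed

lemma norm_cis_minus_1_squared: "(norm (cis x - 1))\<^sup>2 = 2 - 2 * cos x"
proof -
  have "(cos x - 1)\<^sup>2 + (sin x)\<^sup>2 = 2 - 2 * cos x"
    using sin_cos_squared_add[of x] by (simp add: power2_eq_square algebra_simps)
  then show ?thesis by (simp add: cmod_power2)
qed

lemma norm_add3_squared_le:
  fixes x y z :: complex
  shows "(norm (x + y + z))\<^sup>2 \<le> 3 * ((norm x)\<^sup>2 + (norm y)\<^sup>2 + (norm z)\<^sup>2)"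
proof -
  have "norm (x + y + z) \<le> norm x + norm y + norm z"
    by (meson norm_triangle_ineq norm_triangle_le add_right_mono order_trans)
  then have "(norm (x + y + z))\<^sup>2 \<le> (norm x + norm y + norm z)\<^sup>2" by (rule power_mono) simp
  also have "\<dots> \<le> 3 * ((norm x)\<^sup>2 + (norm y)\<^sup>2 + (norm z)\<^sup>2)"
    using zero_le_power2[of "norm x - norm y"] zero_le_power2[of "norm y - norm z"]
      zero_le_power2[of "norm x - norm z"]
    by (simp add: power2_eq_square algebra_simps)
  finally show ?thesis .
qed

text \<open>The Dirichlet polynomial minus its target is the sum of \<open>Z0\<close> (terms \<open>n < Q\<close>, where the target supplies
  the phases \<open>u n\<close>), of the terms \<open>Q \<le> n < Y\<close> and of the terms \<open>Y \<le> n < X\<close>. The first is small under the weight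
  by \<open>kernel_mean_bump\<close>, the second is nearly orthogonal with respect to the weight by the hypothesis on the
  frequencies, and for the third the weight is estimated by \<open>1\<close>.\<close>

theorem weighted_distance_to_target:
  fixes l a :: "nat \<Rightarrow> real" and u :: "nat \<Rightarrow> complex" and t0 \<eta> T :: real and Q Y X k :: nat
  assumes u: "\<And>n. norm (u n) = 1" and \<eta>: "\<eta> > 0" and T: "T > 0"
    and QYX: "Q < Y" "Y \<le> X"
    and sep: "\<And>\<mu> x y. (\<And>n. n < Q \<Longrightarrow> \<bar>\<mu> n\<bar> \<le> int (Suc k)) \<Longrightarrow> x \<in> {Q..<Y} \<Longrightarrow> y \<in> {Q..<Y} \<Longrightarrow>
        x \<noteq> y \<or> (\<exists>n<Q. \<mu> n \<noteq> 0) \<Longrightarrow> \<eta> \<le> \<bar>(\<Sum>n<Q. real_of_int (\<mu> n) * l n) + (l y - l x)\<bar>"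
    and a: "\<And>n. 0 \<le> a n" and l: "inj_on l {Y..<X}"
    and far: "\<And>t. t \<in> {T..2 * T} \<Longrightarrow>
       \<epsilon> \<le> norm ((\<Sum>n<X. of_real (a n) * cis (- ((t0 + t) * l n))) - (\<Sum>n<Q. of_real (a n) * u n))"
    and \<epsilon>: "\<epsilon> \<ge> 0"
  defines "c \<equiv> kernel_mean Q (\<lambda>_. k)"
  shows "\<epsilon>\<^sup>2 * (c * T - 2 / \<eta>) \<le> 3 * (
     real Q * (\<Sum>n<Q. (a n)\<^sup>2) * (2 * c * T / (real k + 1) + 16 / \<eta>) +
     ((\<Sum>n\<in>{Q..<Y}. (a n)\<^sup>2) * (c * T + 2 / \<eta>) + (\<Sum>n\<in>{Q..<Y}. a n)\<^sup>2 * (2 / \<eta>)) +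
     ((\<Sum>n\<in>{Y..<X}. (a n)\<^sup>2) * T +
       (\<Sum>x\<in>{Y..<X}. \<Sum>y\<in>{Y..<X} - {x}. a x * a y * (2 / \<bar>l y - l x\<bar>))))"
proof -
  define \<phi> where "\<phi> = (\<lambda>n. t0 * l n + Arg (u n))"
  define K where "K = torus_kernel Q \<phi> l (\<lambda>_. k)"
  have Kc: "continuous_on S K" for S unfolding K_def by (rule continuous_torus_kernel)
  have K01: "0 \<le> K t" "K t \<le> 1" for t by (simp_all add: K_def torus_kernel_bounds)
  have phase: "cis (- ((t0 + t) * l n)) = u n * cis (- (\<phi> n + t * l n))" for t n
  proof -
    have "u n = cis (Arg (u n))" using rcis_cmod_Arg[of "u n"] u[of n] by (simp add: rcis_def)
    then have "u n * cis (- (\<phi> n + t * l n)) = cis (Arg (u n)) * cis (- (\<phi> n + t * l n))" by simp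
    also have "\<dots> = cis (- ((t0 + t) * l n))" by (simp add: cis_mult \<phi>_def algebra_simps)
    finally show ?thesis by simp
  qed
  have QY: "Q \<in> {Q..<Y}" using QYX by simp
  have kint: "\<bar>integral {T..2 * T} (torus_kernel Q \<phi> l \<kappa>) - kernel_mean Q \<kappa> * T\<bar> \<le> 2 / \<eta>"
    if "\<And>n. \<kappa> n \<le> Suc k" for \<kappa>
  proof (rule kernel_integral_bounds[OF \<eta> T])
    fix m assume m: "m \<in> PiE {..<Q} (\<lambda>n. {..2 * \<kappa> n})" "\<exists>n<Q. m n \<noteq> \<kappa> n"
    have "\<bar>int (m n) - int (\<kappa> n)\<bar> \<le> int (Suc k)" if "n < Q" for n
      using m(1) that \<open>\<And>n. \<kappa> n \<le> Suc k\<close>[of n] by (force simp: PiE_def Pi_def)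
    then have "\<eta> \<le> \<bar>(\<Sum>n<Q. real_of_int (int (m n) - int (\<kappa> n)) * l n) + (l Q - l Q)\<bar>"
      using m(2) by (intro sep QY) auto
    then show "\<eta> \<le> \<bar>\<Sum>n<Q. (real (m n) - real (\<kappa> n)) * l n\<bar>" by simp
  qed
  have IK: "\<bar>integral {T..2 * T} K - c * T\<bar> \<le> 2 / \<eta>"
    unfolding K_def c_def by (rule kint) simp
  define Z0 where "Z0 = (\<lambda>t. \<Sum>n<Q. of_real (a n) * u n * (cis (- (\<phi> n + t * l n)) - 1))"
  define Z where "Z = (\<lambda>J t. \<Sum>n\<in>J. (of_real (a n) * cis (- (t0 * l n))) * cis (- (t * l n)))"
  have split: "(\<Sum>n<X. of_real (a n) * cis (- ((t0 + t) * l n))) - (\<Sum>n<Q. of_real (a n) * u n) =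
      Z0 t + Z {Q..<Y} t + Z {Y..<X} t" for t
  proof -
    define g where "g = (\<lambda>n. complex_of_real (a n) * cis (- ((t0 + t) * l n)))"
    have "sum g {..<X} = sum g {..<Q} + (sum g {Q..<Y} + sum g {Y..<X})"
      using QYX sum.atLeastLessThan_concat[of 0 Q X g] sum.atLeastLessThan_concat[of Q Y X g]
      by (simp add: lessThan_atLeast0)
    moreover have "sum g J = Z J t" for J
      unfolding Z_def g_def by (intro sum.cong refl) (simp add: cis_mult algebra_simps)
    moreover have "sum g {..<Q} - (\<Sum>n<Q. of_real (a n) * u n) = Z0 t"
      unfolding Z0_def g_def sum_subtractf[symmetric] phase
      by (intro sum.cong refl) (simp add: algebra_simps)
    ultimately show ?thesis unfolding g_def[symmetric] by simp
  qed
  have Zc: "continuous_on S (Z J)" for S J unfolding Z_def by (intro continuous_intros)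
  have Z0c: "continuous_on S Z0" for S unfolding Z0_def by (intro continuous_intros)
  have B0: "integral {T..2 * T} (\<lambda>t. K t * (norm (Z0 t))\<^sup>2) \<le>
      real Q * (\<Sum>n<Q. (a n)\<^sup>2) * (2 * c * T / (real k + 1) + 16 / \<eta>)"
  proof -
    \<comment> \<open>\<open>\<bar>cis x - 1\<bar>\<^sup>2 = 4 * (1 - (1 + cos x) / 2)\<close>, and the factor \<open>(1 + cos x) / 2\<close> raises one exponent\<close>
    define K' where "K' = (\<lambda>j. torus_kernel Q \<phi> l ((\<lambda>_. k)(j := Suc k)))"
    have K'c: "continuous_on S (K' j)" for S j unfolding K'_def by (rule continuous_torus_kernel)
    have K': "K' j t = K t * ((1 + cos (\<phi> j + t * l j)) / 2)" if "j < Q" for j t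
    proof -
      have "K' j t = ((1 + cos (\<phi> j + t * l j)) / 2) ^ Suc k *
          (\<Prod>n\<in>{..<Q} - {j}. ((1 + cos (\<phi> n + t * l n)) / 2) ^ k)"
        unfolding K'_def torus_kernel_def using that
        by (subst prod.remove[of _ j]) (auto intro!: prod.cong)
      moreover have "K t = ((1 + cos (\<phi> j + t * l j)) / 2) ^ k *
          (\<Prod>n\<in>{..<Q} - {j}. ((1 + cos (\<phi> n + t * l n)) / 2) ^ k)"
        unfolding K_def torus_kernel_def using that by (subst prod.remove[of _ j]) auto
      ultimately show ?thesis by simp
    qed
    have "integral {T..2 * T} (\<lambda>t. K t * (norm (Z0 t))\<^sup>2) \<le>
       integral {T..2 * T} (\<lambda>t. \<Sum>n<Q. real Q * (a n)\<^sup>2 * (4 * (K t - K' n t)))"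
    proof (rule integral_le)
      fix t
      have "norm (Z0 t) \<le> (\<Sum>n<Q. a n * norm (cis (- (\<phi> n + t * l n)) - 1))"
        unfolding Z0_def by (rule sum_norm_le) (use a u in \<open>auto simp: norm_mult\<close>)
      then have "(norm (Z0 t))\<^sup>2 \<le> (\<Sum>n<Q. a n * norm (cis (- (\<phi> n + t * l n)) - 1))\<^sup>2"
        by (rule power_mono) simp
      also have "\<dots> \<le> (\<Sum>n<Q. (a n * norm (cis (- (\<phi> n + t * l n)) - 1))\<^sup>2) * real (card {..<Q})"
        using Cauchy_Schwarz_ineq_sum[of "\<lambda>n. a n * norm (cis (- (\<phi> n + t * l n)) - 1)" "\<lambda>_. 1" "{..<Q}"]
        by simp
      finally have "K t * (norm (Z0 t))\<^sup>2 \<le>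
          K t * ((\<Sum>n<Q. (a n * norm (cis (- (\<phi> n + t * l n)) - 1))\<^sup>2) * real Q)"
        using K01(1)[of t] by (simp add: mult_left_mono)
      also have "\<dots> = (\<Sum>n<Q. real Q * (a n)\<^sup>2 * (4 * (K t - K' n t)))"
        unfolding sum_distrib_left sum_distrib_right
      proof (intro sum.cong refl)
        fix n assume "n \<in> {..<Q}"
        have "(norm (cis (- (\<phi> n + t * l n)) - 1))\<^sup>2 = 2 - 2 * cos (\<phi> n + t * l n)"
          using norm_cis_minus_1_squared[of "- (\<phi> n + t * l n)"] by (simp only: cos_minus)
        then have "(a n * norm (cis (- (\<phi> n + t * l n)) - 1))\<^sup>2 =
            (a n)\<^sup>2 * (2 - 2 * cos (\<phi> n + t * l n))" by (simp only: power_mult_distrib)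
        then show "K t * ((a n * norm (cis (- (\<phi> n + t * l n)) - 1))\<^sup>2 * real Q) =
            real Q * (a n)\<^sup>2 * (4 * (K t - K' n t))"
          using K'[of n t] \<open>n \<in> {..<Q}\<close>
          by (simp only: lessThan_iff) (simp add: algebra_simps)
      qed
      finally show "K t * (norm (Z0 t))\<^sup>2 \<le> (\<Sum>n<Q. real Q * (a n)\<^sup>2 * (4 * (K t - K' n t)))" .
    qed (intro integrable_continuous_interval continuous_intros Kc K'c Z0c)+
    also have "\<dots> = (\<Sum>n<Q. real Q * (a n)\<^sup>2 * (4 * (integral {T..2 * T} K - integral {T..2 * T} (K' n))))"
    proof -
      have "integral {T..2 * T} (\<lambda>t. \<Sum>n<Q. real Q * (a n)\<^sup>2 * (4 * (K t - K' n t))) =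
         (\<Sum>n<Q. integral {T..2 * T} (\<lambda>t. real Q * (a n)\<^sup>2 * (4 * (K t - K' n t))))"
        by (intro Henstock_Kurzweil_Integration.integral_sum integrable_continuous_interval
            continuous_intros Kc K'c) auto
      also have "\<dots> = (\<Sum>n<Q. real Q * (a n)\<^sup>2 * (4 * (integral {T..2 * T} K - integral {T..2 * T} (K' n))))"
        by (intro sum.cong refl)
           (simp add: Henstock_Kurzweil_Integration.integral_diff integrable_continuous_interval Kc K'c)
      finally show ?thesis .
    qed
    also have "\<dots> \<le> (\<Sum>n<Q. real Q * (a n)\<^sup>2 * (2 * c * T / (real k + 1) + 16 / \<eta>))"
    proof (intro sum_mono mult_left_mono)
      fix n assume "n \<in> {..<Q}"
      then have "kernel_mean Q ((\<lambda>_. k)(n := Suc k)) = c * ((2 * real k + 1) / (2 * real k + 2))"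
        unfolding c_def by (intro kernel_mean_bump) auto
      moreover have "\<bar>integral {T..2 * T} (K' n) - kernel_mean Q ((\<lambda>_. k)(n := Suc k)) * T\<bar> \<le> 2 / \<eta>"
        unfolding K'_def by (rule kint) auto
      ultimately have "integral {T..2 * T} (K' n) \<ge> c * ((2 * real k + 1) / (2 * real k + 2)) * T - 2 / \<eta>"
        by (simp only: abs_le_iff) linarith
      moreover have "integral {T..2 * T} K \<le> c * T + 2 / \<eta>" using IK by (simp only: abs_le_iff) linarith
      ultimately have "4 * (integral {T..2 * T} K - integral {T..2 * T} (K' n)) \<le>
          4 * (c * T - c * ((2 * real k + 1) / (2 * real k + 2)) * T) + 16 / \<eta>" by simp
      also have "4 * (c * T - c * ((2 * real k + 1) / (2 * real k + 2)) * T) = 2 * c * T / (real k + 1)"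
      proof -
        define r where "r = 1 / (2 * (real k + 1))"
        have "(2 * real k + 1) / (2 * real k + 2) = 1 - r" by (simp add: r_def field_simps)
        moreover have "4 * (c * T - c * (1 - r) * T) = (4 * r) * (c * T)" by (simp add: algebra_simps)
        moreover have "4 * r = 2 / (real k + 1)" by (simp add: r_def field_simps)
        ultimately show ?thesis by (simp only:) simp
      qed
      finally show "4 * (integral {T..2 * T} K - integral {T..2 * T} (K' n)) \<le>
          2 * c * T / (real k + 1) + 16 / \<eta>" .
    qed auto
    also have "\<dots> = real Q * (\<Sum>n<Q. (a n)\<^sup>2) * (2 * c * T / (real k + 1) + 16 / \<eta>)"
      by (simp only: sum_distrib_left sum_distrib_right)
    finally show ?thesis .
  qed
  have nb: "norm (of_real (a n) * cis (- (t0 * l n))) = a n" for n using a by (simp add: norm_mult)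
  have B1: "integral {T..2 * T} (\<lambda>t. K t * (norm (Z {Q..<Y} t))\<^sup>2) \<le>
      (\<Sum>n\<in>{Q..<Y}. (a n)\<^sup>2) * (c * T + 2 / \<eta>) + (\<Sum>n\<in>{Q..<Y}. a n)\<^sup>2 * (2 / \<eta>)"
  proof -
    have off: "norm (integral {T..2 * T} (\<lambda>t. of_real (K t) * cis (t * (l y - l x)))) \<le> 2 / \<eta>"
      if xy: "x \<in> {Q..<Y}" "y \<in> {Q..<Y}" "x \<noteq> y" for x y
    proof -
      have sep': "\<eta> \<le> \<bar>(\<Sum>n<Q. (real (m n) - real k) * l n) + (l y - l x)\<bar>"
        if m: "m \<in> PiE {..<Q} (\<lambda>n. {..2 * k})" for m
      proof -
        have "\<bar>int (m n) - int k\<bar> \<le> int (Suc k)" if "n < Q" for n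
          using m that by (force simp: PiE_def Pi_def)
        then have "\<eta> \<le> \<bar>(\<Sum>n<Q. real_of_int (int (m n) - int k) * l n) + (l y - l x)\<bar>"
          using xy by (intro sep) auto
        then show ?thesis by simp
      qed
      have "l y - l x \<noteq> 0"
        using sep[of "\<lambda>_. 0" x y] xy \<eta> by auto
      moreover have "T \<le> 2 * T" using T by simp
      from norm_kernel_integral_minus_mean_le[OF \<eta> this, where Q = Q and \<kappa> = "\<lambda>_. k" and l = l and \<omega> = "l y - l x" and \<phi> = \<phi>] sep'
      have "norm (integral {T..2 * T} (\<lambda>t. of_real (K t) * cis (t * (l y - l x))) -
         (if l y - l x = 0 then of_real (kernel_mean Q (\<lambda>_. k) * (2 * T - T)) else 0)) \<le> 2 / \<eta>"
        unfolding K_def by blast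
      ultimately show ?thesis by simp
    qed
    have "integral {T..2 * T} (\<lambda>t. K t * (norm (Z {Q..<Y} t))\<^sup>2) \<le>
      (\<Sum>x\<in>{Q..<Y}. (a x)\<^sup>2) * integral {T..2 * T} K +
      (\<Sum>x\<in>{Q..<Y}. \<Sum>y\<in>{Q..<Y} - {x}. a x * a y * (2 / \<eta>))"
      using weighted_mean_square_le[OF finite_atLeastLessThan Kc off,
        where b = "\<lambda>n. of_real (a n) * cis (- (t0 * l n))"]
      unfolding nb Z_def .
    also have "\<dots> \<le> (\<Sum>x\<in>{Q..<Y}. (a x)\<^sup>2) * (c * T + 2 / \<eta>) +
      (\<Sum>x\<in>{Q..<Y}. \<Sum>y\<in>{Q..<Y}. a x * a y * (2 / \<eta>))"
    proof (intro add_mono mult_left_mono sum_mono sum_mono2)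
      show "integral {T..2 * T} K \<le> c * T + 2 / \<eta>" using IK by (simp only: abs_le_iff) linarith
    qed (use a \<eta> in \<open>auto intro!: sum_nonneg mult_nonneg_nonneg\<close>)
    also have "(\<Sum>x\<in>{Q..<Y}. \<Sum>y\<in>{Q..<Y}. a x * a y * (2 / \<eta>)) = (\<Sum>n\<in>{Q..<Y}. a n)\<^sup>2 * (2 / \<eta>)"
      by (simp only: power2_eq_square sum_product) (simp only: sum_distrib_right)
    finally show ?thesis .
  qed
  have B2: "integral {T..2 * T} (\<lambda>t. K t * (norm (Z {Y..<X} t))\<^sup>2) \<le>
      (\<Sum>n\<in>{Y..<X}. (a n)\<^sup>2) * T +
       (\<Sum>x\<in>{Y..<X}. \<Sum>y\<in>{Y..<X} - {x}. a x * a y * (2 / \<bar>l y - l x\<bar>))"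
  proof -
    have "integral {T..2 * T} (\<lambda>t. K t * (norm (Z {Y..<X} t))\<^sup>2) \<le>
        integral {T..2 * T} (\<lambda>t. 1 * (norm (Z {Y..<X} t))\<^sup>2)"
      by (intro integral_le integrable_continuous_interval continuous_intros Kc Zc mult_right_mono K01) auto
    also have "\<dots> \<le> (\<Sum>x\<in>{Y..<X}. (a x)\<^sup>2) * integral {T..2 * T} (\<lambda>_. 1) +
      (\<Sum>x\<in>{Y..<X}. \<Sum>y\<in>{Y..<X} - {x}. a x * a y * (2 / \<bar>l y - l x\<bar>))"
    proof -
      have off: "norm (integral {T..2 * T} (\<lambda>t. of_real 1 * cis (t * (l y - l x)))) \<le> 2 / \<bar>l y - l x\<bar>"
        if "x \<in> {Y..<X}" "y \<in> {Y..<X}" "x \<noteq> y" for x y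
      proof -
        have "l y - l x \<noteq> 0" using l that by (auto dest: inj_onD)
        then show ?thesis using norm_integral_cis_le[of "l y - l x" T "2 * T"] T by simp
      qed
      show ?thesis
        using weighted_mean_square_le[OF finite_atLeastLessThan continuous_on_const off,
          where b = "\<lambda>n. of_real (a n) * cis (- (t0 * l n))"]
        unfolding nb Z_def .
    qed
    finally show ?thesis using T by simp
  qed
  have "\<epsilon>\<^sup>2 * (c * T - 2 / \<eta>) \<le> \<epsilon>\<^sup>2 * integral {T..2 * T} K"
    using IK by (intro mult_left_mono) (auto simp: abs_le_iff)
  also have "\<dots> = integral {T..2 * T} (\<lambda>t. \<epsilon>\<^sup>2 * K t)" by simp
  also have "\<dots> \<le> integral {T..2 * T} (\<lambda>t. 3 * (K t * (norm (Z0 t))\<^sup>2 + K t * (norm (Z {Q..<Y} t))\<^sup>2 +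
      K t * (norm (Z {Y..<X} t))\<^sup>2))"
  proof (intro integral_le integrable_continuous_interval continuous_intros Kc Zc Z0c)
    fix t assume "t \<in> {T..2 * T}"
    then have "\<epsilon>\<^sup>2 \<le> (norm (Z0 t + Z {Q..<Y} t + Z {Y..<X} t))\<^sup>2"
      using far[of t] \<epsilon> unfolding split by (intro power_mono) auto
    also note norm_add3_squared_le
    finally have "K t * \<epsilon>\<^sup>2 \<le> K t * (3 * ((norm (Z0 t))\<^sup>2 + (norm (Z {Q..<Y} t))\<^sup>2 + (norm (Z {Y..<X} t))\<^sup>2))"
      using K01(1) by (rule mult_left_mono)
    then show "\<epsilon>\<^sup>2 * K t \<le> 3 * (K t * (norm (Z0 t))\<^sup>2 + K t * (norm (Z {Q..<Y} t))\<^sup>2 +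
      K t * (norm (Z {Y..<X} t))\<^sup>2)" by (simp add: algebra_simps)
  qed
  also have "\<dots> = 3 * (integral {T..2 * T} (\<lambda>t. K t * (norm (Z0 t))\<^sup>2) +
      integral {T..2 * T} (\<lambda>t. K t * (norm (Z {Q..<Y} t))\<^sup>2) +
      integral {T..2 * T} (\<lambda>t. K t * (norm (Z {Y..<X} t))\<^sup>2))"
  proof -
    have i0: "(\<lambda>t. K t * (norm (Z0 t))\<^sup>2) integrable_on {T..2 * T}"
      and iZ: "\<And>J. (\<lambda>t. K t * (norm (Z J t))\<^sup>2) integrable_on {T..2 * T}"
      by (intro integrable_continuous_interval continuous_intros Kc Zc Z0c)+
    show ?thesis
      by (simp only: integral_mult_right Henstock_Kurzweil_Integration.integral_add
          integrable_add i0 iZ)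
  qed
  also have "\<dots> \<le> 3 * (
     real Q * (\<Sum>n<Q. (a n)\<^sup>2) * (2 * c * T / (real k + 1) + 16 / \<eta>) +
     ((\<Sum>n\<in>{Q..<Y}. (a n)\<^sup>2) * (c * T + 2 / \<eta>) + (\<Sum>n\<in>{Q..<Y}. a n)\<^sup>2 * (2 / \<eta>)) +
     ((\<Sum>n\<in>{Y..<X}. (a n)\<^sup>2) * T +
       (\<Sum>x\<in>{Y..<X}. \<Sum>y\<in>{Y..<X} - {x}. a x * a y * (2 / \<bar>l y - l x\<bar>))))"
    using B0 B1 B2 by (intro mult_left_mono add_mono) auto
  finally show ?thesis .
qed

section \<open>Elementary sums\<close>

lemma sum_powr_tail_le:
  assumes "Q \<ge> 2"
  shows "(\<Sum>n\<in>{Q..<Y}. 1 / (real n * sqrt (real n))) \<le> 2 / sqrt (real Q - 1)"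
proof -
  have step: "1 / (real n * sqrt (real n)) \<le> 2 / sqrt (real n - 1) - 2 / sqrt (real (Suc n) - 1)"
    if "n \<ge> 2" for n
  proof -
    define p q where "p = sqrt (real n)" and "q = sqrt (real n - 1)"
    have p: "p > 0" "q > 0" "q \<le> p" using that by (auto simp: p_def q_def)
    have pq: "p * p = real n" "q * q = real n - 1" using that by (auto simp: p_def q_def)
    have "(p - q) * (p + q) = 1" using pq by (simp add: algebra_simps)
    then have "p - q = 1 / (p + q)" using p by (simp add: field_simps)
    moreover have "1 / (p + q) \<ge> 1 / (2 * p)" using p by (intro divide_left_mono) auto
    ultimately have "2 * (p - q) \<ge> 1 / p" by simp
    then have "2 * (p - q) / (p * q) \<ge> 1 / p / (p * q)" using p by (intro divide_right_mono) auto
    moreover have "1 / p / (p * q) \<ge> 1 / p / (p * p)" using p by (intro divide_left_mono mult_left_mono) auto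
    moreover have "1 / p / (p * p) = 1 / (real n * p)" using pq by (simp add: field_simps)
    moreover have "2 * (p - q) / (p * q) = 2 / q - 2 / p" using p by (simp add: field_simps)
    ultimately have "1 / (real n * p) \<le> 2 / q - 2 / p" by linarith
    then show ?thesis by (simp add: p_def q_def)
  qed
  show ?thesis
  proof (cases "Q \<le> Y")
    case True
    have "(\<Sum>n\<in>{Q..<Y}. 1 / (real n * sqrt (real n))) \<le>
        (\<Sum>n\<in>{Q..<Y}. 2 / sqrt (real n - 1) - 2 / sqrt (real (Suc n) - 1))"
      using assms by (intro sum_mono step) auto
    also have "\<dots> = 2 / sqrt (real Q - 1) - 2 / sqrt (real Y - 1)"
      using sum_Suc_diff'[OF True, of "\<lambda>n. - (2 / sqrt (real n - 1))"] by simp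
    also have "\<dots> \<le> 2 / sqrt (real Q - 1)" using True assms by simp
    finally show ?thesis .
  qed (use assms in auto)
qed

lemma sum_inverse_le:
  assumes "X \<ge> 2"
  shows "(\<Sum>j\<in>{1..<X}. 1 / real j) \<le> 16 * real X powr (1 / 16)"
proof -
  have "(\<Sum>j\<in>{1..<Suc (Suc m)}. 1 / real j) \<le> 1 + ln (real (Suc m))" for m
  proof (induction m)
    case 0
    then show ?case by simp
  next
    case (Suc m)
    have "ln (real (Suc m) / real (Suc (Suc m))) \<le> real (Suc m) / real (Suc (Suc m)) - 1"
      by (rule ln_le_minus_one) simp
    moreover have "real (Suc m) / real (Suc (Suc m)) - 1 = - (1 / real (Suc (Suc m)))"
      by (simp add: field_simps)
    ultimately have "1 / real (Suc (Suc m)) \<le> ln (real (Suc (Suc m))) - ln (real (Suc m))"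
      by (simp add: ln_div)
    with Suc show ?case by simp
  qed
  from this[of "X - 2"] have "(\<Sum>j\<in>{1..<X}. 1 / real j) \<le> 1 + ln (real (X - 1))"
  proof -
    have "Suc (Suc (X - 2)) = X" "Suc (X - 2) = X - 1" using assms by auto
    then show ?thesis using \<open>sum _ _ \<le> 1 + ln (real (Suc (X - 2)))\<close> by (simp only:)
  qed
  moreover have "ln (real (X - 1)) \<le> ln (real X)" using assms by simp
  moreover have "ln (real X powr (1 / 16)) = 1 / 16 * ln (real X)" by (rule ln_powr)
  moreover have "ln (real X powr (1 / 16)) \<le> real X powr (1 / 16) - 1"
    using assms by (intro ln_le_minus_one) auto
  ultimately show ?thesis by linarith
qed

lemma sum_inverse_distance_le:
  assumes "x < X"
  shows "(\<Sum>y\<in>{Y..<X} - {x}. 1 / \<bar>real x - real y\<bar>) \<le> 2 * (\<Sum>j\<in>{1..<X}. 1 / real j)"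
proof -
  have "(\<Sum>y\<in>{Y..<X} - {x}. 1 / \<bar>real x - real y\<bar>) \<le> (\<Sum>y\<in>{..<x} \<union> {Suc x..<X}. 1 / \<bar>real x - real y\<bar>)"
    by (intro sum_mono2) auto
  also have "\<dots> = (\<Sum>y\<in>{..<x}. 1 / \<bar>real x - real y\<bar>) + (\<Sum>y\<in>{Suc x..<X}. 1 / \<bar>real x - real y\<bar>)"
    by (intro sum.union_disjoint) auto
  finally have "(\<Sum>y\<in>{Y..<X} - {x}. 1 / \<bar>real x - real y\<bar>) \<le>
      (\<Sum>y\<in>{..<x}. 1 / \<bar>real x - real y\<bar>) + (\<Sum>y\<in>{Suc x..<X}. 1 / \<bar>real x - real y\<bar>)" .
  moreover have "(\<Sum>y\<in>{..<x}. 1 / \<bar>real x - real y\<bar>) = (\<Sum>j\<in>{1..x}. 1 / real j)"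
    by (rule sum.reindex_bij_witness[of _ "\<lambda>j. x - j" "\<lambda>j. x - j"]) auto
  moreover have "(\<Sum>j\<in>{1..x}. 1 / real j) \<le> (\<Sum>j\<in>{1..<X}. 1 / real j)"
    using assms by (intro sum_mono2) auto
  moreover have "(\<Sum>y\<in>{Suc x..<X}. 1 / \<bar>real x - real y\<bar>) = (\<Sum>j\<in>{1..<X - x}. 1 / real j)"
    by (rule sum.reindex_bij_witness[of _ "\<lambda>j. x + j" "\<lambda>j. j - x"]) auto
  moreover have "(\<Sum>j\<in>{1..<X - x}. 1 / real j) \<le> (\<Sum>j\<in>{1..<X}. 1 / real j)"
    by (intro sum_mono2) auto
  ultimately show ?thesis by linarith
qed

text \<open>With \<open>a x \<le> p / (x + \<alpha>)\<close> and \<open>\<bar>ln u - ln v\<bar> \<ge> \<bar>u - v\<bar> / max u v\<close>, each term is at most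
  \<open>2 * p\<^sup>2 * (1 / x + 1 / y) / \<bar>x - y\<bar>\<close>, and the sum splits into products of harmonic sums.\<close>

lemma off_diagonal_sum_le:
  fixes \<alpha> \<sigma> :: real
  assumes \<alpha>: "0 < \<alpha>" "\<alpha> \<le> 1" and \<sigma>: "15 / 16 \<le> \<sigma>" "\<sigma> \<le> 1" and Y: "Y \<ge> 1" and X: "X \<ge> 2"
  shows "(\<Sum>x\<in>{Y..<X}. \<Sum>y\<in>{Y..<X} - {x}. (real x + \<alpha>) powr (- \<sigma>) * (real y + \<alpha>) powr (- \<sigma>) *
     (2 / \<bar>ln (real y + \<alpha>) - ln (real x + \<alpha>)\<bar>)) \<le> 2048 * real X powr (1 / 4)"
proof -
  define H where "H = (\<Sum>j\<in>{1..<X}. 1 / real j)"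
  define p where "p = real X powr (1 / 16)"
  have p: "p > 0" using X by (simp add: p_def)
  have H: "0 \<le> H" "H \<le> 16 * p" unfolding H_def p_def using sum_inverse_le[OF X] by (auto intro: sum_nonneg)
  have a_le: "(real x + \<alpha>) powr (- \<sigma>) \<le> p / (real x + \<alpha>)" if "x \<in> {Y..<X}" for x
  proof -
    have x: "1 \<le> real x + \<alpha>" "real x + \<alpha> \<le> real X" using that Y \<alpha> by auto
    have "(real x + \<alpha>) powr (- \<sigma>) = (real x + \<alpha>) powr (1 - \<sigma>) / (real x + \<alpha>)"
    proof -
      have "(real x + \<alpha>) powr (1 + - \<sigma>) = (real x + \<alpha>) powr 1 * (real x + \<alpha>) powr (- \<sigma>)"
        by (rule powr_add)
      then show ?thesis using x by simp
    qed
    moreover have "(real x + \<alpha>) powr (1 - \<sigma>) \<le> (real x + \<alpha>) powr (1 / 16)"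
      using x \<sigma> by (intro powr_mono) auto
    moreover have "\<dots> \<le> p" unfolding p_def using x by (intro powr_mono2) auto
    ultimately show ?thesis using x by (simp add: divide_right_mono)
  qed
  have term_le: "(real x + \<alpha>) powr (- \<sigma>) * (real y + \<alpha>) powr (- \<sigma>) *
     (2 / \<bar>ln (real y + \<alpha>) - ln (real x + \<alpha>)\<bar>) \<le>
     2 * p\<^sup>2 * (1 / real x * (1 / \<bar>real x - real y\<bar>) + 1 / real y * (1 / \<bar>real x - real y\<bar>))"
    if xy: "x \<in> {Y..<X}" "y \<in> {Y..<X} - {x}" for x y
  proof -
    define u v where "u = real x + \<alpha>" and "v = real y + \<alpha>"
    define b where "b = max u v"
    have u: "real x \<le> u" "real x \<ge> 1" and v: "real y \<le> v" "real y \<ge> 1"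
      using xy Y \<alpha> by (auto simp: u_def v_def)
    have b: "b > 0" using u v by (auto simp: b_def)
    have ne: "u \<noteq> v" using xy by (auto simp: u_def v_def)
    have d: "\<bar>u - v\<bar> = \<bar>real x - real y\<bar>" by (simp add: u_def v_def)
    have "\<bar>u - v\<bar> / b \<le> \<bar>ln v - ln u\<bar>"
      using abs_ln_diff_ge[of u b v] u v by (auto simp: b_def abs_minus_commute)
    moreover have "\<bar>u - v\<bar> / b > 0" using ne b by simp
    ultimately have "2 / \<bar>ln v - ln u\<bar> \<le> 2 / (\<bar>u - v\<bar> / b)"
      by (intro divide_left_mono mult_pos_pos; linarith)
    then have "u powr (- \<sigma>) * v powr (- \<sigma>) * (2 / \<bar>ln v - ln u\<bar>) \<le> (p / u) * (p / v) * (2 / (\<bar>u - v\<bar> / b))"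
      using a_le[of x] a_le[of y] xy p u v unfolding u_def[symmetric] v_def[symmetric]
      by (intro mult_mono) auto
    also have "\<dots> = 2 * p\<^sup>2 * (b / (u * v)) * (1 / \<bar>u - v\<bar>)"
      by (simp add: power2_eq_square field_simps)
    also have "\<dots> \<le> 2 * p\<^sup>2 * (1 / real x + 1 / real y) * (1 / \<bar>u - v\<bar>)"
    proof (intro mult_right_mono mult_left_mono)
      have "b / (u * v) \<le> 1 / u + 1 / v"
        using u v by (auto simp: b_def max_def field_simps)
      also have "\<dots> \<le> 1 / real x + 1 / real y"
        using u v by (intro add_mono divide_left_mono) auto
      finally show "b / (u * v) \<le> 1 / real x + 1 / real y" .
    qed auto
    also have "\<dots> = 2 * p\<^sup>2 * (1 / real x * (1 / \<bar>real x - real y\<bar>) + 1 / real y * (1 / \<bar>real x - real y\<bar>))"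
      unfolding d by (simp only: distrib_right mult.assoc)
    finally show ?thesis unfolding u_def v_def .
  qed
  have "(\<Sum>x\<in>{Y..<X}. \<Sum>y\<in>{Y..<X} - {x}. (real x + \<alpha>) powr (- \<sigma>) * (real y + \<alpha>) powr (- \<sigma>) *
     (2 / \<bar>ln (real y + \<alpha>) - ln (real x + \<alpha>)\<bar>)) \<le>
     (\<Sum>x\<in>{Y..<X}. \<Sum>y\<in>{Y..<X} - {x}.
       2 * p\<^sup>2 * (1 / real x * (1 / \<bar>real x - real y\<bar>) + 1 / real y * (1 / \<bar>real x - real y\<bar>)))"
    by (intro sum_mono term_le)
  also have "\<dots> = 2 * p\<^sup>2 * ((\<Sum>x\<in>{Y..<X}. \<Sum>y\<in>{Y..<X} - {x}. 1 / real x * (1 / \<bar>real x - real y\<bar>)) +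
      (\<Sum>x\<in>{Y..<X}. \<Sum>y\<in>{Y..<X} - {x}. 1 / real y * (1 / \<bar>real x - real y\<bar>)))"
    by (simp only: sum_distrib_left[symmetric] sum.distrib)
  also have "(\<Sum>x\<in>{Y..<X}. \<Sum>y\<in>{Y..<X} - {x}. 1 / real y * (1 / \<bar>real x - real y\<bar>)) =
      (\<Sum>x\<in>{Y..<X}. \<Sum>y\<in>{Y..<X} - {x}. 1 / real x * (1 / \<bar>real x - real y\<bar>))"
  proof -
    have "(\<Sum>x\<in>{Y..<X}. \<Sum>y\<in>{Y..<X} - {x}. 1 / real y * (1 / \<bar>real x - real y\<bar>)) =
       (\<Sum>x\<in>{Y..<X}. \<Sum>y | y \<in> {Y..<X} \<and> y \<noteq> x. 1 / real y * (1 / \<bar>real x - real y\<bar>))"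
      by (intro sum.cong) auto
    also have "\<dots> = (\<Sum>y\<in>{Y..<X}. \<Sum>x | x \<in> {Y..<X} \<and> y \<noteq> x. 1 / real y * (1 / \<bar>real x - real y\<bar>))"
      by (rule sum.swap_restrict) auto
    also have "\<dots> = (\<Sum>x\<in>{Y..<X}. \<Sum>y\<in>{Y..<X} - {x}. 1 / real x * (1 / \<bar>real x - real y\<bar>))"
      by (intro sum.cong) (auto simp: abs_minus_commute)
    finally show ?thesis .
  qed
  also have "2 * p\<^sup>2 * ((\<Sum>x\<in>{Y..<X}. \<Sum>y\<in>{Y..<X} - {x}. 1 / real x * (1 / \<bar>real x - real y\<bar>)) +
      (\<Sum>x\<in>{Y..<X}. \<Sum>y\<in>{Y..<X} - {x}. 1 / real x * (1 / \<bar>real x - real y\<bar>))) \<le>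
      2 * p\<^sup>2 * (2 * H * H + 2 * H * H)"
  proof -
    have "(\<Sum>x\<in>{Y..<X}. \<Sum>y\<in>{Y..<X} - {x}. 1 / real x * (1 / \<bar>real x - real y\<bar>)) \<le>
        (\<Sum>x\<in>{Y..<X}. 1 / real x * (2 * H))"
    proof (rule sum_mono)
      fix x assume "x \<in> {Y..<X}"
      then have "(\<Sum>y\<in>{Y..<X} - {x}. 1 / \<bar>real x - real y\<bar>) \<le> 2 * H"
        unfolding H_def by (intro sum_inverse_distance_le) auto
      then show "(\<Sum>y\<in>{Y..<X} - {x}. 1 / real x * (1 / \<bar>real x - real y\<bar>)) \<le> 1 / real x * (2 * H)"
        unfolding sum_distrib_left[symmetric] by (rule mult_left_mono) simp
    qed
    also have "\<dots> = (\<Sum>x\<in>{Y..<X}. 1 / real x) * (2 * H)" by (rule sum_distrib_right[symmetric])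
    also have "\<dots> \<le> H * (2 * H)"
      unfolding H_def using Y by (intro mult_right_mono sum_mono2) (auto intro: sum_nonneg)
    finally have "(\<Sum>x\<in>{Y..<X}. \<Sum>y\<in>{Y..<X} - {x}. 1 / real x * (1 / \<bar>real x - real y\<bar>)) \<le> 2 * H * H"
      by (simp only: mult_ac)
    then show ?thesis by (intro mult_left_mono add_mono) auto
  qed
  also have "\<dots> = 8 * p\<^sup>2 * H\<^sup>2" by (simp add: power2_eq_square)
  also have "\<dots> \<le> 8 * p\<^sup>2 * (16 * p)\<^sup>2" using H by (intro mult_left_mono power_mono) auto
  also have "\<dots> = 2048 * p ^ 4" by (simp add: power2_eq_square power4_eq_xxxx)
  also have "p ^ 4 = real X powr (1 / 4)" using X by (simp add: p_def powr_power)
  finally show ?thesis by simp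
qed

lemma harmonic_dyadic_ge: "real L / 2 \<le> (\<Sum>n<2 ^ L - 1. 1 / (real n + 2))"
proof (induction L)
  case 0
  then show ?case by simp
next
  case (Suc L)
  have "(\<Sum>n<2 ^ Suc L - 1. 1 / (real n + 2)) =
      (\<Sum>n<2 ^ L - 1. 1 / (real n + 2)) + (\<Sum>n\<in>{2 ^ L - 1..<2 ^ Suc L - 1}. 1 / (real n + 2))"
    using sum.atLeastLessThan_concat[of 0 "2 ^ L - 1" "2 ^ Suc L - 1" "\<lambda>n. 1 / (real n + 2)"]
    by (simp add: lessThan_atLeast0 diff_le_mono)
  moreover have "(\<Sum>n\<in>{2 ^ L - 1..<2 ^ Suc L - 1}. 1 / (real n + 2)) \<ge>
      (\<Sum>n\<in>{2 ^ L - 1..<2 ^ Suc L - 1 :: nat}. 1 / 2 ^ Suc L)"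
  proof (rule sum_mono)
    fix n :: nat assume "n \<in> {2 ^ L - 1..<2 ^ Suc L - 1}"
    then have "n + 2 \<le> 2 ^ Suc L" by auto
    then have "real n + 2 \<le> 2 ^ Suc L"
      by (metis of_nat_add of_nat_le_iff of_nat_numeral of_nat_power)
    then show "1 / 2 ^ Suc L \<le> 1 / (real n + 2)" by (intro divide_left_mono) auto
  qed
  moreover have "(\<Sum>n\<in>{2 ^ L - 1..<2 ^ Suc L - 1 :: nat}. 1 / 2 ^ Suc L) = (1 / 2 :: real)"
  proof -
    have "2 ^ Suc L - 1 - (2 ^ L - 1) = (2 ^ L :: nat)"
      using one_le_power[of "2::nat" L] by (simp del: one_le_power)
    then show ?thesis by simp
  qed
  ultimately show ?case using Suc by simp
qed

section \<open>Choice of the parameters\<close>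

lemma mult_32_le_power2: "32 * L \<le> 2 ^ L" if "L \<ge> 8" for L :: nat
  using that
proof (induction L rule: dec_induct)
  case base
  then show ?case by simp
next
  case (step L)
  have "32 * Suc L \<le> 32 * L + 32 * L" using step.hyps by simp
  also have "\<dots> \<le> 2 ^ L + 2 ^ L" using step.IH by (intro add_mono)
  finally show ?case by simp
qed

text \<open>All quantities are powers of two, and the inequalities reduce to \<open>32 * L \<le> 2 ^ L\<close>. The integer
  \<open>R\<close> is the fourth root of the bound \<open>Y\<close> that separates the second range of summation from the third.\<close>

lemma parameter_bounds:
  fixes L :: nat
  assumes L: "L \<ge> 8"
  defines "Q \<equiv> 2 ^ L :: nat"
  defines "k \<equiv> Q ^ 5" and "R \<equiv> (2 :: nat) ^ (Q\<^sup>2 div 4)" and "M \<equiv> (2 :: nat) ^ 2 ^ Q"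
  shows "Q * (2 * k + 1) ^ Q \<le> R" "2 * (Q ^ (Suc k * Q) * R ^ 4) \<le> M" "16 * Q \<le> R"
    "R ^ 4 \<le> 2 ^ (Q\<^sup>2)"
proof -
  have LQ: "32 * L \<le> Q" unfolding Q_def using mult_32_le_power2[OF L] .
  have Q256: "256 \<le> Q" unfolding Q_def using power_increasing[OF L, of "2::nat"] by simp
  have powQ: "Q ^ j = 2 ^ (L * j)" for j by (simp add: Q_def power_mult)
  have "2 * k + 1 \<le> 4 * k" using Q256 by (simp add: k_def)
  also have "4 * k = 2 ^ (5 * L + 2)" by (simp add: k_def powQ power_add mult.commute)
  finally have "(2 * k + 1) ^ Q \<le> (2 ^ (5 * L + 2)) ^ Q" by (rule power_mono) simp
  then have "Q * (2 * k + 1) ^ Q \<le> 2 ^ L * (2 ^ (5 * L + 2)) ^ Q"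
    unfolding Q_def by (intro mult_left_mono) auto
  also have "\<dots> = 2 ^ (L + (5 * L + 2) * Q)" by (simp only: power_add power_mult)
  also have "\<dots> \<le> R" unfolding R_def
  proof (rule power_increasing)
    have "L + (5 * L + 2) * Q \<le> L * Q + (5 * L + 2 * L) * Q"
      using L Q256 by (intro add_mono mult_right_mono) auto
    also have "\<dots> = 8 * L * Q" by (simp add: algebra_simps)
    finally have "4 * (L + (5 * L + 2) * Q) \<le> (32 * L) * Q" by simp
    also have "\<dots> \<le> Q\<^sup>2" unfolding power2_eq_square using LQ by (rule mult_right_mono) simp
    finally show "L + (5 * L + 2) * Q \<le> Q\<^sup>2 div 4" by simp
  qed simp
  finally show *: "Q * (2 * k + 1) ^ Q \<le> R" .
  have "Q \<le> k" unfolding k_def using Q256 by (simp add: self_le_power)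
  then have "16 \<le> (2 * k + 1) ^ 1" using Q256 by simp
  also have "\<dots> \<le> (2 * k + 1) ^ Q" using Q256 by (intro power_increasing) auto
  finally have "Q * 16 \<le> Q * (2 * k + 1) ^ Q" by (intro mult_left_mono) auto
  with * show "16 * Q \<le> R" by linarith
  have "R ^ 4 = 2 ^ (4 * (Q\<^sup>2 div 4))" by (simp add: R_def power_mult[symmetric] mult.commute)
  also have "\<dots> \<le> 2 ^ (Q\<^sup>2)" by (intro power_increasing) auto
  finally show R4: "R ^ 4 \<le> 2 ^ (Q\<^sup>2)" .
  have "2 * (Q ^ (Suc k * Q) * R ^ 4) \<le> 2 * (2 ^ (L * (Suc k * Q)) * 2 ^ (Q\<^sup>2))"
    unfolding powQ[of "Suc k * Q"] using R4 by (intro mult_left_mono) auto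
  also have "\<dots> = 2 ^ (1 + L * (Suc k * Q) + Q\<^sup>2)" by (simp only: power_add power_one_right mult.assoc)
  also have "\<dots> \<le> M" unfolding M_def
  proof (rule power_increasing)
    have Q1: "1 \<le> Q" "L \<le> Q" using Q256 LQ by auto
    have a: "1 \<le> Q ^ 7" "Q\<^sup>2 \<le> Q ^ 7" using Q1 by (auto intro: power_increasing)
    have "L * (Suc k * Q) \<le> Q * (Suc k * Q)" using Q1 by (intro mult_right_mono) auto
    also have "\<dots> = Q ^ 7 + Q\<^sup>2" by (simp add: k_def power2_eq_square eval_nat_numeral algebra_simps)
    finally have "1 + L * (Suc k * Q) + Q\<^sup>2 \<le> 4 * Q ^ 7" using a by linarith
    also have "\<dots> = 2 ^ (7 * L + 2)" by (simp add: powQ power_add mult.commute)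
    also have "\<dots> \<le> 2 ^ Q" using LQ L by (intro power_increasing) auto
    finally show "1 + L * (Suc k * Q) + Q\<^sup>2 \<le> 2 ^ Q" .
  qed simp
  finally show "2 * (Q ^ (Suc k * Q) * R ^ 4) \<le> M" .
qed

text \<open>The conclusion of \<open>weighted_distance_to_target\<close>, read with \<open>G\<close> for the mean of the kernel times \<open>T\<close>, \<open>q\<close>
  for \<open>Q\<close>, \<open>r\<close> for \<open>R\<close> and \<open>ie\<close> for \<open>1 / \<eta>\<close>. Every term on the right is at most a constant times
  \<open>G / sqrt (q - 1)\<close>, so that \<open>q\<close> is bounded in terms of \<open>\<epsilon>\<close>.\<close>

lemma numeric_contradiction:
  fixes G T r q ie Sa Sb Sc Sd Off \<epsilon> :: real
  assumes main: "(\<epsilon> / 2)\<^sup>2 * (G - 2 * ie) \<le> 3 * (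
      q * Sa * (2 * G / (q ^ 5 + 1) + 16 * ie) + (Sb * (G + 2 * ie) + Sc\<^sup>2 * (2 * ie)) + (Sd * T + Off))"
    and q: "q \<ge> 2" and r: "16 * q \<le> r" and ie: "0 \<le> ie" "ie \<le> T / r ^ 16"
    and T: "0 \<le> T" "T \<le> r * G / q" and Sa: "0 \<le> Sa" "Sa \<le> q ^ 3"
    and Sb: "0 \<le> Sb" "Sb \<le> 2 / sqrt (q - 1)" and Sc: "0 \<le> Sc" "Sc \<le> r ^ 4"
    and Sd: "0 \<le> Sd" "Sd \<le> 2 / sqrt (r ^ 4 - 1)" and Off: "Off \<le> T / r"
    and G: "G > 0" and \<epsilon>: "\<epsilon> > 0"
  shows "sqrt (q - 1) \<le> 240 / \<epsilon>\<^sup>2"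
proof -
  have r0: "r \<ge> 32" using r q by linarith
  define g where "g = G / q"
  have g: "g > 0" using G q by (simp add: g_def)
  have Tr: "T / r \<le> g" using T(2) r0 q by (simp add: g_def field_simps)
  have ie2: "ie \<le> g / r ^ 15"
  proof -
    have "T / r ^ 16 = (T / r) / r ^ 15" by (simp add: power_Suc eval_nat_numeral)
    also have "\<dots> \<le> g / r ^ 15" using Tr r0 by (intro divide_right_mono) auto
    finally show ?thesis using ie by linarith
  qed
  have rp: "32 \<le> r ^ j" if "j \<ge> 1" for j
    using power_increasing[OF that, of r] r0 by simp
  have ie_r: "ie * r ^ 15 \<le> g" using ie2 r0 by (simp add: field_simps)
  have small: "c * ie \<le> g" if "0 \<le> c" "c \<le> r ^ 15" for c
    using mult_right_mono[OF that(2) ie(1)] ie_r by (simp add: mult.commute)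
  have gG: "g \<le> G / 2" unfolding g_def using q G by (intro divide_left_mono) auto
  have i1: "2 * ie \<le> g" using small[of 2] rp[of 15] by simp
  have q5: "q ^ 4 * (2 * G / (q ^ 5 + 1)) \<le> 2 * g"
  proof -
    have "q ^ 4 * (2 * G / (q ^ 5 + 1)) \<le> q ^ 4 * (2 * G / q ^ 5)"
      using q G by (intro mult_left_mono divide_left_mono) (auto intro!: mult_pos_pos add_pos_pos)
    also have "\<dots> = 2 * g" using q by (simp add: g_def field_simps eval_nat_numeral)
    finally show ?thesis .
  qed
  have q4: "q ^ 4 * (16 * ie) \<le> g"
  proof -
    have "q \<le> r" using r q by linarith
    have "16 * q ^ 4 \<le> r * r ^ 4" using q r0 \<open>q \<le> r\<close> by (intro mult_mono power_mono) auto
    also have "\<dots> = r ^ 5" by (simp add: eval_nat_numeral)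
    also have "\<dots> \<le> r ^ 15" using r0 by (intro power_increasing) auto
    finally show ?thesis using small[of "16 * q ^ 4"] q by (simp add: mult_ac)
  qed
  have t0: "q * Sa * (2 * G / (q ^ 5 + 1) + 16 * ie) \<le> 3 * g"
  proof -
    have "q * Sa \<le> q * q ^ 3" using Sa q by (intro mult_left_mono) auto
    also have "\<dots> = q ^ 4" by (simp add: eval_nat_numeral)
    finally have "q * Sa * (2 * G / (q ^ 5 + 1) + 16 * ie) \<le> q ^ 4 * (2 * G / (q ^ 5 + 1) + 16 * ie)"
      using G q ie by (intro mult_right_mono) (auto intro!: add_nonneg_nonneg divide_nonneg_nonneg)
    with q5 q4 show ?thesis by (simp add: distrib_left)
  qed
  have sq: "sqrt (q - 1) > 0" using q by simp
  have sq': "sqrt (q - 1) \<le> q"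
  proof (rule real_le_lsqrt)
    have "1 * q \<le> q * q" using q by (intro mult_right_mono) auto
    then show "q - 1 \<le> q\<^sup>2" by (simp add: power2_eq_square)
  qed (use q in auto)
  define h where "h = G / sqrt (q - 1)"
  have gh: "g \<le> h" unfolding g_def h_def using sq sq' q G by (intro divide_left_mono) auto
  have t1: "Sb * (G + 2 * ie) \<le> 4 * h"
  proof -
    have "Sb * (G + 2 * ie) \<le> 2 / sqrt (q - 1) * (2 * G)"
      using Sb i1 gG G ie sq by (intro mult_mono) auto
    then show ?thesis by (simp add: h_def)
  qed
  have t1': "Sc\<^sup>2 * (2 * ie) \<le> g"
  proof -
    have "Sc\<^sup>2 \<le> (r ^ 4)\<^sup>2" using Sc by (intro power_mono) auto
    also have "(r ^ 4)\<^sup>2 = r ^ 8" by (simp add: power_mult[symmetric])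
    finally have "2 * Sc\<^sup>2 \<le> r * r ^ 8" using r0 by (intro mult_mono) auto
    also have "\<dots> = r ^ 9" by (simp add: eval_nat_numeral)
    also have "\<dots> \<le> r ^ 15" using r0 by (intro power_increasing) auto
    finally show ?thesis using small[of "2 * Sc\<^sup>2"] by (simp add: mult_ac)
  qed
  have t2: "Sd * T \<le> g"
  proof -
    have "r\<^sup>2 / 2 \<le> sqrt (r ^ 4 - 1)"
    proof (rule real_le_rsqrt)
      have "(r\<^sup>2 / 2)\<^sup>2 = r ^ 4 / 4" by (simp add: power_divide power_mult[symmetric])
      then show "(r\<^sup>2 / 2)\<^sup>2 \<le> r ^ 4 - 1" using rp[of 4] by simp
    qed
    then have "2 / sqrt (r ^ 4 - 1) \<le> 2 / (r\<^sup>2 / 2)"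
      using r0 by (intro divide_left_mono mult_pos_pos) (auto intro: less_le_trans)
    also have "2 / (r\<^sup>2 / 2) = 4 / r / r" by (simp add: power2_eq_square)
    finally have "Sd * T \<le> 4 / r / r * T" using Sd T by (intro mult_right_mono) auto
    also have "\<dots> = 4 / r * (T / r)" by simp
    also have "\<dots> \<le> 1 * g" using Tr r0 g T by (intro mult_mono) auto
    finally show ?thesis by simp
  qed
  have "(\<epsilon> / 2)\<^sup>2 * (G / 2) \<le> (\<epsilon> / 2)\<^sup>2 * (G - 2 * ie)"
    using i1 gG by (intro mult_left_mono) auto
  also note main
  also have "3 * (q * Sa * (2 * G / (q ^ 5 + 1) + 16 * ie) +
      (Sb * (G + 2 * ie) + Sc\<^sup>2 * (2 * ie)) + (Sd * T + Off)) \<le>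
      3 * (3 * g + (4 * h + g) + (g + g))"
    using order_trans[OF Off Tr] by (intro mult_left_mono add_mono t0 t1 t1' t2) auto
  also have "\<dots> \<le> 3 * (10 * h)" using gh by simp
  finally have "G * (\<epsilon>\<^sup>2 / 8) \<le> G * (30 / sqrt (q - 1))"
    by (simp add: h_def power_divide mult.commute)
  then have "\<epsilon>\<^sup>2 / 8 \<le> 30 / sqrt (q - 1)" using G by (simp only: mult_le_cancel_left_pos)
  then show ?thesis using sq \<epsilon> by (simp add: field_simps)
qed

section \<open>Approximation at one point\<close>

lemma powr_term_polar:
  assumes "x > 0"
  shows "complex_of_real x powr (- (Complex \<sigma> t0 + \<i> * complex_of_real \<tau>)) =
     complex_of_real (x powr (- \<sigma>)) * cis (- ((t0 + \<tau>) * ln x))"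
proof -
  have "- (Complex \<sigma> t0 + \<i> * complex_of_real \<tau>) * complex_of_real (ln x) =
      Complex (- \<sigma> * ln x) (- ((t0 + \<tau>) * ln x))"
    by (simp add: complex_eq_iff algebra_simps)
  then have "complex_of_real x powr (- (Complex \<sigma> t0 + \<i> * complex_of_real \<tau>)) =
      exp (Complex (- \<sigma> * ln x) (- ((t0 + \<tau>) * ln x)))"
    using real_powr_eq_exp[OF assms] by (simp only:)
  also have "\<dots> = complex_of_real (exp (- \<sigma> * ln x)) * cis (- ((t0 + \<tau>) * ln x))"
    using exp_eq_polar[of "Complex (- \<sigma> * ln x) (- ((t0 + \<tau>) * ln x))"] by simp
  also have "exp (- \<sigma> * ln x) = x powr (- \<sigma>)" using assms by (simp add: powr_def)
  finally show ?thesis .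
qed

text \<open>For \<open>X\<close> about \<open>T\<^sup>2\<close> both the main term and the error term of \<open>hurwitz_zeta_approx\<close> at \<open>\<alpha> + X\<close> are at most a
  constant times \<open>T powr (- 7 / 8)\<close>.\<close>

lemma hurwitz_zeta_remainder_le:
  fixes \<sigma> t0 \<tau> \<alpha> T :: real
  assumes \<sigma>: "15 / 16 \<le> \<sigma>" "\<sigma> \<le> 1" and \<alpha>: "0 < \<alpha>" "\<alpha> \<le> 1" and T: "T \<ge> 4" "2 * \<bar>t0\<bar> \<le> T"
    and \<tau>: "\<tau> \<in> {T..2 * T}" and X: "T\<^sup>2 \<le> real X" "real X \<le> 2 * T\<^sup>2"
  defines "s \<equiv> Complex \<sigma> t0 + \<i> * complex_of_real \<tau>"
  shows "norm (hurwitz_zeta s \<alpha> - (\<Sum>n<X. complex_of_real (real n + \<alpha>) powr (- s))) \<le> 20 / sqrt T"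
proof -
  have Res: "Re s = \<sigma>" and Ims: "Im s = t0 + \<tau>" by (simp_all add: s_def)
  have im: "t0 + \<tau> \<ge> T / 2" using T \<tau> by auto
  have s1: "s \<noteq> 1" using im T Ims by auto
  define b where "b = \<alpha> + real X"
  have T2: "T\<^sup>2 = T powr 2" using T by simp
  have T16: "T\<^sup>2 \<ge> 16" using power_mono[of 4 T 2] T by simp
  have b: "T\<^sup>2 \<le> b" "b \<le> 4 * T\<^sup>2" "b \<ge> 1" using X \<alpha> T16 by (auto simp: b_def)
  have bp: "b powr (- \<sigma>) \<le> T powr (- (15 / 8))"
  proof -
    have "b powr (- \<sigma>) \<le> b powr (- (15 / 16))" using b \<sigma> by (intro powr_mono) auto
    also have "\<dots> \<le> (T\<^sup>2) powr (- (15 / 16))" using b T by (intro powr_mono2') auto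
    also have "(T\<^sup>2) powr (- (15 / 16)) = T powr (- (15 / 8))"
      unfolding T2 by (simp add: powr_powr)
    finally show ?thesis .
  qed
  have bq: "b powr (1 - \<sigma>) \<le> 2 * T powr (1 / 8)"
  proof -
    have "b powr (1 - \<sigma>) \<le> b powr (1 / 16)" using b \<sigma> by (intro powr_mono) auto
    also have "\<dots> \<le> (4 * T\<^sup>2) powr (1 / 16)" using b by (intro powr_mono2) auto
    also have "\<dots> = 4 powr (1 / 16) * (T\<^sup>2) powr (1 / 16)" by (simp add: powr_mult)
    also have "(T\<^sup>2) powr (1 / 16) = T powr (1 / 8)"
      unfolding T2 by (simp add: powr_powr)
    also have "4 powr (1 / 16) * \<dots> \<le> 2 * T powr (1 / 8)"
    proof (rule mult_right_mono)
      have "(4::real) powr (1 / 16) \<le> 4 powr (1 / 2)" by (intro powr_mono) auto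
      then show "(4::real) powr (1 / 16) \<le> 2" by (simp add: powr_half_sqrt)
    qed simp
    finally show ?thesis .
  qed
  have norms: "norm s \<le> 4 * T"
  proof -
    have "norm s \<le> \<bar>Re s\<bar> + \<bar>Im s\<bar>" by (rule cmod_le)
    then show ?thesis unfolding Res Ims using \<sigma> T \<tau> by auto
  qed
  have norms1: "norm (s - 1) \<ge> T / 2"
    using abs_Im_le_cmod[of "s - 1"] im Ims by simp
  let ?m = "complex_of_real b powr (1 - s) / (s - 1)"
  have eq: "hurwitz_zeta s \<alpha> - (\<Sum>n<X. complex_of_real (real n + \<alpha>) powr (- s)) = hurwitz_zeta s b"
    using hurwitz_zeta_shift[OF \<alpha>(1) s1, of X] by (simp add: b_def)
  have n1: "norm ?m \<le> 4 * T powr (- (7 / 8))"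
  proof -
    have "norm ?m \<le> 2 * T powr (1 / 8) / (T / 2)"
      unfolding norm_divide using b bq norms1 T norm_real_powr[of b "1 - s"] Res
      by (intro frac_le) auto
    moreover have "T powr (1 / 8) / T powr 1 = T powr (1 / 8 - 1)" by (rule powr_diff[symmetric])
    ultimately show ?thesis using T by simp
  qed
  have n2: "norm (hurwitz_zeta s b - ?m) \<le> 12 * T powr (- (7 / 8))"
  proof -
    have "norm (hurwitz_zeta s b - ?m) \<le> norm s * (b powr (- \<sigma> - 1) + b powr (- \<sigma>) / \<sigma>)"
      using hurwitz_zeta_approx[of b s] b \<sigma> s1 Res by simp
    also have "\<dots> \<le> (4 * T) * (T powr (- (15 / 8)) + 2 * T powr (- (15 / 8)))"
    proof (intro mult_mono add_mono norms)
      have "b powr (- \<sigma> - 1) \<le> b powr (- \<sigma>)" using b by (intro powr_mono) auto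
      with bp show "b powr (- \<sigma> - 1) \<le> T powr (- (15 / 8))" by linarith
      have "b powr (- \<sigma>) / \<sigma> \<le> b powr (- \<sigma>) / (1 / 2)" using \<sigma> b by (intro divide_left_mono) auto
      with bp show "b powr (- \<sigma>) / \<sigma> \<le> 2 * T powr (- (15 / 8))" by simp
    qed (use \<sigma> T in auto)
    also have "\<dots> = 12 * (T powr 1 * T powr (- (15 / 8)))" using T by simp
    also have "T powr 1 * T powr (- (15 / 8)) = T powr (1 + - (15 / 8))" by (rule powr_add[symmetric])
    finally show ?thesis by simp
  qed
  have "norm (hurwitz_zeta s b) \<le> norm ?m + norm (hurwitz_zeta s b - ?m)"
    using norm_triangle_ineq[of ?m "hurwitz_zeta s b - ?m"] by simp
  with n1 n2 have "norm (hurwitz_zeta s \<alpha> - (\<Sum>n<X. complex_of_real (real n + \<alpha>) powr (- s))) \<le>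
      16 * T powr (- (7 / 8))" unfolding eq by linarith
  also have "\<dots> \<le> 16 * T powr (- (1 / 2))" using T by (intro mult_left_mono powr_mono) auto
  also have "T powr (- (1 / 2)) = 1 / sqrt T" using T by (simp add: powr_minus powr_half_sqrt inverse_eq_divide)
  finally show ?thesis using T by (simp add: field_simps)
qed

text \<open>The lower bound for \<open>T\<close> in the theorem contains this exponential; twenty powers of \<open>M\<close> pay for all
  constants that depend on the parameters.\<close>

lemma exp_power_dominates:
  fixes M Q :: nat
  assumes "Q \<ge> 5"
  shows "real M ^ 20 \<le> exp ((real M + 2) * exp (real Q ^ 2))"
proof -
  have "real M \<le> exp (real M + 2)" using exp_ge_add_one_self[of "real M + 2"] by linarith
  then have "real M ^ 20 \<le> exp (real M + 2) ^ 20" by (intro power_mono) auto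
  also have "\<dots> = exp (real (20 :: nat) * (real M + 2))" by (rule exp_of_nat_mult[symmetric])
  also have "\<dots> \<le> exp ((real M + 2) * exp (real Q ^ 2))"
  proof -
    have "5\<^sup>2 \<le> real Q ^ 2" using assms by (intro power_mono) auto
    moreover have "(5::real)\<^sup>2 = 25" by simp
    ultimately have "20 \<le> exp (real Q ^ 2)" using exp_ge_add_one_self[of "real Q ^ 2"] by linarith
    then have "(real M + 2) * 20 \<le> (real M + 2) * exp (real Q ^ 2)" by (intro mult_left_mono) auto
    then show ?thesis by simp
  qed
  finally show ?thesis .
qed

lemma power2_le_exp_square: "real (2 ^ (Q\<^sup>2)) \<le> exp (2 * real Q ^ 2)"
proof -
  have "(2::real) \<le> exp 1" using exp_ge_add_one_self[of 1] by simp
  then have "(2::real) ^ (Q\<^sup>2) \<le> exp 1 ^ (Q\<^sup>2)" by (intro power_mono) auto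
  also have "\<dots> = exp (real (Q\<^sup>2))" by (simp add: exp_of_nat_mult[symmetric])
  also have "\<dots> \<le> exp (2 * real Q ^ 2)" by simp
  finally show ?thesis by simp
qed

lemma powr_square_le:
  fixes \<sigma> x :: real
  assumes "3 / 4 \<le> \<sigma>" "0 < \<alpha>" "n \<ge> 1"
  shows "((real n + \<alpha>) powr (- \<sigma>))\<^sup>2 \<le> 1 / (real n * sqrt (real n))"
proof -
  have "((real n + \<alpha>) powr (- \<sigma>))\<^sup>2 = (real n + \<alpha>) powr (- (2 * \<sigma>))"
    using assms by (simp add: power2_eq_square flip: powr_add)
  also have "\<dots> \<le> real n powr (- (2 * \<sigma>))" using assms by (intro powr_mono2') auto
  also have "\<dots> \<le> real n powr (- 1 + - (1 / 2))" using assms by (intro powr_mono) auto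
  also have "\<dots> = real n powr (- 1) * real n powr (- (1 / 2))" by (rule powr_add)
  also have "\<dots> = 1 / (real n * sqrt (real n))"
    using assms by (simp add: powr_minus powr_half_sqrt inverse_eq_divide)
  finally show ?thesis .
qed

text \<open>If \<open>\<zeta>(s0 + i\<tau>; \<alpha>)\<close> stayed away from \<open>w\<close> for all \<open>\<tau> \<in> [T, 2T]\<close>, so would the Dirichlet polynomial, and
  \<open>weighted_distance_to_target\<close> with \<open>numeric_contradiction\<close> would bound \<open>Q\<close> in terms of \<open>\<epsilon>\<close>.\<close>

theorem point_approximation:
  fixes \<sigma> t0 \<alpha> \<epsilon> T H :: real and w :: complex and L :: nat
  defines "Q \<equiv> 2 ^ L :: nat" and "M \<equiv> (2 :: nat) ^ 2 ^ 2 ^ L"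
  assumes \<sigma>: "15 / 16 \<le> \<sigma>" "\<sigma> \<le> 1" and L: "L \<ge> 8" and adm: "\<alpha> \<in> admissible Q M"
    and H: "H \<ge> 1" and \<epsilon>: "\<epsilon> > 0" and w: "w \<noteq> 0" and room: "norm w + 1 / \<alpha> \<le> real L / 2"
    and Q\<alpha>: "1 / \<alpha> \<le> real Q" and Q1: "40 / \<epsilon> \<le> real Q" and Q2: "240 / \<epsilon>\<^sup>2 < sqrt (real Q - 1)"
    and Q3: "2 * \<bar>t0\<bar> \<le> real Q"
    and T: "bigK H Q M \<alpha> * exp ((real M + 2) * exp (real Q ^ 2)) \<le> T"
  shows "\<exists>\<tau>\<in>{T..2 * T}. norm (hurwitz_zeta (Complex \<sigma> t0 + \<i> * complex_of_real \<tau>) \<alpha> - w) < \<epsilon>"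
proof (rule ccontr)
  assume "\<not> ?thesis"
  then have far0: "\<epsilon> \<le> norm (hurwitz_zeta (Complex \<sigma> t0 + \<i> * complex_of_real \<tau>) \<alpha> - w)"
    if "\<tau> \<in> {T..2 * T}" for \<tau> using that by force
  define k where "k = Q ^ 5"
  define R where "R = (2 :: nat) ^ (Q\<^sup>2 div 4)"
  define Y where "Y = R ^ 4"
  have MQ: "M = 2 ^ 2 ^ Q" by (simp add: M_def Q_def)
  note pars = parameter_bounds[OF L, folded Q_def, folded k_def R_def, folded MQ, folded Y_def]
  have Q256: "256 \<le> Q" unfolding Q_def using power_increasing[OF L, of "2::nat"] by simp
  have R1: "R \<ge> 1" by (simp add: R_def)
  have RY: "R \<le> Y" unfolding Y_def using R1 by (simp add: self_le_power)
  have QY: "Q < Y" using pars(3) RY Q256 by linarith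
  have YM: "2 * Y \<le> M"
  proof -
    have "1 * Y \<le> Q ^ (Suc k * Q) * Y" using Q256 by (intro mult_right_mono) auto
    with pars(2) show ?thesis by linarith
  qed
  have kM: "2 * Suc k + 4 \<le> M"
  proof -
    have "2 * k + 1 \<le> (2 * k + 1) ^ Q" using Q256 by (intro self_le_power) auto
    also have "\<dots> \<le> Q * (2 * k + 1) ^ Q" using Q256 by simp
    finally have "2 * k + 1 \<le> Y" using pars(1) RY by linarith
    moreover have "5 \<le> Y" using QY Q256 by linarith
    ultimately have "2 * k + 6 \<le> M" using YM by linarith
    then show ?thesis by simp
  qed
  have M1: "M \<ge> 1" using kM by simp
  have Mr: "4096 \<le> M"
  proof -
    have "2 * (16 * Q) \<le> M" using pars(3) RY YM by linarith
    with Q256 show ?thesis by linarith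
  qed
  note range = admissible_range[OF adm _ M1]
  have \<alpha>: "algebraic \<alpha>" "0 < \<alpha>" "\<alpha> \<le> 1" using range Q256 by (auto simp: alg_irrationals_def)
  define K where "K = bigK H Q M \<alpha>"
  define B where "B = real Q ^ (Suc k * Q) * real Y"
  have B: "0 < B" "2 * B \<le> real M"
  proof -
    show "0 < B" using Q256 QY by (simp add: B_def)
    have "real (2 * (Q ^ (Suc k * Q) * Y)) \<le> real M" using pars(2) by (simp only: of_nat_le_iff)
    then show "2 * B \<le> real M" by (simp add: B_def)
  qed
  have MMQ: "M \<le> M * Q" using Q256 by simp
  have K1: "K \<ge> 1" unfolding K_def
    by (rule one_over_alg_le_bigK(2)[OF \<alpha> H]) (use MMQ Mr in linarith)
  have TE: "K * real M ^ 20 \<le> T"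
  proof -
    have "K * real M ^ 20 \<le> K * exp ((real M + 2) * exp (real Q ^ 2))"
      using K1 Q256 by (intro mult_left_mono exp_power_dominates) auto
    with T show ?thesis by (simp add: K_def)
  qed
  have M20: "real M ^ 20 \<le> T"
  proof -
    have "1 * real M ^ 20 \<le> K * real M ^ 20" using K1 by (intro mult_right_mono) auto
    with TE show ?thesis by linarith
  qed
  have MT: "real M ^ j \<le> T" if "j \<le> 20" for j
    using power_increasing[OF that, of "real M"] M1 M20 by simp
  have T0: "T \<ge> 4096" using MT[of 1] Mr by simp
  define r where "r = real R"
  have rM: "r \<le> real M" "r ^ 4 \<le> real M" "r \<ge> 1"
    using RY YM R1 unfolding r_def Y_def
    by (auto simp flip: of_nat_power)
  \<comment> \<open>\<open>ie\<close> is the reciprocal of the lower bound for the frequencies; kernels with one exponent \<open>Suc k\<close> occur\<close>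
  define D where "D = alg_degree \<alpha>"
  define ie where "ie = B * (real D * real_of_int (poly_l1 (min_int_poly \<alpha>)) ^ (Suc k * Q + 1) * (2 * B) ^ (D - 1))"
  have e_le: "2 * (Suc k * Q + 1) + 2 \<le> M * Q + 1"
  proof -
    have "(2 * Suc k + 4) * Q \<le> M * Q" using kM by (rule mult_right_mono) simp
    moreover have "(2 * Suc k + 4) * Q = 2 * (Suc k * Q) + 4 * Q" by (simp add: algebra_simps)
    moreover have "2 * p + 4 * Q \<le> n \<Longrightarrow> 2 * (p + 1) + 2 \<le> n + 1" for p n :: nat using Q256 by (simp | arith | presburger)
    ultimately show ?thesis by metis
  qed
  have lB: "real D * real_of_int (poly_l1 (min_int_poly \<alpha>)) ^ (Suc k * Q + 1) * (2 * B) ^ (D - 1) \<le> K"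
    unfolding K_def D_def
  proof (rule liouville_constant_le_bigK[OF \<alpha> H e_le])
    have "M \<le> M * Q + 2" using MMQ by linarith
    then have "real M \<le> real (M * Q + 2)" by (simp only: of_nat_le_iff)
    with B show "0 \<le> 2 * B" "2 * B \<le> real (M * Q + 2)" by linarith+
  qed
  have ie_le: "ie \<le> T / r ^ 16"
  proof -
    have "ie * r ^ 16 \<le> (real M * K) * real M ^ 16"
      unfolding ie_def using lB B rM K1
      by (intro mult_mono power_mono) (auto intro!: mult_nonneg_nonneg simp: poly_l1_nonneg)
    also have "\<dots> = K * real M ^ 17" by (simp add: eval_nat_numeral)
    also have "\<dots> \<le> K * real M ^ 20" using K1 M1 by (intro mult_left_mono power_increasing) auto
    finally show ?thesis using TE rM by (simp add: field_simps)
  qed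
  have Yexp: "real Y \<le> exp (2 * real Q ^ 2)"
  proof -
    have "real Y \<le> real (2 ^ (Q\<^sup>2))" using pars(4) by (simp only: of_nat_le_iff)
    with power2_le_exp_square show ?thesis by (rule order_trans[rotated -1])
  qed
  define l where "l = (\<lambda>n::nat. ln (real n + \<alpha>))"
  define a where "a = (\<lambda>n::nat. (real n + \<alpha>) powr (- \<sigma>))"
  have sep0: "1 \<le> ie * \<bar>(\<Sum>n<Q. real_of_int (\<mu> n) * l n) + (l y - l x)\<bar>"
    if "\<And>n. n < Q \<Longrightarrow> \<bar>\<mu> n\<bar> \<le> int (Suc k)" "x \<in> {Q..<Y}" "y \<in> {Q..<Y}"
       "x \<noteq> y \<or> (\<exists>n<Q. \<mu> n \<noteq> 0)" for \<mu> x y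
    unfolding ie_def l_def D_def B_def
    by (rule frequency_separation[OF adm _ M1 _ _ Yexp]) (use that Q256 kM in auto)
  have ie0: "ie > 0"
  proof -
    have "1 \<le> ie * \<bar>(\<Sum>n<Q. real_of_int 1 * l n) + (l Q - l Q)\<bar>"
      by (rule sep0) (use Q256 QY in \<open>auto intro!: exI[of _ 0]\<close>)
    then have "ie \<noteq> 0" by auto
    moreover have "ie \<ge> 0" unfolding ie_def using B by (auto intro!: mult_nonneg_nonneg simp: poly_l1_nonneg)
    ultimately show ?thesis by simp
  qed
  have sep: "1 / ie \<le> \<bar>(\<Sum>n<Q. real_of_int (\<mu> n) * l n) + (l y - l x)\<bar>"
    if "\<And>n. n < Q \<Longrightarrow> \<bar>\<mu> n\<bar> \<le> int (Suc k)" "x \<in> {Q..<Y}" "y \<in> {Q..<Y}"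
       "x \<noteq> y \<or> (\<exists>n<Q. \<mu> n \<noteq> 0)" for \<mu> x y
    using sep0[OF that] ie0 by (simp add: field_simps)
  have a0: "a n \<ge> 0" for n by (simp add: a_def)
  have a_mono: "a n \<le> a 0" for n unfolding a_def using \<alpha> \<sigma> by (intro powr_mono2') auto
  have a0_le: "a 0 \<le> 1 / \<alpha>"
  proof -
    have "\<alpha> powr (- \<sigma>) \<le> \<alpha> powr (- 1)" using \<alpha> \<sigma> by (intro powr_mono') auto
    then show ?thesis using \<alpha> by (simp add: a_def powr_minus inverse_eq_divide)
  qed
  define m where "m = (2 :: nat) ^ L - 1"
  have Qm: "Q = Suc m" by (simp add: Q_def m_def)
  have "\<exists>u. (\<forall>n. norm (u n) = 1) \<and> (\<Sum>n<Suc m. of_real (a n) * u n) = w"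
  proof (rule polygon)
    have "real L / 2 \<le> (\<Sum>n<m. 1 / (real n + 2))" unfolding m_def by (rule harmonic_dyadic_ge)
    also have "\<dots> \<le> (\<Sum>n<m. a (Suc n))"
    proof (rule sum_mono)
      fix n
      have "1 / (real n + 2) \<le> 1 / (real (Suc n) + \<alpha>)" using \<alpha> by (intro divide_left_mono) auto
      also have "\<dots> = (real (Suc n) + \<alpha>) powr (- 1)"
        using \<alpha> by (simp add: powr_minus inverse_eq_divide)
      also have "\<dots> \<le> a (Suc n)" unfolding a_def using \<alpha> \<sigma> by (intro powr_mono) auto
      finally show "1 / (real n + 2) \<le> a (Suc n)" .
    qed
    finally show "norm w + a 0 \<le> (\<Sum>n<m. a (Suc n))" using room a0_le by linarith
  qed (use a0 a_mono w in auto)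
  then obtain u where u: "\<And>n. norm (u n) = 1" "(\<Sum>n<Q. of_real (a n) * u n) = w"
    unfolding Qm by blast
  define X where "X = nat \<lceil>T\<^sup>2\<rceil>"
  have T2: "T \<le> T\<^sup>2" using T0 by (simp add: power2_eq_square)
  have X: "T\<^sup>2 \<le> real X" "real X \<le> 2 * T\<^sup>2"
    unfolding X_def using T0 T2 by linarith+
  have YX: "Y \<le> X"
  proof -
    have "real Y \<le> real M" using YM by simp
    also have "\<dots> \<le> real X" using MT[of 1] T2 X by simp
    finally show ?thesis by simp
  qed
  have X2: "X \<ge> 2" using YX QY Q256 by linarith
  have sqT: "sqrt T \<ge> real Q"
  proof (rule real_le_rsqrt)
    have "real Q \<le> real M" using QY YM by simp
    then have "(real Q)\<^sup>2 \<le> (real M)\<^sup>2" by (intro power_mono) auto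
    from order_trans[OF this MT] show "(real Q)\<^sup>2 \<le> T" by simp
  qed
  \<comment> \<open>half of \<open>\<epsilon>\<close> is spent on the remainder of the Dirichlet polynomial\<close>
  have far: "\<epsilon> / 2 \<le> norm ((\<Sum>n<X. of_real (a n) * cis (- ((t0 + t) * l n))) - (\<Sum>n<Q. of_real (a n) * u n))"
    if t: "t \<in> {T..2 * T}" for t
  proof -
    let ?s = "Complex \<sigma> t0 + \<i> * complex_of_real t"
    define S where "S = (\<Sum>n<X. complex_of_real (real n + \<alpha>) powr (- ?s))"
    have S: "S = (\<Sum>n<X. of_real (a n) * cis (- ((t0 + t) * l n)))"
      unfolding S_def a_def l_def using \<alpha> by (intro sum.cong refl powr_term_polar) auto
    have "2 * \<bar>t0\<bar> \<le> T"
    proof -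
      have "real Q \<le> T" using QY YM MT[of 1] by simp
      with Q3 show ?thesis by linarith
    qed
    then have "norm (hurwitz_zeta ?s \<alpha> - S) \<le> 20 / sqrt T"
      unfolding S_def using \<sigma> \<alpha> T0 X t by (intro hurwitz_zeta_remainder_le) auto
    also have "\<dots> \<le> 20 / (40 / \<epsilon>)"
      using sqT Q1 \<epsilon> T0 by (intro divide_left_mono mult_pos_pos) auto
    also have "\<dots> = \<epsilon> / 2" using \<epsilon> by simp
    finally have "norm (hurwitz_zeta ?s \<alpha> - S) \<le> \<epsilon> / 2" .
    moreover have "norm (hurwitz_zeta ?s \<alpha> - w) \<le> norm (hurwitz_zeta ?s \<alpha> - S) + norm (S - w)"
      using norm_triangle_ineq[of "hurwitz_zeta ?s \<alpha> - S" "S - w"] by simp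
    ultimately show ?thesis using far0[OF t] unfolding S[symmetric] u(2) by linarith
  qed
  define c where "c = kernel_mean Q (\<lambda>_. k)"
  have inj: "inj_on l {Y..<X}"
  proof (rule inj_onI)
    fix x y assume "l x = l y"
    then have "real x + \<alpha> = real y + \<alpha>" unfolding l_def using \<alpha> by (subst (asm) ln_inj_iff) auto
    then show "x = y" by simp
  qed
  have main: "(\<epsilon> / 2)\<^sup>2 * (c * T - 2 / (1 / ie)) \<le> 3 * (
     real Q * (\<Sum>n<Q. (a n)\<^sup>2) * (2 * c * T / (real k + 1) + 16 / (1 / ie)) +
     ((\<Sum>n\<in>{Q..<Y}. (a n)\<^sup>2) * (c * T + 2 / (1 / ie)) + (\<Sum>n\<in>{Q..<Y}. a n)\<^sup>2 * (2 / (1 / ie))) +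
     ((\<Sum>n\<in>{Y..<X}. (a n)\<^sup>2) * T +
       (\<Sum>x\<in>{Y..<X}. \<Sum>y\<in>{Y..<X} - {x}. a x * a y * (2 / \<bar>l y - l x\<bar>))))"
    unfolding c_def
    by (rule weighted_distance_to_target[OF u(1) _ _ QY YX sep a0 inj far]) (use ie0 T0 \<epsilon> in auto)
  have cR: "real Q / r \<le> c"
  proof -
    have "real (Q * (2 * k + 1) ^ Q) \<le> r" unfolding r_def using pars(1) by (simp only: of_nat_le_iff)
    then have "real Q * (2 * real k + 1) ^ Q \<le> r" by (simp add: add.commute)
    then have "real Q / r \<le> 1 / (2 * real k + 1) ^ Q" using rM by (simp add: field_simps)
    also have "\<dots> \<le> c" unfolding c_def by (rule kernel_mean_ge)
    finally show ?thesis .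
  qed
  have "0 < real Q / r" using rM Q256 by (intro divide_pos_pos) auto
  with cR have c0: "c > 0" by linarith
  have "sqrt (real Q - 1) \<le> 240 / \<epsilon>\<^sup>2"
  proof (rule numeric_contradiction[where G = "c * T" and T = T and r = r and ie = ie and
        Sa = "\<Sum>n<Q. (a n)\<^sup>2" and Sb = "\<Sum>n\<in>{Q..<Y}. (a n)\<^sup>2" and Sc = "\<Sum>n\<in>{Q..<Y}. a n" and
        Sd = "\<Sum>n\<in>{Y..<X}. (a n)\<^sup>2" and
        Off = "\<Sum>x\<in>{Y..<X}. \<Sum>y\<in>{Y..<X} - {x}. a x * a y * (2 / \<bar>l y - l x\<bar>)"])
    have "2 / (1 / ie) = 2 * ie" "16 / (1 / ie) = 16 * ie" "real k = real Q ^ 5" "2 * c * T = 2 * (c * T)"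
      by (simp_all add: k_def)
    with main show "(\<epsilon> / 2)\<^sup>2 * (c * T - 2 * ie) \<le> 3 * (
      real Q * (\<Sum>n<Q. (a n)\<^sup>2) * (2 * (c * T) / (real Q ^ 5 + 1) + 16 * ie) +
      ((\<Sum>n\<in>{Q..<Y}. (a n)\<^sup>2) * (c * T + 2 * ie) + (\<Sum>n\<in>{Q..<Y}. a n)\<^sup>2 * (2 * ie)) +
      ((\<Sum>n\<in>{Y..<X}. (a n)\<^sup>2) * T +
       (\<Sum>x\<in>{Y..<X}. \<Sum>y\<in>{Y..<X} - {x}. a x * a y * (2 / \<bar>l y - l x\<bar>))))"
      by (simp only:)
    show "16 * real Q \<le> r" unfolding r_def using pars(3) by linarith
    have "T * (real Q / r) \<le> T * c" using cR T0 by (intro mult_left_mono) auto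
    then show "T \<le> r * (c * T) / real Q" using rM Q256 by (simp add: field_simps)
    show "(\<Sum>n<Q. (a n)\<^sup>2) \<le> real Q ^ 3"
    proof -
      have "a n \<le> real Q" for n using a_mono[of n] a0_le Q\<alpha> by linarith
      then have "(\<Sum>n<Q. (a n)\<^sup>2) \<le> (\<Sum>n<Q. (real Q)\<^sup>2)"
        using a0 by (intro sum_mono power_mono) auto
      then show ?thesis by (simp add: power2_eq_square power3_eq_cube)
    qed
    have tail: "(\<Sum>n\<in>{q..<p}. (a n)\<^sup>2) \<le> 2 / sqrt (real q - 1)" if "q \<ge> 2" for p q
    proof -
      have "(\<Sum>n\<in>{q..<p}. (a n)\<^sup>2) \<le> (\<Sum>n\<in>{q..<p}. 1 / (real n * sqrt (real n)))"
        unfolding a_def using \<sigma> \<alpha> that by (intro sum_mono powr_square_le) auto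
      also note sum_powr_tail_le[OF that]
      finally show ?thesis .
    qed
    show "(\<Sum>n\<in>{Q..<Y}. (a n)\<^sup>2) \<le> 2 / sqrt (real Q - 1)" using Q256 by (intro tail) auto
    have "real Y = r ^ 4" by (simp add: Y_def r_def)
    then show "(\<Sum>n\<in>{Y..<X}. (a n)\<^sup>2) \<le> 2 / sqrt (r ^ 4 - 1)" using tail[of Y X] QY Q256 by simp
    show "(\<Sum>n\<in>{Q..<Y}. a n) \<le> r ^ 4"
    proof -
      have "(\<Sum>n\<in>{Q..<Y}. a n) \<le> (\<Sum>n\<in>{Q..<Y}. 1)"
      proof (rule sum_mono)
        fix n assume "n \<in> {Q..<Y}"
        then have "real n + \<alpha> \<ge> 1" using Q256 \<alpha> by auto
        then have "(real n + \<alpha>) powr (- \<sigma>) \<le> (real n + \<alpha>) powr 0" using \<sigma> by (intro powr_mono) auto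
        with \<open>real n + \<alpha> \<ge> 1\<close> show "a n \<le> 1" by (simp add: a_def)
      qed
      also have "\<dots> \<le> real Y" by simp
      finally show ?thesis using \<open>real Y = r ^ 4\<close> by simp
    qed
    show "(\<Sum>x\<in>{Y..<X}. \<Sum>y\<in>{Y..<X} - {x}. a x * a y * (2 / \<bar>l y - l x\<bar>)) \<le> T / r"
    proof -
      have "(\<Sum>x\<in>{Y..<X}. \<Sum>y\<in>{Y..<X} - {x}. a x * a y * (2 / \<bar>l y - l x\<bar>)) \<le> 2048 * real X powr (1 / 4)"
        unfolding a_def l_def using \<alpha> \<sigma> X2 QY by (intro off_diagonal_sum_le) auto
      also have "\<dots> \<le> 2048 * (2 * sqrt T)"
      proof (rule mult_left_mono)
        have "real X powr (1 / 4) \<le> (2 * T\<^sup>2) powr (1 / 4)" using X by (intro powr_mono2) auto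
        also have "\<dots> \<le> (16 * T\<^sup>2) powr (1 / 4)" using T0 by (intro powr_mono2) auto
        also have "16 * T\<^sup>2 = (4 * T)\<^sup>2" by (simp add: power2_eq_square)
        also have "(4 * T)\<^sup>2 = (4 * T) powr 2" using T0 by simp
        also have "((4 * T) powr 2) powr (1 / 4) = (4 * T) powr (1 / 2)" by (simp add: powr_powr)
        also have "\<dots> = 2 * sqrt T" using T0 by (simp add: powr_half_sqrt real_sqrt_mult)
        finally show "real X powr (1 / 4) \<le> 2 * sqrt T" .
      qed simp
      also have "\<dots> \<le> T / r"
      proof -
        have "4096 * r \<le> sqrt T"
        proof (rule real_le_rsqrt)
          have "4096 * r \<le> real M * real M" using rM Mr by (intro mult_mono) auto
          then have "(4096 * r)\<^sup>2 \<le> (real M * real M)\<^sup>2" using rM by (intro power_mono) auto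
          also have "\<dots> = real M ^ 4" by (simp add: power2_eq_square eval_nat_numeral)
          finally show "(4096 * r)\<^sup>2 \<le> T" using MT[of 4] by simp
        qed
        then have "4096 * r * sqrt T \<le> sqrt T * sqrt T" using T0 by (intro mult_right_mono) auto
        then show ?thesis using T0 rM by (simp add: field_simps)
      qed
      finally show ?thesis .
    qed
  qed (use Q256 ie0 ie_le T0 c0 \<epsilon> a0 in \<open>auto intro: sum_nonneg\<close>)
  with Q2 show False by simp
qed

section \<open>Shrinking the disc\<close>

lemma norm_hurwitz_zeta_le:
  assumes z: "1 / 2 \<le> Re z" "Re z \<le> 2" "1 \<le> \<bar>Im z\<bar>" and \<alpha>: "0 < \<alpha>" "\<alpha> \<le> 1" "1 / \<alpha> \<le> T"
  shows "norm (hurwitz_zeta z \<alpha>) \<le> T\<^sup>2 + 2 + 3 * norm z"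
proof -
  have z1: "z \<noteq> 1" using z by auto
  define b where "b = \<alpha> + 1"
  have b: "1 \<le> b" "b \<le> 2" using \<alpha> by (auto simp: b_def)
  have eq: "hurwitz_zeta z \<alpha> = complex_of_real \<alpha> powr (- z) + hurwitz_zeta z b"
    using hurwitz_zeta_shift[OF \<alpha>(1) z1, of 1] by (simp add: b_def)
  have n1: "norm (complex_of_real \<alpha> powr (- z)) \<le> T\<^sup>2"
  proof -
    have "1 \<le> 1 / \<alpha>" using \<alpha> by simp
    then have T1: "1 \<le> T" using \<alpha> by linarith
    have "norm (complex_of_real \<alpha> powr (- z)) = \<alpha> powr (- Re z)"
      using norm_real_powr[OF \<alpha>(1), of "- z"] by simp
    also have "\<dots> = (1 / \<alpha>) powr Re z" using \<alpha> by (simp add: powr_divide powr_minus_divide)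
    also have "\<dots> \<le> T powr Re z" using \<alpha> z by (intro powr_mono2) auto
    also have "\<dots> \<le> T powr 2" using T1 z by (intro powr_mono) auto
    finally show ?thesis using T1 by simp
  qed
  have n2: "norm (complex_of_real b powr (1 - z) / (z - 1)) \<le> 2"
  proof -
    have "b powr (1 - Re z) \<le> b powr 1" using b z by (intro powr_mono) auto
    then have "norm (complex_of_real b powr (1 - z)) \<le> 2"
      using norm_real_powr[of b "1 - z"] b by simp
    moreover have "1 \<le> norm (z - 1)" using abs_Im_le_cmod[of "z - 1"] z by simp
    ultimately have "norm (complex_of_real b powr (1 - z)) / norm (z - 1) \<le> 2 / 1"
      by (intro frac_le) auto
    then show ?thesis by (simp add: norm_divide)
  qed
  have n3: "norm (hurwitz_zeta z b - complex_of_real b powr (1 - z) / (z - 1)) \<le> norm z * (1 + 2)"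
  proof -
    have p: "b powr (- Re z - 1) \<le> b powr 0" "b powr (- Re z) \<le> b powr 0"
      by (rule powr_mono; use b z in linarith)+
    have "b powr (- Re z) / Re z \<le> 1 / (1 / 2)" using p b z by (intro frac_le) auto
    then have "b powr (- Re z - 1) + b powr (- Re z) / Re z \<le> 1 + 2" using p b by auto
    then have "norm z * (b powr (- Re z - 1) + b powr (- Re z) / Re z) \<le> norm z * (1 + 2)"
      by (intro mult_left_mono) auto
    moreover have "norm (hurwitz_zeta z b - complex_of_real b powr (1 - z) / (z - 1)) \<le>
        norm z * (b powr (- Re z - 1) + b powr (- Re z) / Re z)"
      using b z z1 by (intro hurwitz_zeta_approx) auto
    ultimately show ?thesis by linarith
  qed
  have n4: "norm (hurwitz_zeta z b) \<le> norm (complex_of_real b powr (1 - z) / (z - 1)) +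
      norm (hurwitz_zeta z b - complex_of_real b powr (1 - z) / (z - 1))"
    using norm_triangle_ineq[of "complex_of_real b powr (1 - z) / (z - 1)"
        "hurwitz_zeta z b - complex_of_real b powr (1 - z) / (z - 1)"] by simp
  have "norm (hurwitz_zeta z \<alpha>) \<le> norm (complex_of_real \<alpha> powr (- z)) + norm (hurwitz_zeta z b)"
    unfolding eq by (rule norm_triangle_ineq)
  also have "\<dots> \<le> T\<^sup>2 + (2 + norm z * (1 + 2))"
    by (rule add_mono[OF n1 order_trans[OF n4 add_mono[OF n2 n3]]])
  finally show ?thesis by simp
qed

text \<open>Cauchy's estimate for the derivative on discs of radius \<open>1 / 8\<close>, which stay away from the pole.\<close>

lemma hurwitz_zeta_lipschitz:
  assumes z0: "15 / 16 \<le> Re z0" "Re z0 \<le> 1" "2 \<le> \<bar>Im z0\<bar>" and \<alpha>: "0 < \<alpha>" "\<alpha> \<le> 1" "1 / \<alpha> \<le> T"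
    and z: "dist z0 z \<le> 1 / 8"
  shows "norm (hurwitz_zeta z \<alpha> - hurwitz_zeta z0 \<alpha>) \<le> 8 * (T\<^sup>2 + 3 + 3 * norm z0) * norm (z - z0)"
proof -
  define C where "C = T\<^sup>2 + 3 + 3 * norm z0"
  let ?f = "\<lambda>z. hurwitz_zeta z \<alpha>"
  have near: "1 / 2 \<le> Re y \<and> Re y \<le> 2 \<and> 1 \<le> \<bar>Im y\<bar> \<and> norm y \<le> norm z0 + 1 / 4"
    if "dist z0 y \<le> 1 / 4" for y
  proof -
    have "norm (z0 - y) \<le> 1 / 4" using that by (simp add: dist_norm)
    then have "\<bar>Re z0 - Re y\<bar> \<le> 1 / 4" "\<bar>Im z0 - Im y\<bar> \<le> 1 / 4"
      using abs_Re_le_cmod[of "z0 - y"] abs_Im_le_cmod[of "z0 - y"] by auto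
    moreover have "norm y \<le> norm z0 + norm (y - z0)"
      using norm_triangle_ineq[of z0 "y - z0"] by simp
    moreover have "norm (y - z0) \<le> 1 / 4" using \<open>norm (z0 - y) \<le> 1 / 4\<close> by (simp add: norm_minus_commute)
    ultimately show ?thesis using z0 by (intro conjI; linarith)
  qed
  have hol: "?f holomorphic_on - {1}" by (rule hurwitz_zeta_characterization(1)[OF \<alpha>(1)])
  have not1: "y \<noteq> 1" if "dist z0 y \<le> 1 / 4" for y using near[OF that] by auto
  have tri: "dist z0 x \<le> 1 / 4" if "dist z0 y \<le> 1 / 8" "dist y x \<le> 1 / 8" for x y
    using dist_triangle[of z0 x y] that by linarith
  have "norm (?f z - ?f z0) \<le> 8 * C * norm (z - z0)"
  proof (rule field_differentiable_bound)
    show "convex (cball z0 (1 / 8))" by (rule convex_cball)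
    fix y assume "y \<in> cball z0 (1 / 8)"
    then have y: "dist z0 y \<le> 1 / 8" by simp
    have "?f field_differentiable at y"
      using holomorphic_on_imp_differentiable_at[OF hol, of y] not1[of y] y by auto
    then show "(?f has_field_derivative deriv ?f y) (at y within cball z0 (1 / 8))"
      by (simp add: field_differentiable_derivI has_field_derivative_at_within)
    have sub: "cball y (1 / 8) \<subseteq> - {1}" using tri[OF y] not1 by auto
    have "norm ((deriv ^^ 1) ?f y) \<le> fact 1 * C / (1 / 8) ^ 1"
    proof (rule Cauchy_inequality)
      show "?f holomorphic_on ball y (1 / 8)"
        by (rule holomorphic_on_subset[OF hol]) (use sub in auto)
      show "continuous_on (cball y (1 / 8)) ?f"
        by (rule continuous_on_subset[OF holomorphic_on_imp_continuous_on[OF hol] sub])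
      fix x assume "norm (y - x) = 1 / 8"
      then have "dist z0 x \<le> 1 / 4" using tri[OF y, of x] by (simp add: dist_norm)
      with near[of x] have "norm (?f x) \<le> T\<^sup>2 + 2 + 3 * norm x" "norm x \<le> norm z0 + 1 / 4"
        using \<alpha> by (auto intro!: norm_hurwitz_zeta_le)
      then show "norm (?f x) \<le> C" unfolding C_def by linarith
    qed simp
    then show "norm (deriv ?f y) \<le> 8 * C" by simp
  qed (use z in auto)
  then show ?thesis by (simp add: C_def)
qed

text \<open>The Lipschitz constant depends on \<open>\<alpha>\<close> only through \<open>1 / \<alpha> \<le> T\<close>, so a single radius serves for all such
  \<open>\<alpha>\<close>.\<close>

lemma exists_common_radius:
  fixes \<sigma> t0 r \<epsilon> T :: real
  assumes \<sigma>: "15 / 16 \<le> \<sigma>" "\<sigma> \<le> 1" and r: "r > 0" and \<epsilon>: "\<epsilon> > 0" and T: "2 * \<bar>t0\<bar> + 4 \<le> T"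
  shows "\<exists>d. 0 < d \<and> d \<le> 1 \<and> (\<forall>\<alpha> \<tau> s. 0 < \<alpha> \<longrightarrow> \<alpha> \<le> 1 \<longrightarrow> 1 / \<alpha> \<le> T \<longrightarrow> \<tau> \<in> {T..2 * T} \<longrightarrow>
     s \<in> cball (Complex \<sigma> t0) (d * r) \<longrightarrow>
     norm (hurwitz_zeta (s + \<i> * complex_of_real \<tau>) \<alpha> -
       hurwitz_zeta (Complex \<sigma> t0 + \<i> * complex_of_real \<tau>) \<alpha>) < \<epsilon>)"
proof -
  define C where "C = T\<^sup>2 + 3 + 3 * (1 + 3 * T)"
  have C: "C > 0" using T by (auto simp: C_def intro!: add_nonneg_pos)
  define d where "d = min 1 (min (1 / (8 * r)) (\<epsilon> / (16 * C * r)))"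
  have d: "0 < d" "d \<le> 1" using r \<epsilon> C by (auto simp: d_def)
  have "d \<le> 1 / (8 * r)" "d \<le> \<epsilon> / (16 * C * r)" by (auto simp: d_def)
  from mult_right_mono[OF this(1), of r] mult_right_mono[OF this(2), of r]
  have dr: "d * r \<le> 1 / 8" and dr': "d * r \<le> \<epsilon> / (16 * C)" using r by simp_all
  have "8 * C * (d * r) \<le> 8 * C * (\<epsilon> / (16 * C))" using dr' C by (intro mult_left_mono) auto
  also have "\<dots> = \<epsilon> / 2" using C by simp
  finally have dr2: "8 * C * (d * r) \<le> \<epsilon> / 2" .
  show ?thesis
  proof (intro exI[of _ d] conjI allI impI d)
    fix \<alpha> \<tau> s assume \<alpha>: "0 < \<alpha>" "\<alpha> \<le> 1" "1 / \<alpha> \<le> T" and \<tau>: "\<tau> \<in> {T..2 * T}"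
      and s: "s \<in> cball (Complex \<sigma> t0) (d * r)"
    define z0 where "z0 = Complex \<sigma> t0 + \<i> * complex_of_real \<tau>"
    define z where "z = s + \<i> * complex_of_real \<tau>"
    have Re: "Re z0 = \<sigma>" "Im z0 = t0 + \<tau>" by (simp_all add: z0_def)
    have nz: "norm z0 \<le> 1 + 3 * T" using cmod_le[of z0] Re \<sigma> \<tau> T by auto
    have diff: "norm (z - z0) \<le> d * r" using s by (simp add: z_def z0_def dist_norm norm_minus_commute)
    have "norm (hurwitz_zeta z \<alpha> - hurwitz_zeta z0 \<alpha>) \<le> 8 * (T\<^sup>2 + 3 + 3 * norm z0) * norm (z - z0)"
      using Re \<sigma> \<tau> T \<alpha> diff dr by (intro hurwitz_zeta_lipschitz) (auto simp: dist_norm norm_minus_commute)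
    also have "\<dots> \<le> 8 * C * (d * r)"
      using nz diff C T unfolding C_def by (intro mult_mono) auto
    also have "\<dots> < \<epsilon>" using dr2 \<epsilon> by linarith
    finally show "norm (hurwitz_zeta (s + \<i> * complex_of_real \<tau>) \<alpha> -
       hurwitz_zeta (Complex \<sigma> t0 + \<i> * complex_of_real \<tau>) \<alpha>) < \<epsilon>"
      by (simp add: z_def z0_def)
  qed
qed

section \<open>Effective approximation\<close>

lemma add_one_le_power2: "N + 1 \<le> 2 ^ (N - 1)" if "N \<ge> 3" for N :: nat
  using that
proof (induction N rule: dec_induct)
  case base
  then show ?case by simp
next
  case (step N)
  have "Suc N + 1 \<le> 2 * (N + 1)" by simp
  also have "\<dots> \<le> 2 * 2 ^ (N - 1)" using step.IH by simp
  also have "\<dots> = 2 ^ (Suc N - 1)" using step.hyps by (cases N) auto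
  finally show ?case .
qed

text \<open>For small \<open>T\<close> the radius is only restricted by the continuity of \<open>f\<close>.\<close>

lemma choice_of_radius:
  fixes \<sigma> t0 r \<epsilon> :: real and f :: "complex \<Rightarrow> complex"
  assumes \<sigma>: "15 / 16 \<le> \<sigma>" "\<sigma> \<le> 1" and r: "r > 0" and \<epsilon>: "\<epsilon> > 0"
    and f: "continuous_on (cball (Complex \<sigma> t0) r) f"
  obtains \<delta> :: "real \<Rightarrow> real" where "\<And>T. 0 < \<delta> T" "\<And>T. \<delta> T \<le> 1"
    "\<And>T s. s \<in> cball (Complex \<sigma> t0) (\<delta> T * r) \<Longrightarrow> norm (f s - f (Complex \<sigma> t0)) < \<epsilon>"
    "\<And>T \<alpha> \<tau> s. 2 * \<bar>t0\<bar> + 4 \<le> T \<Longrightarrow> 0 < \<alpha> \<Longrightarrow> \<alpha> \<le> 1 \<Longrightarrow> 1 / \<alpha> \<le> T \<Longrightarrow> \<tau> \<in> {T..2 * T} \<Longrightarrow>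
      s \<in> cball (Complex \<sigma> t0) (\<delta> T * r) \<Longrightarrow>
      norm (hurwitz_zeta (s + \<i> * complex_of_real \<tau>) \<alpha> -
        hurwitz_zeta (Complex \<sigma> t0 + \<i> * complex_of_real \<tau>) \<alpha>) < \<epsilon>"
proof -
  let ?s0 = "Complex \<sigma> t0"
  obtain e where e: "e > 0" "\<And>s. s \<in> cball ?s0 r \<Longrightarrow> dist s ?s0 < e \<Longrightarrow> dist (f s) (f ?s0) < \<epsilon>"
    using f \<epsilon> r unfolding continuous_on_iff by (metis centre_in_cball less_imp_le)
  define df where "df = min 1 (e / (2 * r))"
  have df: "0 < df" "df \<le> 1" "df * r \<le> e / 2"
  proof -
    show "0 < df" "df \<le> 1" using e r by (auto simp: df_def)
    have "df \<le> e / (2 * r)" by (simp add: df_def)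
    from mult_right_mono[OF this, of r] show "df * r \<le> e / 2" using r by simp
  qed
  have "\<exists>d. 0 < d \<and> d \<le> 1 \<and> (2 * \<bar>t0\<bar> + 4 \<le> T \<longrightarrow> (\<forall>\<alpha> \<tau> s. 0 < \<alpha> \<longrightarrow> \<alpha> \<le> 1 \<longrightarrow> 1 / \<alpha> \<le> T \<longrightarrow>
     \<tau> \<in> {T..2 * T} \<longrightarrow> s \<in> cball ?s0 (d * r) \<longrightarrow>
     norm (hurwitz_zeta (s + \<i> * complex_of_real \<tau>) \<alpha> -
       hurwitz_zeta (?s0 + \<i> * complex_of_real \<tau>) \<alpha>) < \<epsilon>))" for T
    using exists_common_radius[OF \<sigma> r \<epsilon>, of t0 T]
    by (cases "2 * \<bar>t0\<bar> + 4 \<le> T") (blast, intro exI[of _ 1], simp)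
  then obtain dz where dz: "\<And>T. 0 < dz T" "\<And>T. dz T \<le> 1"
    "\<And>T \<alpha> \<tau> s. 2 * \<bar>t0\<bar> + 4 \<le> T \<Longrightarrow> 0 < \<alpha> \<Longrightarrow> \<alpha> \<le> 1 \<Longrightarrow> 1 / \<alpha> \<le> T \<Longrightarrow> \<tau> \<in> {T..2 * T} \<Longrightarrow>
      s \<in> cball ?s0 (dz T * r) \<Longrightarrow> norm (hurwitz_zeta (s + \<i> * complex_of_real \<tau>) \<alpha> -
        hurwitz_zeta (?s0 + \<i> * complex_of_real \<tau>) \<alpha>) < \<epsilon>"
    by metis
  define \<delta> where "\<delta> = (\<lambda>T. min df (dz T))"
  have sub: "\<delta> T * r \<le> df * r" "\<delta> T * r \<le> dz T * r" for T
    using r by (auto simp: \<delta>_def intro!: mult_right_mono)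
  show ?thesis
  proof (rule that[of \<delta>])
    show "0 < \<delta> T" "\<delta> T \<le> 1" for T using df dz[of T] by (auto simp: \<delta>_def)
    show "norm (f s - f ?s0) < \<epsilon>" if s: "s \<in> cball ?s0 (\<delta> T * r)" for T s
    proof -
      have "dist ?s0 s \<le> df * r" using s sub(1)[of T] by simp
      moreover have "df * r \<le> 1 * r" using df r by (intro mult_right_mono) auto
      ultimately have "dist ?s0 s \<le> r" "dist ?s0 s < e" using df e by linarith+
      with e(2)[of s] show ?thesis by (simp add: dist_norm norm_minus_commute)
    qed
    show "norm (hurwitz_zeta (s + \<i> * complex_of_real \<tau>) \<alpha> -
        hurwitz_zeta (?s0 + \<i> * complex_of_real \<tau>) \<alpha>) < \<epsilon>"
      if "2 * \<bar>t0\<bar> + 4 \<le> T" "0 < \<alpha>" "\<alpha> \<le> 1" "1 / \<alpha> \<le> T" "\<tau> \<in> {T..2 * T}"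
        "s \<in> cball ?s0 (\<delta> T * r)" for T \<alpha> \<tau> s
      by (rule dz(3)) (use that sub(2)[of T] in auto)
  qed
qed

text \<open>The exponent is at least \<open>1\<close>, as \<open>4 * (d - D) - 3\<close> lies between \<open>1\<close> and \<open>4 * d\<close>.\<close>

lemma base_le_powr:
  fixes b d D :: real
  assumes "1 \<le> b" "0 \<le> D" "D \<le> d - 1"
  shows "b \<le> b powr (4 * d / (4 * (d - D) - 3))"
proof -
  have "1 \<le> 4 * d / (4 * (d - D) - 3)" using assms by (simp add: field_simps)
  then have "b powr 1 \<le> b powr (4 * d / (4 * (d - D) - 3))" using assms by (intro powr_mono) auto
  then show ?thesis using assms by simp
qed

text \<open>The term \<open>2 ^ n\<close> in \<open>L / 2 \<ge> 2 ^ n + N\<close> pays for \<open>1 / \<alpha>\<close>, and \<open>N\<close> for everything that depends on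
  \<open>f\<close> and \<open>\<epsilon>\<close>.\<close>

lemma simultaneous_parameters:
  fixes \<epsilon> t0 A W :: real and n N :: nat
  defines "L \<equiv> 2 ^ (n + N) :: nat" and "Q \<equiv> 2 ^ 2 ^ (n + N) :: nat"
  assumes N: "N \<ge> 3" "W \<le> real N" "40 / \<epsilon> \<le> real N" "(240 / \<epsilon>\<^sup>2)\<^sup>2 + 2 \<le> real N" "2 * \<bar>t0\<bar> + 4 \<le> real N"
    and A: "1 / 2 ^ n \<le> A" and \<alpha>: "A \<le> \<alpha>" and \<epsilon>: "\<epsilon> > 0"
  shows "L \<ge> 8" "Q = 2 ^ L" "W + 1 / \<alpha> \<le> real L / 2" "1 / \<alpha> \<le> real Q" "40 / \<epsilon> \<le> real Q"
    "240 / \<epsilon>\<^sup>2 < sqrt (real Q - 1)" "2 * \<bar>t0\<bar> + 4 \<le> real Q"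
proof -
  show Q: "Q = 2 ^ L" by (simp add: Q_def L_def)
  have "L \<ge> 2 ^ N" unfolding L_def by (intro power_increasing) auto
  moreover have "(2::nat) ^ N \<ge> 2 ^ 3" using N by (intro power_increasing) auto
  ultimately show "L \<ge> 8" by simp
  have LQ: "L \<le> Q" unfolding Q by (rule less_imp_le[OF less_exp])
  have "N \<le> 2 ^ N" by (rule less_imp_le[OF less_exp])
  then have "N \<le> Q" using \<open>L \<ge> 2 ^ N\<close> LQ by linarith
  then have NQ: "real N \<le> real Q" by simp
  have A0: "A > 0" using A by (rule less_le_trans[rotated]) simp
  have "1 / \<alpha> \<le> 1 / A" using A0 \<alpha> by (intro divide_left_mono) auto
  also have "\<dots> \<le> 1 / (1 / 2 ^ n)" using A A0 by (intro divide_left_mono) auto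
  finally have \<alpha>n: "1 / \<alpha> \<le> 2 ^ n" by simp
  have "2 ^ n + N \<le> 2 ^ n * (N + 1)" by simp
  also have "\<dots> \<le> 2 ^ n * 2 ^ (N - 1)" using add_one_le_power2[OF N(1)] by (intro mult_left_mono) auto
  finally have "2 * (2 ^ n + N) \<le> 2 * (2 ^ n * 2 ^ (N - 1))" by simp
  also have "\<dots> = L" unfolding L_def using N(1) by (cases N) (simp_all add: power_add)
  finally have "real (2 * (2 ^ n + N)) \<le> real L" by (simp only: of_nat_le_iff)
  then have half: "2 ^ n + real N \<le> real L / 2" by simp
  then show "W + 1 / \<alpha> \<le> real L / 2" using \<alpha>n N by linarith
  have "real L \<le> real Q" using LQ by simp
  then show "1 / \<alpha> \<le> real Q" using half \<alpha>n by linarith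
  show "40 / \<epsilon> \<le> real Q" "2 * \<bar>t0\<bar> + 4 \<le> real Q" using N NQ by linarith+
  show "240 / \<epsilon>\<^sup>2 < sqrt (real Q - 1)"
    by (rule real_less_rsqrt) (use N NQ in linarith)
qed

lemma one_minus_xi_const_ge: "15 / 16 \<le> 1 - xi_const"
  by (simp add: xi_const_def)

text \<open>\<open>point_approximation\<close> with the parameters as computed by the programs. The lower bound for \<open>T\<close> also
  implies \<open>1 / \<alpha> \<le> T\<close>, by \<open>one_over_alg_le_bigK\<close>; this makes the radius \<open>\<delta> T\<close> small enough for \<open>\<alpha>\<close>.\<close>

lemma shifts_close_to_target:
  fixes \<sigma> t0 r \<epsilon> A H d T \<alpha> :: real and f :: "complex \<Rightarrow> complex" and \<delta> :: "real \<Rightarrow> real" and n N :: nat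
  defines "s0 \<equiv> Complex \<sigma> t0" and "Q \<equiv> 2 ^ 2 ^ (n + N) :: nat" and "M \<equiv> 2 ^ 2 ^ 2 ^ 2 ^ (n + N) :: nat"
  assumes \<sigma>: "15 / 16 \<le> \<sigma>" "\<sigma> \<le> 1" and \<epsilon>: "\<epsilon> > 0" and f0: "f s0 \<noteq> 0"
    and f\<delta>: "\<And>T s. s \<in> cball s0 (\<delta> T * r) \<Longrightarrow> norm (f s - f s0) < \<epsilon>"
    and \<zeta>\<delta>: "\<And>T \<alpha> \<tau> s. 2 * \<bar>t0\<bar> + 4 \<le> T \<Longrightarrow> 0 < \<alpha> \<Longrightarrow> \<alpha> \<le> 1 \<Longrightarrow> 1 / \<alpha> \<le> T \<Longrightarrow> \<tau> \<in> {T..2 * T} \<Longrightarrow>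
      s \<in> cball s0 (\<delta> T * r) \<Longrightarrow>
      norm (hurwitz_zeta (s + \<i> * complex_of_real \<tau>) \<alpha> - hurwitz_zeta (s0 + \<i> * complex_of_real \<tau>) \<alpha>) < \<epsilon>"
    and N: "N \<ge> 3" "norm (f s0) \<le> real N" "40 / \<epsilon> \<le> real N" "(240 / \<epsilon>\<^sup>2)\<^sup>2 + 2 \<le> real N" "2 * \<bar>t0\<bar> + 4 \<le> real N"
    and A: "1 / 2 ^ n \<le> A" and H: "\<forall>P\<in>difference_polys Q M. real_of_int (poly_height P) \<le> H"
    and \<alpha>: "\<alpha> \<in> admissible Q M \<inter> {A..1}" and D: "real (alg_degree \<alpha>) \<le> d - 1"
    and T: "(bigK H Q M \<alpha> * exp ((real M + 2) * exp (real Q ^ 2)))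
                     powr (4 * d / (4 * (d - real (alg_degree \<alpha>)) - 3)) \<le> T"
  shows "\<exists>\<tau>\<in>{T..2 * T}. \<forall>s\<in>cball s0 (\<delta> T * r).
     norm (hurwitz_zeta (s + \<i> * complex_of_real \<tau>) \<alpha> - f s) < 3 * \<epsilon>"
proof -
  define L :: nat where "L = 2 ^ (n + N)"
  have adm: "\<alpha> \<in> admissible Q M" and "A \<le> \<alpha>" using \<alpha> by auto
  note par = simultaneous_parameters[OF N A \<open>A \<le> \<alpha>\<close> \<epsilon>, folded Q_def L_def]
  have QL: "Q = 2 ^ L" by (simp add: Q_def L_def)
  have QM: "Q \<ge> 1" "M \<ge> 1" by (simp_all add: Q_def M_def)
  have M: "M = 2 ^ 2 ^ Q" by (simp add: M_def Q_def)
  have "Q \<le> 2 ^ Q" "2 ^ Q \<le> M" unfolding M by (rule less_imp_le[OF less_exp])+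
  then have QM': "Q \<le> M" by linarith
  note range = admissible_range[OF adm QM]
  have alg: "algebraic \<alpha>" using range(1) by (simp add: alg_irrationals_def)
  have H1: "H \<ge> 1" using height_bound_ge_1[OF QM] H by blast
  have Q256: "256 \<le> Q" unfolding QL using power_increasing[OF par(1), of "2::nat"] by simp
  have "1 * Q \<le> M * Q" using QM by (intro mult_right_mono) auto
  with Q256 have "4 \<le> M * Q + 1" by linarith
  note K = one_over_alg_le_bigK[OF alg range(2,3) H1 this]
  define E where "E = exp ((real M + 2) * exp (real Q ^ 2))"
  have E1: "1 \<le> E" unfolding E_def by simp
  have ME: "real M \<le> E"
  proof -
    have "real M ^ 1 \<le> real M ^ 20" using QM by (intro power_increasing) auto
    also have "\<dots> \<le> E" unfolding E_def using Q256 by (intro exp_power_dominates) auto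
    finally show ?thesis by simp
  qed
  define b where "b = bigK H Q M \<alpha> * E"
  have Kb: "bigK H Q M \<alpha> \<le> b" unfolding b_def using mult_left_mono[OF E1, of "bigK H Q M \<alpha>"] K by simp
  have Eb: "E \<le> b" unfolding b_def using mult_right_mono[OF K(2), of E] E1 by simp
  have "b \<le> b powr (4 * d / (4 * (d - real (alg_degree \<alpha>)) - 3))"
    using Kb K D by (intro base_le_powr) auto
  with T have bT: "b \<le> T" by (simp add: b_def E_def)
  obtain \<tau> where \<tau>: "\<tau> \<in> {T..2 * T}" "norm (hurwitz_zeta (s0 + \<i> * complex_of_real \<tau>) \<alpha> - f s0) < \<epsilon>"
  proof -
    have "\<exists>\<tau>\<in>{T..2 * T}. norm (hurwitz_zeta (Complex \<sigma> t0 + \<i> * complex_of_real \<tau>) \<alpha> - f s0) < \<epsilon>"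
      by (rule point_approximation[OF \<sigma> par(1), folded QL, folded M, OF adm H1 \<epsilon> f0 par(3-6)])
         (use par(7) bT in \<open>simp_all add: b_def E_def\<close>)
    then show ?thesis using that unfolding s0_def by blast
  qed
  have "real Q \<le> T" using QM' ME Eb bT by linarith
  then have T4: "2 * \<bar>t0\<bar> + 4 \<le> T" using par(7) by linarith
  have "1 \<le> \<alpha> * T"
  proof -
    have "\<alpha> * bigK H Q M \<alpha> \<le> \<alpha> * T" using Kb bT range by (intro mult_left_mono) auto
    with K(1) show ?thesis by linarith
  qed
  then have \<alpha>T: "1 / \<alpha> \<le> T" using range by (simp add: field_simps)
  show ?thesis
  proof (intro bexI[OF _ \<tau>(1)] ballI)
    fix s assume s: "s \<in> cball s0 (\<delta> T * r)"
    let ?z = "hurwitz_zeta (s + \<i> * complex_of_real \<tau>) \<alpha>"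
    let ?y = "hurwitz_zeta (s0 + \<i> * complex_of_real \<tau>) \<alpha>"
    have "norm (?z - f s) \<le> norm (?z - ?y) + norm (?y - f s0) + norm (f s0 - f s)"
      using norm_triangle_ineq[of "?z - ?y" "(?y - f s0) + (f s0 - f s)"]
        norm_triangle_ineq[of "?y - f s0" "f s0 - f s"] by simp
    moreover have "norm (?z - ?y) < \<epsilon>" by (rule \<zeta>\<delta>[OF T4 range(2,3) \<alpha>T \<tau>(1) s])
    moreover have "norm (f s0 - f s) < \<epsilon>" using f\<delta>[OF s] by (simp add: norm_minus_commute)
    ultimately show "norm (?z - f s) < 3 * \<epsilon>" using \<tau>(2) by linarith
  qed
qed

theorem theorem2:
  "\<exists>(pQ :: recfn) (pM :: recfn) (c5 :: nat \<Rightarrow> real \<Rightarrow> real) (\<nu> :: nat \<Rightarrow> real \<Rightarrow> real).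
     computable_nat_real c5 {3..} \<and> computable_nat_real \<nu> {3..} \<and>
     (\<forall>N\<ge>1. \<forall>d\<ge>3. c5 N d > 0 \<and> \<nu> N d > 0) \<and>
     (\<forall>(\<sigma>0 :: real) (t0 :: real) (s0 :: complex) (r :: real) (f :: complex \<Rightarrow> complex)
        (\<epsilon> :: real) (d0 :: ereal).
        1 - xi_const \<le> \<sigma>0 \<and> \<sigma>0 \<le> 1 \<and> s0 = Complex \<sigma>0 t0 \<and> r > 0 \<and>
        continuous_on (cball s0 r) f \<and> f analytic_on interior (cball s0 r) \<and>
        0 < \<epsilon> \<and> \<epsilon> < cmod (f s0) \<and> is_d0 \<sigma>0 d0 \<longrightarrow>
        (\<exists>(N0 :: nat) (\<delta> :: real \<Rightarrow> real).
           (\<forall>T. 0 < \<delta> T \<and> \<delta> T \<le> 1) \<and>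
           (\<forall>N\<ge>N0. N \<ge> 1 \<longrightarrow> (\<forall>A. 0 < A \<and> A < 1 \<longrightarrow>
              (\<forall>g. is_name g (input_data \<sigma>0 A \<epsilon> f s0 N) \<longrightarrow>
                (\<exists>Q M :: nat.
                   rec_eval g pQ [N] Q \<and> rec_eval g pM [N] M \<and> Q \<ge> 2 \<and> M \<ge> 1 \<and>
                   finite {\<alpha> \<in> {A..1}. algebraic \<alpha> \<and> \<alpha> \<notin> \<rat> \<and>
                             ereal (real (alg_degree \<alpha>)) \<le> d0 - 1 \<and> \<alpha> \<notin> admissible Q M} \<and>
                   (\<forall>H :: real. (\<forall>P\<in>difference_polys Q M. real_of_int (poly_height P) \<le> H) \<longrightarrow>
                     (\<forall>d :: real. 3 \<le> d \<and> ereal d \<le> d0 \<longrightarrow>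
                       (\<forall>\<alpha>\<in>admissible Q M \<inter> {A..1}. real (alg_degree \<alpha>) \<le> d - 1 \<longrightarrow>
                         (\<forall>T :: real.
                            T \<ge> c5 N d *
                              max ((bigK H Q M \<alpha> * exp ((real M + 2) * exp (real Q ^ 2)))
                                     powr (4 * d / (4 * (d - real (alg_degree \<alpha>)) - 3)))
                                  (\<epsilon> powr (- 2 * \<nu> N d)) \<longrightarrow>
                            (\<exists>\<tau>\<in>{T..2 * T}. \<forall>s\<in>cball s0 (\<delta> T * r).
                               cmod (hurwitz_zeta (s + \<i> * complex_of_real \<tau>) \<alpha> - f s)
                                 < 3 * \<epsilon>)))))))))))"
proof (rule exI[of _ rf_Q], rule exI[of _ rf_M], rule exI[of _ "\<lambda>_ _. 1"],
    rule exI[of _ "\<lambda>_ _. 1"], intro conjI allI impI)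
  show "computable_nat_real (\<lambda>_ _. 1) {3..}" "computable_nat_real (\<lambda>_ _. 1) {3..}"
    by (rule computable_nat_real_one)+
  show "(0::real) < 1" "(0::real) < 1" by simp_all
next
  fix \<sigma>0 t0 r \<epsilon> :: real and s0 :: complex and f :: "complex \<Rightarrow> complex" and d0 :: ereal
  assume asm: "1 - xi_const \<le> \<sigma>0 \<and> \<sigma>0 \<le> 1 \<and> s0 = Complex \<sigma>0 t0 \<and> r > 0 \<and>
        continuous_on (cball s0 r) f \<and> f analytic_on interior (cball s0 r) \<and>
        0 < \<epsilon> \<and> \<epsilon> < cmod (f s0) \<and> is_d0 \<sigma>0 d0"
  have "1 - xi_const \<le> \<sigma>0" using asm by (elim conjE)
  with one_minus_xi_const_ge have \<sigma>: "15 / 16 \<le> \<sigma>0" by linarith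
  have \<sigma>': "\<sigma>0 \<le> 1" using asm by (elim conjE)
  have s0: "s0 = Complex \<sigma>0 t0" using asm by (elim conjE)
  have r: "r > 0" using asm by (elim conjE)
  have fc: "continuous_on (cball s0 r) f" using asm by (elim conjE)
  have \<epsilon>: "\<epsilon> > 0" using asm by (elim conjE)
  have f\<epsilon>: "\<epsilon> < cmod (f s0)" using asm by (elim conjE)
  have f: "continuous_on (cball (Complex \<sigma>0 t0) r) f" using fc unfolding s0 .
  have f0: "f (Complex \<sigma>0 t0) \<noteq> 0" using f\<epsilon> \<epsilon> unfolding s0 by auto
  define N0 where "N0 = max 3 (nat \<lceil>max (max (norm (f (Complex \<sigma>0 t0))) (40 / \<epsilon>))
      (max ((240 / \<epsilon>\<^sup>2)\<^sup>2 + 2) (2 * \<bar>t0\<bar> + 4))\<rceil>)"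
  have N0: "N \<ge> 3" "norm (f (Complex \<sigma>0 t0)) \<le> real N" "40 / \<epsilon> \<le> real N"
    "(240 / \<epsilon>\<^sup>2)\<^sup>2 + 2 \<le> real N" "2 * \<bar>t0\<bar> + 4 \<le> real N" if "N \<ge> N0" for N
  proof -
    show "N \<ge> 3" using that by (simp add: N0_def)
    have "max (max (norm (f (Complex \<sigma>0 t0))) (40 / \<epsilon>)) (max ((240 / \<epsilon>\<^sup>2)\<^sup>2 + 2) (2 * \<bar>t0\<bar> + 4)) \<le> real N0"
      unfolding N0_def by (rule order_trans[OF real_nat_ceiling_ge of_nat_mono[OF max.cobounded2]])
    also have "\<dots> \<le> real N" using that by simp
    finally show "norm (f (Complex \<sigma>0 t0)) \<le> real N" "40 / \<epsilon> \<le> real N"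
      "(240 / \<epsilon>\<^sup>2)\<^sup>2 + 2 \<le> real N" "2 * \<bar>t0\<bar> + 4 \<le> real N" by simp_all
  qed
  show "\<exists>(N0 :: nat) (\<delta> :: real \<Rightarrow> real).
           (\<forall>T. 0 < \<delta> T \<and> \<delta> T \<le> 1) \<and>
           (\<forall>N\<ge>N0. N \<ge> 1 \<longrightarrow> (\<forall>A. 0 < A \<and> A < 1 \<longrightarrow>
              (\<forall>g. is_name g (input_data \<sigma>0 A \<epsilon> f s0 N) \<longrightarrow>
                (\<exists>Q M :: nat.
                   rec_eval g rf_Q [N] Q \<and> rec_eval g rf_M [N] M \<and> Q \<ge> 2 \<and> M \<ge> 1 \<and>
                   finite {\<alpha> \<in> {A..1}. algebraic \<alpha> \<and> \<alpha> \<notin> \<rat> \<and>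
                             ereal (real (alg_degree \<alpha>)) \<le> d0 - 1 \<and> \<alpha> \<notin> admissible Q M} \<and>
                   (\<forall>H :: real. (\<forall>P\<in>difference_polys Q M. real_of_int (poly_height P) \<le> H) \<longrightarrow>
                     (\<forall>d :: real. 3 \<le> d \<and> ereal d \<le> d0 \<longrightarrow>
                       (\<forall>\<alpha>\<in>admissible Q M \<inter> {A..1}. real (alg_degree \<alpha>) \<le> d - 1 \<longrightarrow>
                         (\<forall>T :: real.
                            T \<ge> 1 *
                              max ((bigK H Q M \<alpha> * exp ((real M + 2) * exp (real Q ^ 2)))
                                     powr (4 * d / (4 * (d - real (alg_degree \<alpha>)) - 3)))
                                  (\<epsilon> powr (- 2 * 1)) \<longrightarrow>
                            (\<exists>\<tau>\<in>{T..2 * T}. \<forall>s\<in>cball s0 (\<delta> T * r).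
                               cmod (hurwitz_zeta (s + \<i> * complex_of_real \<tau>) \<alpha> - f s)
                                 < 3 * \<epsilon>)))))))))"
  proof (rule choice_of_radius[OF \<sigma> \<sigma>' r \<epsilon> f])
    fix \<delta> :: "real \<Rightarrow> real"
    assume \<delta>: "\<And>T. 0 < \<delta> T" "\<And>T. \<delta> T \<le> 1"
    "\<And>T s. s \<in> cball (Complex \<sigma>0 t0) (\<delta> T * r) \<Longrightarrow> norm (f s - f (Complex \<sigma>0 t0)) < \<epsilon>"
    "\<And>T \<alpha> \<tau> s. 2 * \<bar>t0\<bar> + 4 \<le> T \<Longrightarrow> 0 < \<alpha> \<Longrightarrow> \<alpha> \<le> 1 \<Longrightarrow> 1 / \<alpha> \<le> T \<Longrightarrow> \<tau> \<in> {T..2 * T} \<Longrightarrow>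
      s \<in> cball (Complex \<sigma>0 t0) (\<delta> T * r) \<Longrightarrow>
      norm (hurwitz_zeta (s + \<i> * complex_of_real \<tau>) \<alpha> -
        hurwitz_zeta (Complex \<sigma>0 t0 + \<i> * complex_of_real \<tau>) \<alpha>) < \<epsilon>"
    show ?thesis
    proof (rule exI[of _ N0], rule exI[of _ \<delta>], intro conjI allI impI)
      show "0 < \<delta> T" "\<delta> T \<le> 1" for T by (rule \<delta>)+
      fix N A g assume N: "N0 \<le> N" and "1 \<le> N" and A: "0 < A \<and> A < 1"
        and g: "is_name g (input_data \<sigma>0 A \<epsilon> f s0 N)"
      have data: "1 < length (input_data \<sigma>0 A \<epsilon> f s0 N)" "input_data \<sigma>0 A \<epsilon> f s0 N ! 1 = A"
        by (simp_all add: input_data_def)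
      have pos: "input_data \<sigma>0 A \<epsilon> f s0 N ! 1 > 0" unfolding data(2) using A by (rule conjunct1)
      obtain n where n: "1 / 2 ^ n \<le> A" "rec_eval g rf_Q [N] (2 ^ 2 ^ (n + N))"
        "rec_eval g rf_M [N] (2 ^ 2 ^ 2 ^ 2 ^ (n + N))"
        by (rule rec_eval_Q_M[OF g data(1) pos, where N = N, unfolded data(2)])
      let ?Q = "2 ^ 2 ^ (n + N) :: nat" and ?M = "2 ^ 2 ^ 2 ^ 2 ^ (n + N) :: nat"
      have fin: "finite {\<alpha> \<in> {A..1}. algebraic \<alpha> \<and> \<alpha> \<notin> \<rat> \<and>
          ereal (real (alg_degree \<alpha>)) \<le> d0 - 1 \<and> \<alpha> \<notin> admissible ?Q ?M}"
        by (rule finite_subset[OF _ finite_exceptional[of A ?Q ?M]]) (use A in auto)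
      have Q2: "?Q \<ge> 2" by (rule self_le_power) simp_all
      have M1: "?M \<ge> 1" by (rule one_le_power) simp
      have close: "\<exists>\<tau>\<in>{T..2 * T}. \<forall>s\<in>cball s0 (\<delta> T * r).
          cmod (hurwitz_zeta (s + \<i> * complex_of_real \<tau>) \<alpha> - f s) < 3 * \<epsilon>"
        if "\<forall>P\<in>difference_polys ?Q ?M. real_of_int (poly_height P) \<le> H"
          "\<alpha> \<in> admissible ?Q ?M \<inter> {A..1}" "real (alg_degree \<alpha>) \<le> d - 1"
          "1 * max ((bigK H ?Q ?M \<alpha> * exp ((real ?M + 2) * exp (real ?Q ^ 2)))
              powr (4 * d / (4 * (d - real (alg_degree \<alpha>)) - 3))) (\<epsilon> powr (- 2 * 1)) \<le> T" for H d \<alpha> T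
        unfolding s0
        by (rule shifts_close_to_target[where f = f and \<delta> = \<delta> and r = r and \<sigma> = \<sigma>0 and ?t0.0 = t0,
              OF \<sigma> \<sigma>' \<epsilon> f0 \<delta>(3) \<delta>(4) N0[OF N] n(1) that(1-3)])
           (use that(4) in \<open>simp_all only: mult_1 max.bounded_iff\<close>)
      show "\<exists>Q M :: nat.
                     rec_eval g rf_Q [N] Q \<and> rec_eval g rf_M [N] M \<and> Q \<ge> 2 \<and> M \<ge> 1 \<and>
                     finite {\<alpha> \<in> {A..1}. algebraic \<alpha> \<and> \<alpha> \<notin> \<rat> \<and>
                               ereal (real (alg_degree \<alpha>)) \<le> d0 - 1 \<and> \<alpha> \<notin> admissible Q M} \<and>
                     (\<forall>H :: real. (\<forall>P\<in>difference_polys Q M. real_of_int (poly_height P) \<le> H) \<longrightarrow>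
                       (\<forall>d :: real. 3 \<le> d \<and> ereal d \<le> d0 \<longrightarrow>
                         (\<forall>\<alpha>\<in>admissible Q M \<inter> {A..1}. real (alg_degree \<alpha>) \<le> d - 1 \<longrightarrow>
                           (\<forall>T :: real.
                              T \<ge> 1 *
                                max ((bigK H Q M \<alpha> * exp ((real M + 2) * exp (real Q ^ 2)))
                                       powr (4 * d / (4 * (d - real (alg_degree \<alpha>)) - 3)))
                                    (\<epsilon> powr (- 2 * 1)) \<longrightarrow>
                              (\<exists>\<tau>\<in>{T..2 * T}. \<forall>s\<in>cball s0 (\<delta> T * r).
                                 cmod (hurwitz_zeta (s + \<i> * complex_of_real \<tau>) \<alpha> - f s)
                                   < 3 * \<epsilon>)))))"
      proof (rule exI[of _ ?Q], rule exI[of _ ?M], intro conjI n(2,3) fin Q2 M1 allI impI ballI)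
        fix H d \<alpha> T
        assume "\<forall>P\<in>difference_polys ?Q ?M. real_of_int (poly_height P) \<le> H"
          "\<alpha> \<in> admissible ?Q ?M \<inter> {A..1}" "real (alg_degree \<alpha>) \<le> d - 1"
          "1 * max ((bigK H ?Q ?M \<alpha> * exp ((real ?M + 2) * exp (real ?Q ^ 2)))
              powr (4 * d / (4 * (d - real (alg_degree \<alpha>)) - 3))) (\<epsilon> powr (- 2 * 1)) \<le> T"
        then show "\<exists>\<tau>\<in>{T..2 * T}. \<forall>s\<in>cball s0 (\<delta> T * r).
            cmod (hurwitz_zeta (s + \<i> * complex_of_real \<tau>) \<alpha> - f s) < 3 * \<epsilon>"
          by (rule close)
      qed
    qed
  qed
qed

end
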